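(* Let $\mu$ be a compactly supported Borel probability measure on $\mathbb R$ with $m_1=0$, $m_2=1$, let $X_1,X_2,\dots$ be free random variables each with distribution $\mu$, and let $\mu_n$ be the distribution of $Y_n=(X_1+\dots+X_n)/\sqrt n$, with density $p_n$. There exist positive constants $c_1(\mu),c(\mu)$ depending only on $\mu$ such that, for all integers $n\ge c_1(\mu)$, $$\chi(\mu_n)=\iint_{\mathbb R\times\mathbb R}\log|x-y|\,p_n(x)p_n(y)\,dx\,dy+\frac34+\frac12\log2\pi=\chi(\mu_w)-\frac{m_3^2}{6n}+\theta\,\frac{c(\mu)}{n^{3/2}},$$ where $\theta$ is a real quantity with $|\theta|\le1$.
   Context: For a probability measure $\mu$ on $\mathbb R$: $m_k=\int u^k\,\mu(du)$. If $X_1,\dots,X_n$ are free with common distribution $\mu$, the distribution of $X_1+\dots+X_n$ is the $n$-fold free additive convolution $\mu^{n\boxplus}$, and $\mu_n((-\infty,x))=\mu^{n\boxplus}((-\infty,\sqrt n\,x))$. It is known that, since $\mu$ is not a Dirac measure, $\mu_n$ is absolutely continuous with respect to Lebesgue measure for all sufficiently large $n$, $n\ge c_1(\mu)$; $p_n$ denotes its density. The free entropy of a probability measure $\nu$ on $\mathbb R$ is $\chi(\nu)=\iint_{\mathbb R\times\mathbb R}\log|x-y|\,\nu(dx)\nu(dy)+\frac34+\frac12\log2\pi$. $\mu_w$ is the standard semicircle measure, with density $p_w(x)=\frac1{2\pi}\sqrt{(4-x^2)_+}$; $\chi(\mu_w)=\frac12\log 2\pi e$. *)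

theory Defs
  imports "HOL-Probability.Probability" "HOL-Library.Poly_Mapping" "HOL-Library.Nonpos_Ints"
begin

section \<open>Laws of self-adjoint noncommutative random variables\<close>

definition compactly_supported :: "real measure \<Rightarrow> bool" where
  "compactly_supported \<nu> \<longleftrightarrow> (\<exists>K. compact K \<and> (AE x in \<nu>. x \<in> K))"

definition moment :: "real measure \<Rightarrow> nat \<Rightarrow> real" where
  "moment \<nu> k = (LINT u|\<nu>. u ^ k)"

text \<open>
  A noncommutative \<open>*\<close>-probability space: a unital complex \<open>*\<close>-algebra with a state \<open>\<phi>\<close>.
  The ring structure is that of the type; the complex scalar multiplication and the
  involution are parameters.  Every \<open>C\<^sup>*\<close>- or \<open>W\<^sup>*\<close>-probability space is of this kind.
\<close>

locale star_prob_space = vector_space scale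
  for scale :: "complex \<Rightarrow> 'a :: ring_1 \<Rightarrow> 'a" +
  fixes star :: "'a \<Rightarrow> 'a" and \<phi> :: "'a \<Rightarrow> complex"
  assumes scale_mult_left: "scale c a * b = scale c (a * b)"
    and scale_mult_right: "a * scale c b = scale c (a * b)"
    and star_star: "star (star a) = a"
    and star_add: "star (a + b) = star a + star b"
    and star_scale: "star (scale c a) = scale (cnj c) (star a)"
    and star_mult: "star (a * b) = star b * star a"
    and state_linear: "Vector_Spaces.linear scale (*) \<phi>"
    and state_one: "\<phi> 1 = 1"
    and state_nonneg: "\<phi> (star a * a) \<in> \<real>\<^sub>\<ge>\<^sub>0"
begin

text \<open>
  A compactly supported probability measure is determined by its moments, so a self-adjoint
  element has at most one law in the following sense; for a self-adjoint element of a
  \<open>C\<^sup>*\<close>-probability space it is the usual spectral distribution.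
\<close>

definition has_law :: "'a \<Rightarrow> real measure \<Rightarrow> bool" where
  "has_law a \<nu> \<longleftrightarrow> star a = a \<and> real_distribution \<nu> \<and> compactly_supported \<nu> \<and>
     (\<forall>k. \<phi> (a ^ k) = complex_of_real (moment \<nu> k))"

text \<open>
  Freeness of the unital subalgebras generated by the single elements \<open>X i\<close>: a product of
  centred elements of these subalgebras, with neighbouring factors taken from different
  subalgebras, is centred.  A factor is given together with the index of its subalgebra.
\<close>

definition free_family :: "('i \<Rightarrow> 'a) \<Rightarrow> bool" where
  "free_family X \<longleftrightarrow> (\<forall>ws. ws \<noteq> [] \<longrightarrow> distinct_adj (map fst ws) \<longrightarrow>
     (\<forall>(i, a) \<in> set ws. a \<in> span (range (\<lambda>k. X i ^ k)) \<and> \<phi> a = 0) \<longrightarrow>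
     \<phi> (prod_list (map snd ws)) = 0)"

end

locale free_iid_sequence = star_prob_space scale star \<phi>
  for scale :: "complex \<Rightarrow> 'a :: ring_1 \<Rightarrow> 'a" and star \<phi> +
  fixes X :: "nat \<Rightarrow> 'a" and \<mu> :: "real measure"
  assumes free: "free_family X"
    and law: "has_law (X i) \<mu>"
begin

text \<open>The sequence is indexed from \<open>0\<close>, so this is \<open>(X\<^sub>1 + \<dots> + X\<^sub>n) / \<surd>n\<close>.\<close>

definition normalized_sum :: "nat \<Rightarrow> 'a" where
  "normalized_sum n = scale (complex_of_real (1 / sqrt (real n))) (\<Sum>i<n. X i)"

end

section \<open>The law of the normalized sum as a notion depending on \<open>\<mu>\<close> and \<open>n\<close> only\<close>

text \<open>
  Constants that depend on \<open>\<mu>\<close> alone have to be chosen before the space carrying the \<open>X i\<close>,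
  but a quantifier inside a formula cannot range over types.  The definition of
  \<open>normalized_sum_law\<close> therefore fixes one type: the noncommutative polynomials
  in countably many indeterminates (only its ring structure; the scalar multiplication,
  involution, state and sequence are arbitrary).
  Theorem \<open>normalized_sum_lawI\<close> below shows that this is no restriction.
\<close>

datatype ncmonom = Monom "nat list"

instantiation ncmonom :: monoid_add
begin

definition zero_ncmonom :: ncmonom where "0 = Monom []"

fun plus_ncmonom :: "ncmonom \<Rightarrow> ncmonom \<Rightarrow> ncmonom" where
  "Monom v + Monom w = Monom (v @ w)"

instance
proof
  fix a b c :: ncmonom
  show "a + b + c = a + (b + c)" by (cases a; cases b; cases c) simp
  show "0 + a = a" "a + 0 = a" by (cases a; simp add: zero_ncmonom_def)+
qed

end

type_synonym ncpoly = "ncmonom \<Rightarrow>\<^sub>0 complex"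

definition normalized_sum_law :: "real measure \<Rightarrow> nat \<Rightarrow> real measure \<Rightarrow> bool" where
  "normalized_sum_law \<mu> n \<nu> \<longleftrightarrow>
     (\<exists>(scale :: complex \<Rightarrow> ncpoly \<Rightarrow> ncpoly) star \<phi> X.
        free_iid_sequence scale star \<phi> X \<mu> \<and>
        star_prob_space.has_law star \<phi> (free_iid_sequence.normalized_sum scale X n) \<nu>)"

section \<open>Free entropy\<close>

text \<open>The logarithm is \<open>-\<infinity>\<close> on the diagonal, whereas \<open>ln 0 = 0\<close> in the library.\<close>

definition log_dist :: "real \<times> real \<Rightarrow> ereal" where
  "log_dist = (\<lambda>(x, y). if x = y then -\<infinity> else ereal (ln \<bar>x - y\<bar>))"

text \<open>
  The double integral is the integral of the positive part minus that of the negative part;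
  for compactly supported \<open>\<nu>\<close> the former is finite, so the value lies in \<open>[-\<infinity>, \<infinity>)\<close>.
\<close>

definition free_entropy :: "real measure \<Rightarrow> ereal" where
  "free_entropy \<nu> =
     enn2ereal (\<integral>\<^sup>+ z. e2ennreal (log_dist z) \<partial>(\<nu> \<Otimes>\<^sub>M \<nu>)) -
     enn2ereal (\<integral>\<^sup>+ z. e2ennreal (- log_dist z) \<partial>(\<nu> \<Otimes>\<^sub>M \<nu>)) +
     ereal (3 / 4 + ln (2 * pi) / 2)"

definition semicircle :: "real measure" where
  "semicircle = density lborel (\<lambda>x. ennreal (sqrt (max 0 (4 - x\<^sup>2)) / (2 * pi)))"

section \<open>Independence of the underlying space\<close>

text \<open>Linear extension from monomials; \<open>f w c\<close> is the image of \<open>c w\<close>.\<close>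

definition lin_ext :: "(ncmonom \<Rightarrow> complex \<Rightarrow> 'b :: comm_monoid_add) \<Rightarrow> ncpoly \<Rightarrow> 'b" where
  "lin_ext f p = (\<Sum>w\<in>Poly_Mapping.keys p. f w (Poly_Mapping.lookup p w))"

lemma lin_ext_add:
  assumes "\<And>w. f w 0 = 0" "\<And>w c d. f w (c + d) = f w c + f w d"
  shows "lin_ext f (p + q) = lin_ext f p + lin_ext f q"
  unfolding lin_ext_def by (rule setsum_keys_plus_distrib) (use assms in auto)

lemma lin_ext_single:
  assumes "\<And>w. f w 0 = 0"
  shows "lin_ext f (Poly_Mapping.single w c) = f w c"
  unfolding lin_ext_def using assms by (cases "c = 0") auto

lemma ncpoly_induct [case_names single add]:
  fixes p :: ncpoly
  assumes "\<And>w c. P (Poly_Mapping.single w c)"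
    and "\<And>p q. P p \<Longrightarrow> P q \<Longrightarrow> P (p + q)"
  shows "P p"
proof (induction p rule: Poly_Mapping.update_induct)
  case const
  show ?case using assms(1)[of 0 0] by simp
next
  case (update p w c)
  have "Poly_Mapping.update w c p = p + Poly_Mapping.single w c"
    using update(1)
    by (intro poly_mapping_eqI)
      (auto simp: lookup_update lookup_add lookup_single when_def in_keys_iff)
  then show ?case using assms update by simp
qed

fun rev_monom :: "ncmonom \<Rightarrow> ncmonom" where
  "rev_monom (Monom w) = Monom (rev w)"

definition nc_scale :: "complex \<Rightarrow> ncpoly \<Rightarrow> ncpoly" where
  "nc_scale c p = Poly_Mapping.single 0 c * p"

definition nc_star :: "ncpoly \<Rightarrow> ncpoly" where
  "nc_star = lin_ext (\<lambda>w c. Poly_Mapping.single (rev_monom w) (cnj c))"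

definition nc_var :: "nat \<Rightarrow> ncpoly" where
  "nc_var i = Poly_Mapping.single (Monom [i]) 1"

lemma rev_monom_add: "rev_monom (v + w) = rev_monom w + rev_monom v"
  by (cases v; cases w) simp

lemma rev_monom_rev [simp]: "rev_monom (rev_monom w) = w"
  by (cases w) simp

lemma nc_scale_single: "nc_scale c (Poly_Mapping.single w d) = Poly_Mapping.single w (c * d)"
  by (simp add: nc_scale_def mult_single)

lemma nc_scale_add: "nc_scale c (p + q) = nc_scale c p + nc_scale c q"
  by (simp add: nc_scale_def distrib_left)

lemma nc_star_add: "nc_star (p + q) = nc_star p + nc_star q"
  unfolding nc_star_def by (rule lin_ext_add) (simp_all add: single_add)

lemma nc_star_single:
  "nc_star (Poly_Mapping.single w c) = Poly_Mapping.single (rev_monom w) (cnj c)"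
  unfolding nc_star_def by (rule lin_ext_single) simp

lemma nc_star_mult: "nc_star (p * q) = nc_star q * nc_star p"
proof (induction p rule: ncpoly_induct)
  case (single v c)
  show ?case
    by (induction q rule: ncpoly_induct)
      (simp_all add: mult_single nc_star_single nc_star_add rev_monom_add distrib_left
        distrib_right mult.commute)
qed (simp add: nc_star_add distrib_left distrib_right)

context star_prob_space
begin

context
  fixes X :: "nat \<Rightarrow> 'a"
begin

fun monom_value :: "ncmonom \<Rightarrow> 'a" where
  "monom_value (Monom w) = prod_list (map X w)"

definition nc_eval :: "ncpoly \<Rightarrow> 'a" where
  "nc_eval = lin_ext (\<lambda>w c. scale c (monom_value w))"

lemma monom_value_add: "monom_value (v + w) = monom_value v * monom_value w"
  by (cases v; cases w) simp

lemma nc_eval_add: "nc_eval (p + q) = nc_eval p + nc_eval q"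
  unfolding nc_eval_def by (rule lin_ext_add) (simp_all add: scale_left_distrib)

lemma nc_eval_single: "nc_eval (Poly_Mapping.single w c) = scale c (monom_value w)"
  unfolding nc_eval_def by (rule lin_ext_single) simp

lemma nc_eval_zero: "nc_eval 0 = 0"
  by (simp add: nc_eval_def lin_ext_def)

lemma nc_eval_one: "nc_eval 1 = 1"
proof -
  have "nc_eval 1 = scale 1 (monom_value 0)"
    by (metis nc_eval_single single_one)
  then show ?thesis by (simp add: zero_ncmonom_def)
qed

lemma nc_eval_mult: "nc_eval (p * q) = nc_eval p * nc_eval q"
proof (induction p rule: ncpoly_induct)
  case (single v c)
  show ?case
    by (induction q rule: ncpoly_induct)
      (simp_all add: mult_single nc_eval_single nc_eval_add monom_value_add scale_mult_left
        scale_mult_right distrib_left)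
qed (simp add: nc_eval_add distrib_right)

lemma nc_eval_scale: "nc_eval (nc_scale c p) = scale c (nc_eval p)"
  by (simp add: nc_scale_def nc_eval_mult nc_eval_single zero_ncmonom_def scale_mult_left)

lemma nc_eval_power: "nc_eval (p ^ k) = nc_eval p ^ k"
  by (induction k) (simp_all add: nc_eval_one nc_eval_mult)

lemma nc_eval_prod_list: "nc_eval (prod_list ps) = prod_list (map nc_eval ps)"
  by (induction ps) (simp_all add: nc_eval_one nc_eval_mult)

lemma nc_eval_sum: "nc_eval (sum f A) = (\<Sum>i\<in>A. nc_eval (f i))"
  by (induction A rule: infinite_finite_induct) (simp_all add: nc_eval_zero nc_eval_add)

lemma nc_eval_var: "nc_eval (nc_var i) = X i"
  by (simp add: nc_var_def nc_eval_single)

lemma star_one: "star 1 = 1"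
  using star_mult[of "star 1" 1] star_star by (metis mult_1 mult_1_right)

lemma nc_eval_star:
  assumes "\<And>i. star (X i) = X i"
  shows "nc_eval (nc_star p) = star (nc_eval p)"
proof (induction p rule: ncpoly_induct)
  case (single v c)
  have "star (prod_list (map X w)) = prod_list (map X (rev w))" for w
    by (induction w) (simp_all add: star_one star_mult assms)
  then have "monom_value (rev_monom v) = star (monom_value v)"
    by (cases v) simp
  then show ?case by (simp add: nc_star_single nc_eval_single star_scale)
qed (simp add: nc_star_add nc_eval_add star_add)

end

end

lemma vector_space_nc_scale: "vector_space nc_scale"
proof
  fix c d :: complex and p q :: ncpoly
  show "nc_scale (c + d) p = nc_scale c p + nc_scale d p"
    by (simp add: nc_scale_def single_add distrib_right)
  show "nc_scale c (nc_scale d p) = nc_scale (c * d) p"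
    by (simp add: nc_scale_def mult_single flip: mult.assoc)
qed (simp_all add: nc_scale_add, simp add: nc_scale_def)

context free_iid_sequence
begin

lemma self_adjoint: "star (X i) = X i"
  using law by (simp add: has_law_def)

lemma phi_add: "\<phi> (a + b) = \<phi> a + \<phi> b" and phi_scale: "\<phi> (scale c a) = c * \<phi> a"
  using state_linear by (simp_all add: Vector_Spaces.linear_iff)

lemma free_iid_sequence_nc:
  "free_iid_sequence nc_scale nc_star (\<phi> \<circ> nc_eval X) nc_var \<mu>"
proof -
  interpret nc: vector_space nc_scale by (rule vector_space_nc_scale)
  interpret nc: star_prob_space nc_scale nc_star "\<phi> \<circ> nc_eval X"
  proof
    fix c :: complex and p q :: ncpoly
    show "nc_scale c p * q = nc_scale c (p * q)"
      by (simp add: nc_scale_def mult.assoc)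
    show "p * nc_scale c q = nc_scale c (p * q)"
    proof (induction p rule: ncpoly_induct)
      case (single v d)
      show ?case
        by (induction q rule: ncpoly_induct)
          (simp_all add: nc_scale_single nc_scale_add mult_single distrib_left mult.left_commute)
    qed (simp add: nc_scale_add distrib_right)
    show "nc_star (nc_star p) = p"
      by (induction p rule: ncpoly_induct) (simp_all add: nc_star_single nc_star_add)
    show "nc_star (nc_scale c p) = nc_scale (cnj c) (nc_star p)"
      by (induction p rule: ncpoly_induct)
        (simp_all add: nc_star_single nc_star_add nc_scale_single nc_scale_add)
    show "(\<phi> \<circ> nc_eval X) 1 = 1"
      by (simp add: nc_eval_one state_one)
    show "(\<phi> \<circ> nc_eval X) (nc_star p * p) \<in> \<real>\<^sub>\<ge>\<^sub>0"
      by (simp add: nc_eval_mult nc_eval_star self_adjoint state_nonneg)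
  qed (simp_all add: nc_star_add nc_star_mult nc_eval_add nc_eval_scale phi_add phi_scale
      distrib_left)
  have span: "nc_eval X p \<in> span (range (\<lambda>k. X i ^ k))"
    if "p \<in> nc.span (range (\<lambda>k. nc_var i ^ k))" for i p
    using that
  proof (induction rule: nc.span_induct_alt)
    case base
    show ?case by (simp add: nc_eval_zero span_zero)
  next
    case (step c p q)
    then obtain k where "p = nc_var i ^ k" by auto
    then have "nc_eval X p \<in> span (range (\<lambda>k. X i ^ k))"
      by (auto simp: nc_eval_power nc_eval_var intro!: span_base)
    with step show ?case by (simp add: nc_eval_add nc_eval_scale span_add span_scale)
  qed
  show ?thesis
  proof
    show "nc.free_family nc_var"
      unfolding nc.free_family_def
    proof (intro allI impI)
      fix ws :: "(nat \<times> ncpoly) list"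
      assume ne: "ws \<noteq> []" and adj: "distinct_adj (map fst ws)"
        and mem: "\<forall>(i, p) \<in> set ws. p \<in> nc.span (range (\<lambda>k. nc_var i ^ k)) \<and>
          (\<phi> \<circ> nc_eval X) p = 0"
      define vs where "vs = map (\<lambda>(i, p). (i, nc_eval X p)) ws"
      have fst: "map fst vs = map fst ws"
        and snd: "map snd vs = map (nc_eval X) (map snd ws)"
        by (auto simp: vs_def)
      have mem': "\<forall>(i, a) \<in> set vs. a \<in> span (range (\<lambda>k. X i ^ k)) \<and> \<phi> a = 0"
        using mem span by (fastforce simp: vs_def)
      have "vs \<noteq> []" using ne by (simp add: vs_def)
      moreover have "distinct_adj (map fst vs)" using adj fst by simp
      ultimately have "\<phi> (prod_list (map snd vs)) = 0"
        using free mem' unfolding free_family_def by blast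
      then show "(\<phi> \<circ> nc_eval X) (prod_list (map snd ws)) = 0"
        unfolding snd by (simp add: nc_eval_prod_list)
    qed
    show "nc.has_law (nc_var i) \<mu>" for i
      using law[of i]
      by (simp add: nc.has_law_def has_law_def nc_eval_power nc_eval_var)
        (simp add: nc_var_def nc_star_single)
  qed
qed

end

theorem normalized_sum_lawI:
  fixes scale :: "complex \<Rightarrow> 'a :: ring_1 \<Rightarrow> 'a"
  assumes "free_iid_sequence scale star \<phi> X \<mu>"
    and "star_prob_space.has_law star \<phi> (free_iid_sequence.normalized_sum scale X n) \<nu>"
  shows "normalized_sum_law \<mu> n \<nu>"
proof -
  interpret free_iid_sequence scale star \<phi> X \<mu> by fact
  interpret nc: free_iid_sequence nc_scale nc_star "\<phi> \<circ> nc_eval X" nc_var \<mu>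
    by (rule free_iid_sequence_nc)
  have eval: "nc_eval X (nc.normalized_sum n) = normalized_sum n"
    by (simp add: nc.normalized_sum_def normalized_sum_def nc_eval_scale nc_eval_sum nc_eval_var)
  have star_sum: "nc_star (sum nc_var A) = sum nc_var A" if "finite A" for A
    using that
  proof induction
    case empty
    show ?case by (simp add: nc_star_def lin_ext_def)
  next
    case (insert i A)
    then show ?case by (simp add: nc_star_add) (simp add: nc_var_def nc_star_single)
  qed
  have "nc.has_law (nc.normalized_sum n) \<nu>"
    using assms(2)
    by (simp add: nc.has_law_def has_law_def nc_eval_power eval)
      (simp add: nc.normalized_sum_def nc.star_scale star_sum)
  then show ?thesis
    unfolding normalized_sum_law_def using nc.free_iid_sequence_axioms by blast
qed

end

theory Submission
  imports Defs "HOL-Complex_Analysis.Complex_Analysis"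
begin

text \<open>
  Put \<open>\<epsilon> = 1 / \<surd>n\<close> and \<open>\<kappa> = m\<^sub>3\<close>.  Freeness makes the \<open>R\<close>-transform additive, so the
  inverse of the Cauchy transform of \<open>\<mu>\<^sub>n\<close> is \<open>K g = 1 / g + g + \<epsilon> \<kappa> g\<^sup>2 + O(\<epsilon>\<^sup>2)\<close>, holomorphically
  on a fixed punctured disc.  A contraction argument solves \<open>K (\<psi> w) = \<alpha> + \<beta> (w + 1 / w)\<close> with \<open>\<psi>\<close>
  holomorphic on \<open>\<bar>w\<bar> < 2\<close> and \<open>\<psi> w = w - \<epsilon> \<kappa> w\<^sup>2 + O(\<epsilon>\<^sup>2)\<close>; the condition that the equation can be
  divided by \<open>w\<^sup>2 - 1\<close> determines \<open>\<alpha>\<close> and \<open>\<beta>\<close>.  Hence \<open>\<mu>\<^sub>n\<close> lives on \<open>[\<alpha> - 2\<beta>, \<alpha> + 2\<beta>]\<close> and has there the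
  density \<open>Im (\<psi> (cis \<theta>)) / \<pi>\<close> at \<open>\<alpha> + 2\<beta> cos \<theta>\<close>.  By the Chebyshev expansion of the logarithmic
  kernel its energy is \<open>ln \<beta> - (\<Sum>k\<ge>1. 2 / k * \<tau>\<^sub>k\<^sup>2)\<close>, where \<open>\<tau>\<^sub>k\<close> is the mean of \<open>cos (k \<theta>)\<close>.  Mean zero
  and variance one express \<open>\<alpha>\<close> and \<open>\<beta>\<close> through \<open>\<tau>\<^sub>1\<close> and \<open>\<tau>\<^sub>2\<close>, and after this substitution only the
  first-order terms \<open>\<tau>\<^sub>1 \<approx> - \<epsilon> \<kappa> / 2\<close> and \<open>\<tau>\<^sub>3 \<approx> \<epsilon> \<kappa> / 2\<close> contribute to order \<open>\<epsilon>\<^sup>2\<close>.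
\<close>

unbundle no vec_syntax

section \<open>Additivity of the R-transform\<close>

text \<open>The underlying algebra carries no norm, so nothing in it can converge. Resolvents there
  are formal power series whose coefficients are finite sums, and analysis starts only after the
  state has turned them into numbers. The final constants must depend on \<mu> alone, which is why
  the remainder Q of the R-transform, its disc and its bound are fixed before n. The density is not
  recovered from boundary values of a Cauchy transform. A law with the required uniformization is
  written down instead, its positivity coming from the dominance of the first coefficient of \<psi>,
  and it is recognized as \<mu>_n by its moments. Coefficients of \<psi> are known only up to
  O(\<epsilon>^2), which is the order of the wanted term. This does no harm because the semicircle
  law is a critical point of the entropy at fixed mean and variance: with \<tau>_2 = -1/2 +
  \<delta>, both ln \<beta> and \<tau>_2^2 have the linear part -\<delta>. In the same way
  \<alpha>^2 / 2 cancels 2 \<tau>_1^2 to leading order, so that -m_3^2 / (6 n) is the contribution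
  -(2/3) (\<epsilon> \<kappa> / 2)^2 of \<tau>_3 alone.\<close>

fun alternating_sum :: "(nat \<Rightarrow> 'r::ring_1) \<Rightarrow> nat \<Rightarrow> nat \<Rightarrow> nat \<Rightarrow> 'r" where
  "alternating_sum b n 0 i = b i"
| "alternating_sum b n (Suc k) i = b i * (\<Sum>j\<in>{..<n} - {i}. alternating_sum b n k j)"

text \<open>The hypothesis is (1 - c_i) (1 + b_i) = 1. Splitting the first letter of a word by b_i =
  c_i + c_i b_i expresses c_i times the sum of all words through words that start with i, and this
  telescopes in the word length. The remainder is explicit, so no infinite sum over words is
  formed.\<close>

lemma alternating_sum_telescope:
  fixes b c :: "nat \<Rightarrow> 'r::ring_1"
  assumes cb: "\<And>i. i < n \<Longrightarrow> c i + c i * b i = b i"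
  shows "(1 - (\<Sum>i<n. c i)) * (1 + (\<Sum>k<N. \<Sum>i<n. alternating_sum b n k i)) =
         1 - (\<Sum>i<n. alternating_sum b n N i - c i * alternating_sum b n N i)"
proof (induction N)
  case 0
  have "c i = b i - c i * b i" if "i < n" for i
    using cb[OF that] by (metis add_diff_cancel_right')
  then have "(\<Sum>i<n. c i) = (\<Sum>i<n. b i - c i * b i)"
    by (intro sum.cong) auto
  then show ?case by simp
next
  case (Suc N)
  let ?W = "alternating_sum b n"
  let ?T = "\<Sum>i<n. ?W N i"
  have step: "?W (Suc N) i = c i * ?T - c i * ?W N i + c i * ?W (Suc N) i" if "i < n" for i
  proof -
    have rest: "(\<Sum>j\<in>{..<n} - {i}. ?W N j) = ?T - ?W N i"
      using that by (simp add: sum_diff1)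
    have "?W (Suc N) i = b i * (?T - ?W N i)"
      by (simp only: alternating_sum.simps rest)
    also have "\<dots> = (c i + c i * b i) * (?T - ?W N i)"
      using cb[OF that] by simp
    also have "\<dots> = c i * ?T - c i * ?W N i + c i * (b i * (?T - ?W N i))"
      by (simp add: algebra_simps)
    finally show ?thesis by (simp only: alternating_sum.simps rest)
  qed
  have "(\<Sum>i<n. c i) * ?T = (\<Sum>i<n. c i * ?T)"
    by (rule sum_distrib_right)
  also have "\<dots> = (\<Sum>i<n. ?W (Suc N) i + c i * ?W N i - c i * ?W (Suc N) i)"
  proof (intro sum.cong refl)
    fix i assume "i \<in> {..<n}"
    then have "?W (Suc N) i = c i * ?T - c i * ?W N i + c i * ?W (Suc N) i"
      by (intro step) simp
    moreover have "a = t - s + r \<Longrightarrow> t = a + s - r" for a t s r :: 'r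
      by simp
    ultimately show "c i * ?T = ?W (Suc N) i + c i * ?W N i - c i * ?W (Suc N) i"
      by blast
  qed
  finally have cT: "(\<Sum>i<n. c i) * ?T =
      (\<Sum>i<n. ?W (Suc N) i) + (\<Sum>i<n. c i * ?W N i) - (\<Sum>i<n. c i * ?W (Suc N) i)"
    by (simp only: sum.distrib sum_subtractf)
  have "(1 - (\<Sum>i<n. c i)) * (1 + (\<Sum>k<Suc N. \<Sum>i<n. ?W k i)) =
      (1 - (\<Sum>i<n. c i)) * (1 + (\<Sum>k<N. \<Sum>i<n. ?W k i)) + (?T - (\<Sum>i<n. c i) * ?T)"
    by (simp only: sum.lessThan_Suc) (simp add: algebra_simps)
  also have "\<dots> = 1 - (\<Sum>i<n. ?W (Suc N) i - c i * ?W (Suc N) i)"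
    unfolding Suc.IH cT by (simp only: sum_subtractf) (simp add: algebra_simps)
  finally show ?case .
qed

text \<open>A word of k + 1 letters without constant term has order at least k + 1; this removes the
  remainder of the telescoped identity up to any given degree.\<close>

lemma alternating_sum_nth_eq_0:
  fixes b :: "nat \<Rightarrow> 'r::ring_1 fps"
  assumes "\<And>i. b i $ 0 = 0" and "m \<le> k"
  shows "alternating_sum b n k i $ m = 0"
  using assms(2)
proof (induction k arbitrary: i m)
  case 0
  then show ?case using assms(1) by simp
next
  case (Suc k)
  have "b i $ l * (\<Sum>j\<in>{..<n} - {i}. alternating_sum b n k j) $ (m - l) = 0" if "l \<le> m" for l
  proof (cases "l = 0")
    case True
    then show ?thesis using assms(1) by simp
  next
    case False
    then have "m - l \<le> k" using Suc.prems by simp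
    then show ?thesis using Suc.IH by (simp add: fps_sum_nth)
  qed
  then show ?case by (simp add: fps_mult_nth)
qed

section \<open>Resolvents as formal power series over the algebra\<close>

context star_prob_space
begin

text \<open>With \<open>h = z K(z)\<close> this is \<open>z (K(z) - x)\<close>, and \<open>resolvent_fps (1 / h) x\<close> is its inverse.\<close>

definition pencil_fps :: "complex fps \<Rightarrow> 'a \<Rightarrow> 'a fps" where
  "pencil_fps h x = Abs_fps (\<lambda>m. scale (h $ m) 1 - (if m = 1 then x else 0))"

definition resolvent_fps :: "complex fps \<Rightarrow> 'a \<Rightarrow> 'a fps" where
  "resolvent_fps u x = Abs_fps (\<lambda>m. \<Sum>k\<le>m. scale ((u ^ Suc k) $ (m - k)) (x ^ k))"

text \<open>\<open>resolvent_fps u x\<close> is the geometric series with terms z^k u^(k+1) x^k for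
  1 / (h - z x). Multiplying by h = 1 / u lowers each exponent of u by one; splitting off k = 0 in
  \<open>resolvent_nth_shift\<close> then gives h R = 1 + z x R for the resolvent R.\<close>

lemma resolvent_nth_scale_sum:
  assumes "h * u = 1"
  shows "(\<Sum>i\<le>m. scale (h $ i) (resolvent_fps u x $ (m - i))) =
         (\<Sum>k\<le>m. scale ((u ^ k) $ (m - k)) (x ^ k))"
proof -
  have hu: "h * u ^ Suc k = u ^ k" for k
    using assms by (simp add: mult.assoc [symmetric])
  have "(\<Sum>i\<le>m. scale (h $ i) (resolvent_fps u x $ (m - i))) =
      (\<Sum>i\<in>{..m}. \<Sum>k\<in>{k. k \<in> {..m} \<and> i + k \<le> m}.
        scale (h $ i * (u ^ Suc k) $ (m - i - k)) (x ^ k))"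
    by (intro sum.cong refl) (auto simp: resolvent_fps_def scale_sum_right intro!: sum.cong)
  also have "\<dots> = (\<Sum>k\<in>{..m}. \<Sum>i\<in>{i. i \<in> {..m} \<and> i + k \<le> m}.
        scale (h $ i * (u ^ Suc k) $ (m - i - k)) (x ^ k))"
    by (intro sum.swap_restrict) auto
  also have "\<dots> = (\<Sum>k\<le>m. scale ((h * u ^ Suc k) $ (m - k)) (x ^ k))"
  proof (intro sum.cong refl)
    fix k assume "k \<in> {..m}"
    then have "{i. i \<in> {..m} \<and> i + k \<le> m} = {0..m - k}" by auto
    then show "(\<Sum>i\<in>{i. i \<in> {..m} \<and> i + k \<le> m}.
        scale (h $ i * (u ^ Suc k) $ (m - i - k)) (x ^ k)) =
        scale ((h * u ^ Suc k) $ (m - k)) (x ^ k)"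
      by (simp only: fps_mult_nth scale_sum_left) (simp add: add.commute)
  qed
  finally show ?thesis unfolding hu .
qed

lemma resolvent_nth_shift:
  "(\<Sum>k\<le>m. scale ((u ^ k) $ (m - k)) (x ^ k)) =
   (if m = 0 then 1 else 0) + (if m = 0 then 0 else x * resolvent_fps u x $ (m - 1))"
proof (cases m)
  case (Suc l)
  have "(\<Sum>k\<le>Suc l. scale ((u ^ k) $ (Suc l - k)) (x ^ k)) =
      (\<Sum>k\<le>l. scale ((u ^ Suc k) $ (l - k)) (x ^ Suc k))"
    by (subst sum.atMost_Suc_shift) simp
  also have "\<dots> = x * resolvent_fps u x $ l"
    by (simp add: resolvent_fps_def sum_distrib_left scale_mult_right)
  finally show ?thesis using Suc by simp
qed simp

lemma resolvent_commute: "x * resolvent_fps u x $ m = resolvent_fps u x $ m * x"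
  by (simp add: resolvent_fps_def sum_distrib_left sum_distrib_right scale_mult_right
      scale_mult_left power_commutes)

lemma pencil_resolvent:
  assumes "h * u = 1"
  shows "pencil_fps h x * resolvent_fps u x = 1"
proof (rule fps_ext)
  fix m
  have "(pencil_fps h x * resolvent_fps u x) $ m =
      (\<Sum>i=0..m. scale (h $ i) (resolvent_fps u x $ (m - i))) -
      (\<Sum>i=0..m. (if i = 1 then x * resolvent_fps u x $ (m - 1) else 0))"
    unfolding fps_mult_nth sum_subtractf [symmetric]
    by (intro sum.cong refl)
      (auto simp: pencil_fps_def left_diff_distrib scale_mult_left)
  also have "\<dots> = (1::'a fps) $ m"
    unfolding atMost_atLeast0 [symmetric] resolvent_nth_scale_sum[OF assms] resolvent_nth_shift
    by auto
  finally show "(pencil_fps h x * resolvent_fps u x) $ m = (1::'a fps) $ m" .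
qed

text \<open>The ring is not commutative, but all coefficients that occur lie in the commutative
  algebra generated by x.\<close>

lemma resolvent_pencil:
  assumes "h * u = 1"
  shows "resolvent_fps u x * pencil_fps h x = 1"
proof -
  have "resolvent_fps u x * pencil_fps h x = pencil_fps h x * resolvent_fps u x"
  proof (rule fps_ext)
    fix m
    have "pencil_fps h x $ i * resolvent_fps u x $ j = resolvent_fps u x $ j * pencil_fps h x $ i"
      for i j
      by (auto simp: pencil_fps_def algebra_simps scale_mult_left scale_mult_right
          resolvent_commute)
    then show "(resolvent_fps u x * pencil_fps h x) $ m =
        (pencil_fps h x * resolvent_fps u x) $ m"
      unfolding fps_mult_nth
      by (subst sum.atLeastAtMost_rev) (auto intro!: sum.cong)
  qed
  then show ?thesis using pencil_resolvent[OF assms] by simp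
qed

end

section \<open>Centred resolvents and freeness\<close>

context free_iid_sequence
begin

lemma phi_zero: "\<phi> 0 = 0"
  using phi_scale[of 0 0] by simp

lemma phi_sum: "\<phi> (sum f A) = (\<Sum>i\<in>A. \<phi> (f i))"
  by (induction A rule: infinite_finite_induct) (simp_all add: phi_add phi_zero)

text \<open>The induction carries a prefix of centred letters: unfolding one level of the
  alternating sum moves its first letter to the end of \<open>ws\<close>, and j \<noteq> i keeps
  neighbouring indices distinct.\<close>

lemma phi_alternating_sum:
  fixes b :: "nat \<Rightarrow> 'a fps"
  assumes b: "\<And>i m. b i $ m \<in> span (range (\<lambda>k. X i ^ k)) \<and> \<phi> (b i $ m) = 0"
    and "distinct_adj (map fst ws @ [i])"
    and "\<forall>(i, a) \<in> set ws. a \<in> span (range (\<lambda>k. X i ^ k)) \<and> \<phi> a = 0"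
  shows "\<phi> (prod_list (map snd ws) * alternating_sum b n k i $ m) = 0"
  using assms(2,3)
proof (induction k arbitrary: ws i m)
  case 0
  have "\<phi> (prod_list (map snd (ws @ [(i, b i $ m)]))) = 0"
    using free 0 b[of i m] unfolding free_family_def
    by (elim allE[of _ "ws @ [(i, b i $ m)]"]) (auto simp: prod_list.append)
  then show ?case by simp
next
  case (Suc k)
  have "\<phi> (prod_list (map snd ws) * (b i $ l * alternating_sum b n k j $ p)) = 0"
    if "j \<noteq> i" for j l p
  proof -
    have "\<phi> (prod_list (map snd (ws @ [(i, b i $ l)])) * alternating_sum b n k j $ p) = 0"
    proof (rule Suc.IH)
      show "distinct_adj (map fst (ws @ [(i, b i $ l)]) @ [j])"
        using Suc.prems(1) that by (simp add: distinct_adj_append_iff)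
    qed (use Suc.prems(2) b[of i l] in auto)
    then show ?thesis by (simp add: mult.assoc)
  qed
  then show ?case
    by (auto simp: fps_mult_nth fps_sum_nth sum_distrib_left phi_sum intro!: sum.neutral)
qed

text \<open>
  Write \<open>z (K - X\<^sub>i) = 1 - c\<^sub>i\<close> with inverse \<open>1 + b\<^sub>i\<close>, where \<open>b\<^sub>i\<close> is centred by the choice of \<open>K\<close>.  The inverse
  of \<open>1 - (\<Sum>i. c\<^sub>i)\<close> is the sum of all products of the \<open>b\<^sub>i\<close> with distinct neighbours, so freeness leaves
  only the empty product.
\<close>

theorem free_sum_resolvent:
  assumes hu: "h * u = 1" and h0: "h $ 0 = 1"
    and rel: "\<And>m. (\<Sum>k\<le>m. (u ^ Suc k) $ (m - k) * of_real (moment \<mu> k)) =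
      (if m = 0 then 1 else 0)"
    and hu': "(1 + of_nat n * (h - 1)) * u' = 1"
  shows "(\<Sum>k\<le>m. (u' ^ Suc k) $ (m - k) * \<phi> ((\<Sum>i<n. X i) ^ k)) = (if m = 0 then 1 else 0)"
proof -
  define r where "r i = resolvent_fps u (X i)" for i
  define b where "b i = r i - 1" for i
  define c where "c i = 1 - pencil_fps h (X i)" for i
  define Y where "Y = (\<Sum>i<n. X i)"
  \<comment> \<open>In terms of the R-transform h = 1 + z R(z), so additivity multiplies h - 1 by
    n.\<close>
  define h' where "h' = 1 + of_nat n * (h - 1)"
  let ?W = "alternating_sum b n"
  have phi_one: "\<phi> 1 = 1" by (rule state_one)
  have phi_pow: "\<phi> (X i ^ k) = of_real (moment \<mu> k)" for i k
    using law[of i] by (simp add: has_law_def)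
  have u0: "u $ 0 = 1"
    using arg_cong[OF hu, of "\<lambda>f. f $ 0"] h0 by simp
  have b0: "b i $ 0 = 0" for i
    by (simp add: b_def r_def resolvent_fps_def u0)
  have bmem: "b i $ m \<in> span (range (\<lambda>k. X i ^ k)) \<and> \<phi> (b i $ m) = 0" for i m
  proof
    have pow: "X i ^ k \<in> span (range (\<lambda>k. X i ^ k))" for k
      by (intro span_base) auto
    have "1 \<in> span (range (\<lambda>k. X i ^ k))"
      using pow[of 0] by simp
    then show "b i $ m \<in> span (range (\<lambda>k. X i ^ k))"
      by (auto simp: b_def r_def resolvent_fps_def fps_one_nth
          intro!: span_diff span_sum span_scale pow span_zero)
    \<comment> \<open>\<open>rel\<close> states that the resolvent series has expectation 1, that
      is, G(K(z)) = z coefficient by coefficient.\<close>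
    have "\<phi> (r i $ m) = (if m = 0 then 1 else 0)"
      unfolding rel[of m, symmetric] r_def resolvent_fps_def
      by (simp add: phi_sum phi_scale phi_pow)
    moreover have "r i $ m = b i $ m + 1 $ m" by (simp add: b_def)
    ultimately show "\<phi> (b i $ m) = 0"
      by (cases "m = 0") (auto simp: phi_add phi_one phi_zero)
  qed
  have phiW: "\<phi> (?W k i $ m) = 0" for k i m
    using phi_alternating_sum[OF bmem, of "[]" i n k m] by simp
  have cb: "c i + c i * b i = b i" for i
    using pencil_resolvent[OF hu, of "X i"]
    by (simp add: c_def b_def r_def algebra_simps)
  have pencil_sum: "pencil_fps h' Y = 1 - (\<Sum>i<n. c i)"
  proof (rule fps_ext)
    fix m
    have "(of_nat n :: complex fps) * f = (\<Sum>i<n. f)" for f by simp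
    then have "h' $ m = 1 $ m + (\<Sum>i<n. h $ m - 1 $ m)"
      unfolding h'_def by (simp add: fps_sum_nth)
    then have "scale (h' $ m) 1 = scale (1 $ m) 1 + (\<Sum>i<n. scale (h $ m - 1 $ m) 1)"
      by (simp only: scale_left_distrib scale_sum_left)
    moreover have "(if m = 1 then Y else 0) = (\<Sum>i<n. if m = 1 then X i else 0)"
      by (simp add: Y_def)
    moreover have "scale (1 $ m) 1 = (1::'a fps) $ m"
      by simp
    ultimately show "pencil_fps h' Y $ m = (1 - (\<Sum>i<n. c i)) $ m"
      by (simp add: pencil_fps_def c_def fps_sum_nth sum.distrib sum_subtractf scale_left_diff_distrib
          right_diff_distrib)
  qed
  \<comment> \<open>For the m-th coefficient, words of at most m letters suffice: every word in
    \<open>E\<close> below has more than m letters and hence order above m.\<close>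
  define S where "S = 1 + (\<Sum>k<m. \<Sum>i<n. ?W k i)"
  define E where "E = (\<Sum>i<n. ?W m i - c i * ?W m i)"
  have W0: "?W m i $ l = 0" if "l \<le> m" for i l
    by (rule alternating_sum_nth_eq_0[OF b0 that])
  have E0: "E $ l = 0" if "l \<le> m" for l
    using that by (auto simp: E_def fps_sum_nth fps_mult_nth W0 intro!: sum.neutral)
  have hu'': "h' * u' = 1" using hu' by (simp add: h'_def)
  have "pencil_fps h' Y * S = 1 - E"
    unfolding pencil_sum S_def E_def by (rule alternating_sum_telescope) (rule cb)
  then have "resolvent_fps u' Y * (pencil_fps h' Y * S) = resolvent_fps u' Y * (1 - E)"
    by simp
  then have "S = resolvent_fps u' Y - resolvent_fps u' Y * E"
    unfolding mult.assoc [symmetric] resolvent_pencil[OF hu''] by (simp add: algebra_simps)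
  moreover have "(resolvent_fps u' Y * E) $ m = 0"
    by (auto simp: fps_mult_nth E0 intro!: sum.neutral)
  ultimately have "S $ m = resolvent_fps u' Y $ m" by simp
  then have "\<phi> (resolvent_fps u' Y $ m) = \<phi> (S $ m)" by simp
  also have "\<dots> = (if m = 0 then 1 else 0)"
    by (simp add: S_def phi_add fps_sum_nth phi_sum phiW phi_one phi_zero)
  finally show ?thesis
    by (simp add: resolvent_fps_def phi_sum phi_scale Y_def)
qed

end

section \<open>Moment series and their compositional inverses\<close>

lemma compactly_supported_moments:
  assumes "real_distribution \<nu>" and "compactly_supported \<nu>"
  obtains L where "L > 0" "AE x in \<nu>. \<bar>x\<bar> \<le> L" "\<And>k. integrable \<nu> (\<lambda>x. x ^ k)"
    "\<And>k. \<bar>moment \<nu> k\<bar> \<le> L ^ k"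
proof -
  interpret real_distribution \<nu> by fact
  obtain K where K: "compact K" "AE x in \<nu>. x \<in> K"
    using assms(2) by (auto simp: compactly_supported_def)
  then obtain L where L: "L > 0" "\<And>x. x \<in> K \<Longrightarrow> \<bar>x\<bar> \<le> L"
    by (metis bounded_pos compact_imp_bounded real_norm_def)
  have AE: "AE x in \<nu>. \<bar>x\<bar> \<le> L"
    using K(2) by eventually_elim (rule L)
  have AEk: "AE x in \<nu>. \<bar>x ^ k\<bar> \<le> L ^ k" for k
    using AE by eventually_elim (auto simp: power_abs intro: power_mono)
  have int: "integrable \<nu> (\<lambda>x. x ^ k)" for k
    by (rule integrable_const_bound[where B = "L ^ k"]) (use AEk in auto)
  have "\<bar>moment \<nu> k\<bar> \<le> L ^ k" for k
  proof -
    have "\<bar>moment \<nu> k\<bar> \<le> (LINT x|\<nu>. \<bar>x ^ k\<bar>)"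
      unfolding moment_def by (rule integral_abs_bound)
    also have "\<dots> \<le> L ^ k"
      by (rule integral_le_const) (use int AEk in auto)
    finally show ?thesis .
  qed
  with L AE int that show ?thesis by blast
qed

definition moment_fps :: "real measure \<Rightarrow> real fps" where
  "moment_fps \<nu> = Abs_fps (moment \<nu>)"

text \<open>Series are kept real and then embedded, since real coefficients are what makes the
  remainder Q commute with conjugation.\<close>

definition fps_of_real :: "real fps \<Rightarrow> complex fps" where
  "fps_of_real f = Abs_fps (\<lambda>n. of_real (f $ n))"

lemma fps_of_real_nth [simp]: "fps_of_real f $ n = of_real (f $ n)"
  by (simp add: fps_of_real_def)

lemma fps_of_real_1 [simp]: "fps_of_real 1 = 1"
  by (rule fps_ext) simp

lemma fps_of_real_X [simp]: "fps_of_real fps_X = fps_X"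
  by (rule fps_ext) (simp add: fps_X_def)

lemma fps_of_real_mult: "fps_of_real (f * g) = fps_of_real f * fps_of_real g"
  by (rule fps_ext) (simp add: fps_mult_nth)

lemma fps_of_real_power: "fps_of_real (f ^ k) = fps_of_real f ^ k"
  by (induction k) (simp_all add: fps_of_real_mult)

lemma fps_of_real_compose: "fps_of_real (f oo g) = fps_of_real f oo fps_of_real g"
  by (rule fps_ext) (simp add: fps_compose_nth flip: fps_of_real_power)

lemma cnj_eval_fps_of_real: "cnj (eval_fps (fps_of_real f) z) = eval_fps (fps_of_real f) (cnj z)"
  if "norm z < fps_conv_radius (fps_of_real f)"
proof -
  have "(\<lambda>n. fps_of_real f $ n * z ^ n) sums eval_fps (fps_of_real f) z"
    by (rule sums_eval_fps[OF that])
  then have "(\<lambda>n. cnj (fps_of_real f $ n * z ^ n)) sums cnj (eval_fps (fps_of_real f) z)"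
    by (simp only: sums_cnj)
  then show ?thesis
    by (simp add: eval_fps_def sums_unique)
qed

lemma moment_fps_nth [simp]: "moment_fps \<nu> $ k = moment \<nu> k"
  by (simp add: moment_fps_def)

lemma fps_conv_radius_of_moments:
  fixes M :: "complex fps"
  assumes "L > 0" and "\<And>k. norm (M $ k) \<le> L ^ k"
  shows "fps_conv_radius M > 0"
proof -
  have "summable (\<lambda>k. M $ k * (of_real (1 / (2 * L))) ^ k)"
  proof (rule summable_comparison_test'[where g = "\<lambda>k. (1 / 2) ^ k" and N = 0])
    show "summable (\<lambda>k. (1 / 2 :: real) ^ k)" by simp
    fix k
    have "norm (M $ k * (of_real (1 / (2 * L))) ^ k) \<le> L ^ k * (1 / (2 * L)) ^ k"
      using assms by (auto simp: norm_mult norm_power norm_divide intro!: mult_mono)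
    also have "\<dots> = (1 / 2) ^ k"
      using assms(1) by (simp add: power_mult_distrib [symmetric])
    finally show "norm (M $ k * (of_real (1 / (2 * L))) ^ k) \<le> (1 / 2) ^ k" .
  qed
  then have "conv_radius (fps_nth M) \<ge> norm (of_real (1 / (2 * L)) :: complex)"
    by (rule conv_radius_geI)
  moreover have "ereal (norm (of_real (1 / (2 * L)) :: complex)) > 0"
    using assms(1) by simp
  ultimately show ?thesis
    unfolding fps_conv_radius_def by (rule less_le_trans[rotated])
qed

text \<open>Translates the coefficient relation of \<open>free_sum_resolvent\<close>: z u(z) = 1 /
  K(z) is the compositional inverse of s M(s), which is the Cauchy transform at 1 / s.\<close>

lemma fps_X_mult_compose_eq_X_iff:
  fixes M u :: "'c::field fps"
  shows "(fps_X * M) oo (fps_X * u) = fps_X \<longleftrightarrow>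
    (\<forall>m. (\<Sum>k\<le>m. (u ^ Suc k) $ (m - k) * M $ k) = (if m = 0 then 1 else 0))"
proof -
  have "((fps_X * M) oo (fps_X * u)) $ Suc m = (\<Sum>k\<le>m. (u ^ Suc k) $ (m - k) * M $ k)" for m
  proof -
    have "((fps_X * M) oo (fps_X * u)) $ Suc m =
        (\<Sum>i\<le>Suc m. (fps_X * M) $ i * ((fps_X * u) ^ i $ Suc m))"
      by (simp only: fps_compose_nth atMost_atLeast0)
    also have "\<dots> = (\<Sum>k\<le>m. (fps_X * M) $ Suc k * ((fps_X * u) ^ Suc k $ Suc m))"
      by (subst sum.atMost_Suc_shift) simp
    also have "\<dots> = (\<Sum>k\<le>m. (u ^ Suc k) $ (m - k) * M $ k)"
    proof (intro sum.cong refl)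
      fix k assume "k \<in> {..m}"
      then show "(fps_X * M) $ Suc k * ((fps_X * u) ^ Suc k $ Suc m) = (u ^ Suc k) $ (m - k) * M $ k"
        unfolding power_mult_distrib fps_X_power_mult_nth by simp
    qed
    finally show ?thesis .
  qed
  moreover have "(fps_X :: 'c fps) $ Suc m = (if m = 0 then 1 else 0)" for m
    by (simp add: fps_X_def)
  moreover have "f = fps_X \<longleftrightarrow> f $ 0 = 0 \<and> (\<forall>m. f $ Suc m = (fps_X :: 'c fps) $ Suc m)" for f
    unfolding fps_eq_iff by (metis fps_X_nth not0_implies_Suc zero_neq_one)
  ultimately show ?thesis by simp
qed

lemma fps_inv_unique:
  fixes a b :: "'c::field fps"
  assumes "a $ 0 = 0" "a $ 1 \<noteq> 0" "b $ 0 = 0" "a oo b = fps_X"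
  shows "b = fps_inv a"
proof -
  have "b = (fps_inv a oo a) oo b"
    using assms by (simp add: fps_inv)
  also have "\<dots> = fps_inv a oo (a oo b)"
    using assms by (intro fps_compose_assoc [symmetric]) auto
  finally show ?thesis using assms by simp
qed

text \<open>F is injective near 0 because its derivative there is nonzero. The expansion of its
  local holomorphic inverse composes with f to \<open>fps_X\<close>, so it is the formal inverse,
  which therefore converges.\<close>

lemma has_fps_expansion_fps_inv:
  fixes F :: "complex \<Rightarrow> complex"
  assumes F: "F has_fps_expansion f" and f0: "f $ 0 = 0" and f1: "f $ 1 \<noteq> 0"
  obtains S where "S has_fps_expansion fps_inv f"
proof -
  obtain s where s: "open s" "0 \<in> s" "F holomorphic_on s" "\<And>z. z \<in> s \<Longrightarrow> F z = eval_fps f z"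
    using has_fps_expansion_imp_holomorphic[OF F] by metis
  have "deriv F 0 = f $ 1"
    using fps_nth_fps_expansion[OF F, of 1] by simp
  then obtain r where r: "r > 0" "ball 0 r \<subseteq> s" "open (F ` ball 0 r)" "inj_on F (ball 0 r)"
    using has_complex_derivative_locally_invertible[OF s(3,2,1)] f1 by metis
  have hol: "F holomorphic_on ball 0 r"
    using r s holomorphic_on_subset by blast
  obtain g where g: "g holomorphic_on (F ` ball 0 r)" "\<And>z. z \<in> ball 0 r \<Longrightarrow> g (F z) = z"
    using holomorphic_has_inverse[OF hol open_ball r(4)] by metis
  have F0: "F 0 = 0" using s f0 by (simp add: eval_fps_at_0)
  have "0 \<in> F ` ball 0 r" using F0 r(1) by force
  then have exp: "g has_fps_expansion fps_expansion g 0"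
    using has_fps_expansion_fps_expansion[OF r(3) _ g(1)] by simp
  define G where "G = fps_expansion g 0"
  have "g 0 = 0" using g(2)[of 0] r(1) F0 by simp
  then have G0: "G $ 0 = 0" by (simp add: G_def fps_expansion_def)
  have "(g \<circ> F) has_fps_expansion (G oo f)"
    unfolding G_def by (rule has_fps_expansion_compose[OF exp F f0])
  moreover have "eventually (\<lambda>z. z \<in> ball 0 r) (nhds (0::complex))"
    using r(1) by (intro eventually_nhds_in_open) auto
  then have "eventually (\<lambda>z. (g \<circ> F) z = z) (nhds 0)"
    by eventually_elim (use g in auto)
  ultimately have "(\<lambda>z. z) has_fps_expansion (G oo f)"
    by (subst (asm) has_fps_expansion_cong[OF _ refl]) auto
  moreover have "(\<lambda>z::complex. z) has_fps_expansion fps_X"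
    by (rule has_fps_expansion_fps_X)
  ultimately have Gf: "G oo f = fps_X"
    by (rule fps_expansion_unique_complex)
  have "G = G oo (f oo fps_inv f)"
    using f0 f1 by (simp add: fps_inv_right)
  also have "\<dots> = (G oo f) oo fps_inv f"
    using f0 by (subst fps_compose_assoc) (auto simp: fps_inv_def)
  also have "\<dots> = fps_inv f"
    unfolding Gf by (rule fps_X_fps_compose_startby0) (simp add: fps_inv_def)
  finally show ?thesis using exp that G_def by metis
qed

lemma eval_fps_split4:
  fixes f :: "complex fps"
  assumes "norm z < fps_conv_radius f"
  shows "eval_fps f z = f $ 0 + f $ 1 * z + f $ 2 * z\<^sup>2 + f $ 3 * z ^ 3 + z ^ 4 * eval_fps (fps_shift 4 f) z"
proof -
  have sum: "summable (\<lambda>n. f $ n * z ^ n)"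
    by (rule summable_fps[OF assms])
  have "summable (\<lambda>n. fps_shift 4 f $ n * z ^ n)"
    by (rule summable_fps) (use assms in simp)
  then have "suminf (\<lambda>n. f $ (n + 4) * z ^ (n + 4)) = z ^ 4 * suminf (\<lambda>n. fps_shift 4 f $ n * z ^ n)"
    by (subst suminf_mult [symmetric]) (auto simp: power_add mult_ac)
  with suminf_split_initial_segment[OF sum, of 4] show ?thesis
    by (simp add: eval_fps_def eval_nat_numeral)
qed

lemma inverse_coeffs:
  fixes h u :: "'c::field fps"
  assumes "h * u = 1" "u $ 0 = 1"
  shows "h $ 0 = 1" "h $ 1 = - u $ 1" "u $ 1 = 0 \<Longrightarrow> h $ 2 = - u $ 2"
    "u $ 1 = 0 \<Longrightarrow> h $ 3 = - u $ 3"
proof -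
  show h0: "h $ 0 = 1"
    using arg_cong[OF assms(1), of "\<lambda>f. f $ 0"] assms(2) by simp
  show h1: "h $ 1 = - u $ 1"
    using arg_cong[OF assms(1), of "\<lambda>f. f $ 1"] assms(2) h0
    by (simp add: fps_mult_nth_1 add_eq_0_iff)
  show h2: "h $ 2 = - u $ 2" if "u $ 1 = 0"
    using arg_cong[OF assms(1), of "\<lambda>f. f $ 2"] assms(2) h0 h1 that
    by (simp add: fps_mult_nth numeral_2_eq_2 add_eq_0_iff)
  show "h $ 3 = - u $ 3" if "u $ 1 = 0"
    using arg_cong[OF assms(1), of "\<lambda>f. f $ 3"] assms(2) h0 h1 h2 that
    by (simp add: fps_mult_nth numeral_3_eq_3 numeral_2_eq_2 add_eq_0_iff)
qed

text \<open>\<open>s * moment_gf \<nu> s\<close> is the Cauchy transform at 1 / s. Being the value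
  of a power series, it has this meaning only inside the disc of convergence.\<close>

definition moment_gf :: "real measure \<Rightarrow> complex \<Rightarrow> complex" where
  "moment_gf \<nu> = eval_fps (fps_of_real (moment_fps \<nu>))"

lemma moment_gf_has_fps_expansion:
  assumes "real_distribution \<nu>" and "compactly_supported \<nu>"
  shows "moment_gf \<nu> has_fps_expansion fps_of_real (moment_fps \<nu>)"
proof -
  obtain L where "L > 0" "\<And>k. \<bar>moment \<nu> k\<bar> \<le> L ^ k"
    using compactly_supported_moments[OF assms] by metis
  then have "fps_conv_radius (fps_of_real (moment_fps \<nu>)) > 0"
    by (intro fps_conv_radius_of_moments) auto
  then show ?thesis
    unfolding moment_gf_def has_fps_expansion_def by simp
qed

text \<open>h = z K(z) is 1 plus the generating series of the free cumulants, the first three of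
  which are 0, 1 and m_3 here. The relation for u determines its coefficients one after the other,
  and convergence is inherited from the compositional inverse.\<close>

theorem R_transform_exists:
  assumes mu: "real_distribution \<mu>" "compactly_supported \<mu>"
    and m1: "moment \<mu> 1 = 0" and m2: "moment \<mu> 2 = 1"
  obtains h u :: "real fps" where "h * u = 1" "h $ 0 = 1" "h $ 1 = 0" "h $ 2 = 1"
    "h $ 3 = moment \<mu> 3" "fps_conv_radius (fps_of_real h) > 0"
    "\<And>m. (\<Sum>k\<le>m. (u ^ Suc k) $ (m - k) * moment \<mu> k) = (if m = 0 then 1 else 0)"
proof -
  interpret real_distribution \<mu> by fact
  define M where "M = moment_fps \<mu>"
  define F where "F = fps_X * M"
  define u where "u = fps_shift 1 (fps_inv F)"
  define h where "h = inverse u"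
  have m0: "moment \<mu> 0 = 1" using prob_space by (simp add: moment_def)
  have F0: "F $ 0 = 0" and F1: "F $ 1 = 1"
    by (simp_all add: F_def M_def moment_fps_def m0)
  have inv0: "fps_inv F $ 0 = 0" by (simp add: fps_inv_def)
  then have Xu: "fps_X * u = fps_inv F"
    unfolding u_def fps_eq_iff by (simp add: fps_X_mult_nth)
  have comp: "F oo (fps_X * u) = fps_X"
    unfolding Xu using F0 F1 by (simp add: fps_inv_right)
  then have rel: "(\<Sum>k\<le>m. (u ^ Suc k) $ (m - k) * moment \<mu> k) = (if m = 0 then 1 else 0)" for m
    unfolding F_def fps_X_mult_compose_eq_X_iff by (simp add: M_def moment_fps_def)
  have u0: "u $ 0 = 1" using rel[of 0] m0 by simp
  then have hu: "h * u = 1" unfolding h_def by (simp add: inverse_mult_eq_1)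
  have u1: "u $ 1 = 0" using rel[of 1] m0 m1 by simp
  have pow0: "(u ^ k) $ 0 = 1" for k by (simp add: fps_power_zeroth u0)
  have pow1: "(u ^ k) $ 1 = 0" for k
    by (induction k) (auto simp: fps_mult_nth_1 u1[simplified])
  have u2: "u $ 2 = - 1"
    using rel[of 2] pow0[of 3] m0 m1 m2
    by (simp add: eval_nat_numeral add_eq_0_iff)
  have u3: "u $ 3 = - moment \<mu> 3"
    using rel[of 3] pow0[of 4] pow1[of 3] m0 m1 m2
    by (simp add: eval_nat_numeral add_eq_0_iff)
  have cF: "fps_of_real (fps_inv F) = fps_inv (fps_of_real F)"
    by (rule fps_inv_unique)
      (use F0 F1 in \<open>auto simp: inv0 fps_inv_right simp flip: fps_of_real_compose\<close>)
  have "(\<lambda>z. z * moment_gf \<mu> z) has_fps_expansion fps_of_real F"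
    unfolding F_def M_def fps_of_real_mult fps_of_real_X
    by (intro fps_expansion_intros moment_gf_has_fps_expansion mu)
  then obtain S where S: "S has_fps_expansion fps_of_real (fps_inv F)"
    unfolding cF using has_fps_expansion_fps_inv F0 F1
    by (metis fps_of_real_nth of_real_0 of_real_eq_0_iff zero_neq_one)
  have "fps_conv_radius (fps_of_real (fps_inv F)) > 0"
    using S by (simp add: has_fps_expansion_def)
  moreover have "fps_of_real u = fps_shift 1 (fps_of_real (fps_inv F))"
    unfolding u_def by (rule fps_ext) simp
  ultimately have "eval_fps (fps_of_real u) has_fps_expansion fps_of_real u"
    by (simp add: has_fps_expansion_def)
  then have "(\<lambda>z. inverse (eval_fps (fps_of_real u) z)) has_fps_expansion inverse (fps_of_real u)"
    by (rule has_fps_expansion_inverse) (simp add: u0)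
  moreover have "fps_of_real h * fps_of_real u = 1"
    using hu by (simp flip: fps_of_real_mult)
  then have "inverse (fps_of_real u) = fps_of_real h"
    by (metis fps_inverse_unique mult.commute)
  ultimately have rad: "fps_conv_radius (fps_of_real h) > 0"
    by (simp add: has_fps_expansion_def)
  note co = inverse_coeffs[OF hu u0]
  show ?thesis
    by (rule that[OF hu co(1) _ _ _ rad rel]) (use co u1 u2 u3 in auto)
qed

section \<open>Cauchy transform of the normalized sum\<close>

context free_iid_sequence
begin

lemma scale_power: "scale c a ^ k = scale (c ^ k) (a ^ k)"
  by (induction k) (simp_all add: scale_mult_left scale_mult_right mult.commute)

text \<open>The sum has the series 1 + n (h - 1), and dilation by \<epsilon> replaces its argument
  by \<epsilon> t. The first two moments are read off the lowest coefficients of the same formal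
  relation; the third claim is its analytic form, an identity of germs at 0.\<close>

lemma normalized_sum_law_gf:
  assumes law_nu: "has_law (normalized_sum n) \<nu>" and n: "n > 0"
    and hu: "h * u = 1" and h: "h $ 0 = 1" "h $ 1 = 0" "h $ 2 = 1"
    and rad: "fps_conv_radius (fps_of_real h) > 0"
    and rel: "\<And>m. (\<Sum>k\<le>m. (u ^ Suc k) $ (m - k) * moment \<mu> k) = (if m = 0 then 1 else 0)"
  defines "\<epsilon> \<equiv> 1 / sqrt (real n)"
  shows "moment \<nu> 1 = 0" "moment \<nu> 2 = 1"
    "eventually (\<lambda>t. let s = t / (1 + of_nat n * (eval_fps (fps_of_real h) (of_real \<epsilon> * t) - 1))
      in s * moment_gf \<nu> s = t) (nhds 0)"
proof -
  define hc uc where "hc = fps_of_real h" and "uc = fps_of_real u"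
  define hn where "hn = 1 + of_nat n * (hc - 1)"
  define un where "un = inverse hn"
  define q where "q = sqrt (real n)"
  have q: "q > 0" "q\<^sup>2 = real n" using n by (simp_all add: q_def)
  have nu: "real_distribution \<nu>" "compactly_supported \<nu>"
    and phi: "\<And>k. \<phi> (normalized_sum n ^ k) = of_real (moment \<nu> k)"
    using law_nu by (auto simp: has_law_def)
  interpret nu: real_distribution \<nu> by fact
  have m0: "moment \<nu> 0 = 1" using nu.prob_space by (simp add: moment_def)
  have of_nat_nth: "(of_nat n * f) $ k = of_nat n * f $ k" for f :: "complex fps" and k
    by (simp add: fps_of_nat[symmetric] fps_mult_left_const_nth del: fps_of_nat)
  have hn0: "hn $ 0 = 1" "hn $ 1 = 0" "hn $ 2 = of_nat n"
    using h by (simp_all add: hn_def of_nat_nth hc_def fps_one_nth)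
  have hnun: "hn * un = 1"
    unfolding un_def using hn0 by (simp add: inverse_mult_eq_1')
  have "hc * uc = 1"
    unfolding hc_def uc_def using hu by (simp flip: fps_of_real_mult)
  moreover have "(\<Sum>k\<le>m. (uc ^ Suc k) $ (m - k) * of_real (moment \<mu> k)) = (if m = 0 then 1 else 0)" for m
  proof -
    have "(\<Sum>k\<le>m. (uc ^ Suc k) $ (m - k) * of_real (moment \<mu> k)) =
        of_real (\<Sum>k\<le>m. (u ^ Suc k) $ (m - k) * moment \<mu> k)"
      unfolding uc_def fps_of_real_power [symmetric] by simp
    then show ?thesis unfolding rel by simp
  qed
  ultimately have main:
    "(\<Sum>k\<le>m. (un ^ Suc k) $ (m - k) * \<phi> ((\<Sum>i<n. X i) ^ k)) = (if m = 0 then 1 else 0)" for m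
    using free_sum_resolvent[of hc uc n un m] hnun h unfolding hn_def by (simp add: hc_def)
  have phi_Y: "\<phi> ((\<Sum>i<n. X i) ^ k) = of_real (q ^ k * moment \<nu> k)" for k
  proof -
    have "\<phi> (normalized_sum n ^ k) = of_real (1 / q) ^ k * \<phi> ((\<Sum>i<n. X i) ^ k)"
      by (simp add: normalized_sum_def scale_power phi_scale q_def)
    then show ?thesis using q(1) by (simp add: phi field_simps)
  qed
  \<comment> \<open>The moments of the unnormalized sum; the factors q^k are absorbed by rescaling
    the argument in \<open>evalM\<close>.\<close>
  define M where "M = Abs_fps (\<lambda>k. complex_of_real (q ^ k * moment \<nu> k))"
  have M: "(\<Sum>k\<le>m. (un ^ Suc k) $ (m - k) * M $ k) = (if m = 0 then 1 else 0)" for m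
    using main[of m] by (simp add: M_def phi_Y)
  have M01: "M $ 0 = 1" by (simp add: M_def m0)
  have un0: "un $ 0 = 1" using M[of 0] M01 by simp
  note co = inverse_coeffs[OF hnun un0]
  have un1: "un $ 1 = 0" "un $ 2 = - of_nat n" using co hn0 by simp_all
  have pow0: "(un ^ k) $ 0 = 1" for k by (simp add: fps_power_zeroth un0)
  have M1: "M $ 1 = 0" using M[of 1] pow0[of 2] un1 M01 by (simp add: eval_nat_numeral)
  then show "moment \<nu> 1 = 0" using q(1) by (simp add: M_def)
  have "M $ 2 = of_nat n"
    using M[of 2] pow0[of 3] un1 M01 M1 by (simp add: eval_nat_numeral)
  then have "complex_of_real (q ^ 2 * moment \<nu> 2) = of_real (real n)" by (simp add: M_def)
  then have "q ^ 2 * moment \<nu> 2 = real n" by (simp only: of_real_eq_iff)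
  then show "moment \<nu> 2 = 1" using q n by simp
  have comp: "(fps_X * M) oo (fps_X * un) = fps_X"
    unfolding fps_X_mult_compose_eq_X_iff using M by blast
  obtain L where L: "L > 0" "\<And>k. \<bar>moment \<nu> k\<bar> \<le> L ^ k"
    using compactly_supported_moments[OF nu] by metis
  have "fps_conv_radius M > 0"
    by (rule fps_conv_radius_of_moments[of "q * L"])
      (use L q in \<open>auto simp: M_def norm_mult norm_power power_mult_distrib intro!: mult_left_mono\<close>)
  then have "eval_fps M has_fps_expansion M" by (simp add: has_fps_expansion_def)
  then have 1: "(\<lambda>s. s * eval_fps M s) has_fps_expansion fps_X * M"
    by (intro fps_expansion_intros)
  define H where "H = eval_fps hc"
  have "H has_fps_expansion hc" using rad by (simp add: has_fps_expansion_def H_def hc_def)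
  then have "(\<lambda>z. 1 + of_nat n * (H z - 1)) has_fps_expansion hn"
    unfolding hn_def
    by (intro fps_expansion_intros has_fps_expansion_const[of "of_nat n", unfolded fps_of_nat])
  then have "(\<lambda>z. inverse (1 + of_nat n * (H z - 1))) has_fps_expansion un"
    unfolding un_def by (rule has_fps_expansion_inverse) (simp add: hn0)
  then have 2: "(\<lambda>z. z * inverse (1 + of_nat n * (H z - 1))) has_fps_expansion fps_X * un"
    by (intro fps_expansion_intros)
  have "((\<lambda>s. s * eval_fps M s) \<circ> (\<lambda>z. z * inverse (1 + of_nat n * (H z - 1)))) has_fps_expansion fps_X"
    using has_fps_expansion_compose[OF 1 2] by (simp add: comp)
  then have ev: "eventually (\<lambda>g. g = ((\<lambda>s. s * eval_fps M s) \<circ>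
      (\<lambda>z. z * inverse (1 + of_nat n * (H z - 1)))) g) (nhds 0)"
    unfolding has_fps_expansion_def by simp
  have evalM: "eval_fps M s = moment_gf \<nu> (of_real q * s)" for s
    by (simp add: eval_fps_def M_def moment_gf_def moment_fps_def power_mult_distrib mult_ac)
  have "((\<lambda>t. complex_of_real \<epsilon> * t) \<longlongrightarrow> of_real \<epsilon> * 0) (nhds 0)"
    by (intro tendsto_intros filterlim_ident)
  then have "filterlim (\<lambda>t. complex_of_real \<epsilon> * t) (nhds 0) (nhds 0)" by simp
  from eventually_compose_filterlim[OF ev this]
  have "eventually (\<lambda>t. let s = t / (1 + of_nat n * (H (of_real \<epsilon> * t) - 1))
      in s * moment_gf \<nu> s = t) (nhds 0)"
  proof eventually_elim
    case (elim t)
    define s where "s = t / (1 + of_nat n * (H (of_real \<epsilon> * t) - 1))"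
    have eq: "\<epsilon> = 1 / q" by (simp add: \<epsilon>_def q_def)
    have s': "of_real \<epsilon> * t * inverse (1 + of_nat n * (H (of_real \<epsilon> * t) - 1)) = s / of_real q"
      by (simp add: s_def eq divide_simps)
    have "of_real \<epsilon> * t = s / of_real q * moment_gf \<nu> s"
      using elim q(1) unfolding o_def s' evalM by simp
    then have "s * moment_gf \<nu> s = t"
      using q(1) by (simp add: eq field_simps)
    then show ?case by (simp add: s_def Let_def)
  qed
  then show "eventually (\<lambda>t. let s = t / (1 + of_nat n * (eval_fps (fps_of_real h) (of_real \<epsilon> * t) - 1))
      in s * moment_gf \<nu> s = t) (nhds 0)"
    by (simp add: H_def hc_def)
qed

end

text \<open>\<open>t * K t\<close> for the inverse \<open>K\<close> of the Cauchy transform of the normalized sum.\<close>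

abbreviation inverse_kernel :: "real \<Rightarrow> real \<Rightarrow> (complex \<Rightarrow> complex) \<Rightarrow> complex \<Rightarrow> complex" where
  "inverse_kernel \<epsilon> \<kappa> Q t \<equiv>
     1 + t\<^sup>2 + of_real (\<epsilon> * \<kappa>) * t ^ 3 + of_real (\<epsilon>\<^sup>2) * t ^ 4 * Q (of_real \<epsilon> * t)"

text \<open>With s = 1 / K t this says that the Cauchy transform takes the value t at K t. The
  variable s turns the neighbourhood of infinity into one of 0.\<close>

abbreviation inverts :: "real \<Rightarrow> real \<Rightarrow> (complex \<Rightarrow> complex) \<Rightarrow> real measure \<Rightarrow> bool" where
  "inverts \<epsilon> \<kappa> Q \<nu> \<equiv>
     eventually (\<lambda>t. let s = t / inverse_kernel \<epsilon> \<kappa> Q t in s * moment_gf \<nu> s = t) (nhds 0)"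

text \<open>Q is the remainder in h z = 1 + z^2 + \<kappa> z^3 + z^4 Q z. It depends on \<mu> only,
  and n enters through \<epsilon> alone: because of n \<epsilon>^2 = 1, the expression n (h
  (\<epsilon> t) - 1) equals t^2 + \<epsilon> \<kappa> t^3 + \<epsilon>^2 t^4 Q (\<epsilon>
  t).\<close>

theorem free_clt_gf:
  assumes mu: "real_distribution \<mu>" "compactly_supported \<mu>"
    and m1: "moment \<mu> 1 = 0" and m2: "moment \<mu> 2 = 1"
  obtains \<rho> B :: real and Q :: "complex \<Rightarrow> complex" where "\<rho> > 0" "Q holomorphic_on ball 0 \<rho>"
    "\<And>z. norm z < \<rho> \<Longrightarrow> norm (Q z) \<le> B" "\<And>z. norm z < \<rho> \<Longrightarrow> Q (cnj z) = cnj (Q z)"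
    "\<And>n \<nu> \<epsilon>. n > 0 \<Longrightarrow> normalized_sum_law \<mu> n \<nu> \<Longrightarrow> \<epsilon> = 1 / sqrt (real n) \<Longrightarrow>
      real_distribution \<nu> \<and> compactly_supported \<nu> \<and> moment \<nu> 1 = 0 \<and> moment \<nu> 2 = 1 \<and>
      inverts \<epsilon> (moment \<mu> 3) Q \<nu>"
proof -
  obtain h u where hu: "h * u = 1" and h: "h $ 0 = 1" "h $ 1 = 0" "h $ 2 = 1" "h $ 3 = moment \<mu> 3"
    and rad: "fps_conv_radius (fps_of_real h) > 0"
    and rel: "\<And>m. (\<Sum>k\<le>m. (u ^ Suc k) $ (m - k) * moment \<mu> k) = (if m = 0 then 1 else 0)"
    by (rule R_transform_exists[OF assms]) (rule that)
  define hc where "hc = fps_of_real h"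
  define Q where "Q = eval_fps (fps_shift 4 hc)"
  obtain r where r: "0 < r" "ereal r < fps_conv_radius hc"
    using rad unfolding hc_def by (metis ereal_dense2 ereal_less(2))
  have sub: "norm z < fps_conv_radius hc" if "norm z \<le> r" for z :: complex
    using that r(2) by (meson ereal_less_eq(3) le_less_trans)
  have cont: "continuous_on (cball 0 r) Q"
    unfolding Q_def
    by (rule continuous_on_subset[OF continuous_on_eval_fps]) (use sub in \<open>auto simp: in_eball_iff\<close>)
  have "bounded (Q ` cball 0 r)"
    by (intro compact_imp_bounded compact_continuous_image cont compact_cball)
  then obtain B where B: "\<And>z. z \<in> cball 0 r \<Longrightarrow> norm (Q z) \<le> B"
    unfolding bounded_iff by blast
  have shift: "fps_shift 4 hc = fps_of_real (fps_shift 4 h)"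
    unfolding hc_def by (rule fps_ext) simp
  show ?thesis
  proof (rule that[of r Q B])
    show "r > 0" by fact
    show "Q holomorphic_on ball 0 r"
      unfolding Q_def by (intro holomorphic_on_eval_fps) (use sub in \<open>auto simp: in_eball_iff\<close>)
    show "norm (Q z) \<le> B" if "norm z < r" for z
      using B that by simp
    show "Q (cnj z) = cnj (Q z)" if "norm z < r" for z
    proof -
      have "norm z < fps_conv_radius (fps_shift 4 hc)" using sub[of z] that by simp
      then show ?thesis unfolding Q_def shift by (simp add: cnj_eval_fps_of_real)
    qed
    fix n \<nu> and \<epsilon> :: real
    assume n: "n > 0" and "normalized_sum_law \<mu> n \<nu>" and eps: "\<epsilon> = 1 / sqrt (real n)"
    then obtain scale :: "complex \<Rightarrow> ncpoly \<Rightarrow> ncpoly" and star \<phi> X where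
      fi: "free_iid_sequence scale star \<phi> X \<mu>"
      and nu_law: "star_prob_space.has_law star \<phi> (free_iid_sequence.normalized_sum scale X n) \<nu>"
      unfolding normalized_sum_law_def by blast
    interpret free_iid_sequence scale star \<phi> X \<mu> by fact
    note gf = normalized_sum_law_gf[OF nu_law n hu h(1-3) rad rel, folded hc_def]
    have eps0: "\<epsilon> > 0" using n eps by simp
    have "((\<lambda>t. complex_of_real \<epsilon> * t) \<longlongrightarrow> of_real \<epsilon> * 0) (nhds 0)"
      by (intro tendsto_intros filterlim_ident)
    then have "eventually (\<lambda>t. complex_of_real \<epsilon> * t \<in> ball 0 r) (nhds 0)"
      using r(1) by (intro topological_tendstoD) auto
    with gf(3) have "inverts \<epsilon> (moment \<mu> 3) Q \<nu>"
    proof eventually_elim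
      case (elim t)
      have rad': "norm (of_real \<epsilon> * t) < fps_conv_radius hc"
        using sub elim(2) by simp
      have ne: "(of_nat n :: complex) * of_real \<epsilon> ^ 2 = 1"
      proof -
        have "real n * \<epsilon>\<^sup>2 = 1" using n by (simp add: eps power_divide)
        then have "complex_of_real (real n * \<epsilon>\<^sup>2) = 1" by simp
        then show ?thesis by simp
      qed
      have "of_nat n * (eval_fps hc (of_real \<epsilon> * t) - 1) =
          of_nat n * of_real \<epsilon> ^ 2 * (t\<^sup>2 + of_real (\<epsilon> * moment \<mu> 3) * t ^ 3 +
          of_real (\<epsilon>\<^sup>2) * t ^ 4 * Q (of_real \<epsilon> * t))"
        unfolding Q_def eval_fps_split4[OF rad']
        by (simp add: hc_def h h(2)[simplified] power_mult_distrib algebra_simps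
            power2_eq_square power3_eq_cube power4_eq_xxxx)
      then have eq: "of_nat n * (eval_fps hc (of_real \<epsilon> * t) - 1) =
          t\<^sup>2 + of_real (\<epsilon> * moment \<mu> 3) * t ^ 3 +
          of_real (\<epsilon>\<^sup>2) * t ^ 4 * Q (of_real \<epsilon> * t)"
        unfolding ne by simp
      show ?case
        using elim(1)[folded eps] unfolding Let_def eq by (simp only: add.assoc)
    qed
    with nu_law gf(1,2) show "real_distribution \<nu> \<and> compactly_supported \<nu> \<and> moment \<nu> 1 = 0 \<and> moment \<nu> 2 = 1 \<and>
      inverts \<epsilon> (moment \<mu> 3) Q \<nu>"
      by (simp add: has_law_def)
  qed
qed

section \<open>Uniformization of the complement of the support\<close>

text \<open>The polynomial \<alpha> w + b (w^2 + 1) with these coefficients interpolates N at 1 and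
  -1, which makes the difference divisible by w^2 - 1. The two points are the critical points of w +
  1 / w and correspond to the endpoints of the support.\<close>

abbreviation edge_rhs :: "(complex \<Rightarrow> complex) \<Rightarrow> complex \<Rightarrow> complex" where
  "edge_rhs N w \<equiv> (N 1 - N (-1)) / 2 * w + (N 1 + N (-1)) / 4 * (w\<^sup>2 + 1) - N w"

definition edge_solution :: "(complex \<Rightarrow> complex) \<Rightarrow> (complex \<Rightarrow> complex) \<Rightarrow> bool" where
  "edge_solution N \<zeta> \<longleftrightarrow> \<zeta> holomorphic_on ball 0 2 \<and>
     (\<forall>w\<in>ball 0 2. (w\<^sup>2 - 1) * \<zeta> w =
        edge_rhs N w)"

lemma edge_solution_exists:
  assumes N: "N holomorphic_on ball 0 2"
  shows "\<exists>\<zeta>. edge_solution N \<zeta>"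
proof -
  define g where "g w = edge_rhs N w" for w
  define g1 where "g1 z = (if z = 1 then deriv g 1 else g z / (z - 1))" for z
  define g2 where "g2 z = (if z = -1 then deriv g1 (-1) else g1 z / (z + 1))" for z
  have g: "g holomorphic_on ball 0 2"
    unfolding g_def by (intro holomorphic_intros N)
  have g0: "g 1 = 0" "g (-1) = 0" by (simp_all add: g_def field_simps)
  have g1: "g1 holomorphic_on ball 0 2"
    by (rule pole_theorem_open_0[OF g open_ball, of 1]) (auto simp: g1_def g0)
  have g1': "g1 (-1) = 0" by (simp add: g1_def g0)
  have g2: "g2 holomorphic_on ball 0 2"
    by (rule pole_theorem_open_0[OF g1 open_ball, of "-1"]) (auto simp: g2_def g1' eq_neg_iff_add_eq_0)
  have "(w\<^sup>2 - 1) * g2 w = g w" for w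
  proof -
    have "(w + 1) * g2 w = g1 w"
      using g1' by (auto simp: g2_def add_eq_0_iff2)
    moreover have "(w - 1) * g1 w = g w"
      using g0 by (auto simp: g1_def)
    ultimately show ?thesis
      by (metis (no_types, opaque_lifting) mult.assoc power2_eq_1_iff power2_eq_square square_diff_one_factored mult.commute)
  qed
  with g2 show ?thesis unfolding edge_solution_def g_def by blast
qed

text \<open>The divisor w^2 - 1 is small near 1 and -1, so the estimate is made on a circle close to
  |w| = 2, where the divisor has modulus at least 2 and the right-hand side is at most (2 + 5/2 + 1)
  M. The maximum principle carries it inside. As the problem is linear in N, the bound also yields
  Lipschitz estimates and, with M = 0, uniqueness.\<close>

lemma edge_solution_bound:
  assumes z: "edge_solution N \<zeta>" and N: "\<And>w. w \<in> ball 0 2 \<Longrightarrow> norm (N w) \<le> M"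
    and w: "w \<in> ball 0 2"
  shows "norm (\<zeta> w) \<le> 3 * M"
proof -
  define r where "r = (max (norm w) (19/10) + 2) / 2"
  have r: "norm w < r" "19/10 < r" "r < 2" using w by (auto simp: r_def)
  have sub: "cball 0 r \<subseteq> ball (0::complex) 2" using r by auto
  have hol: "\<zeta> holomorphic_on ball 0 2" using z by (simp add: edge_solution_def)
  have M0: "M \<ge> 0" using N[of 0] by (auto intro: order_trans[OF norm_ge_zero])
  have "norm (\<zeta> v) \<le> 3 * M" if v: "norm v = r" for v
  proof -
    have vb: "v \<in> ball 0 2" using v r by simp
    have eq: "(w\<^sup>2 - 1) * \<zeta> w = edge_rhs N w"
      if "w \<in> ball 0 2" for w using z that by (simp add: edge_solution_def)
    have N1: "norm (N 1) \<le> M" "norm (N (-1)) \<le> M" "norm (N v) \<le> M" using N vb by auto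
    have v2: "norm (v\<^sup>2) \<le> 4"
      using power_mono[of "norm v" 2 2] v r by (simp add: norm_power)
    have "norm ((N 1 - N (-1)) / 2 * v) \<le> M * 2"
    proof -
      have "norm (N 1 - N (-1)) \<le> 2 * M" using N1 norm_triangle_ineq4[of "N 1" "N (-1)"] by linarith
      then have "norm ((N 1 - N (-1)) / 2) \<le> M" by (simp add: norm_divide)
      then show ?thesis unfolding norm_mult using v r M0 by (intro mult_mono) auto
    qed
    moreover have "norm ((N 1 + N (-1)) / 4 * (v\<^sup>2 + 1)) \<le> (M / 2) * 5"
    proof -
      have "norm (N 1 + N (-1)) \<le> 2 * M" using N1 norm_triangle_ineq[of "N 1" "N (-1)"] by linarith
      then have "norm ((N 1 + N (-1)) / 4) \<le> M / 2" by (simp add: norm_divide)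
      moreover have "norm (v\<^sup>2 + 1) \<le> 5" using v2 norm_triangle_ineq[of "v\<^sup>2" 1] by simp
      ultimately show ?thesis unfolding norm_mult using M0 by (intro mult_mono) auto
    qed
    ultimately have "norm ((v\<^sup>2 - 1) * \<zeta> v) \<le> M * 2 + (M / 2) * 5 + M"
      unfolding eq[OF vb] using N1(3)
      by (intro order_trans[OF norm_triangle_ineq4] order_trans[OF norm_triangle_ineq] add_mono) auto
    then have up: "norm (v\<^sup>2 - 1) * norm (\<zeta> v) \<le> 11 / 2 * M" by (simp add: norm_mult)
    have "(19/10)\<^sup>2 \<le> r\<^sup>2" using r by (intro power_mono) auto
    then have "norm (v\<^sup>2 - 1) \<ge> 2"
      using norm_triangle_ineq2[of "v\<^sup>2" 1] v by (simp add: norm_power norm_mult power2_eq_square)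
    then have "2 * norm (\<zeta> v) \<le> 11 / 2 * M"
      using up by (meson mult_right_mono norm_ge_zero order_trans)
    then show ?thesis using M0 by linarith
  qed
  then have frontier: "norm (\<zeta> v) \<le> 3 * M" if "v \<in> frontier (ball 0 r)" for v
    using that r by (simp add: frontier_ball sphere_def)
  have hol_r: "\<zeta> holomorphic_on interior (ball 0 r)"
    using hol sub ball_subset_cball[of 0 r] by (metis holomorphic_on_subset interior_open open_ball order_trans)
  have cont_r: "continuous_on (closure (ball 0 r)) \<zeta>"
    using holomorphic_on_imp_continuous_on[OF hol] sub r by (simp add: closure_ball continuous_on_subset)
  have "w \<in> ball 0 r" using r by simp
  from maximum_modulus_frontier[OF hol_r cont_r bounded_ball frontier this] show ?thesis .
qed

lemma edge_solution_diff:
  assumes "edge_solution N \<zeta>" "edge_solution N' \<zeta>'"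
  shows "edge_solution (\<lambda>w. N w - N' w) (\<lambda>w. \<zeta> w - \<zeta>' w)"
  unfolding edge_solution_def
proof (intro conjI ballI)
  show "(\<lambda>w. \<zeta> w - \<zeta>' w) holomorphic_on ball 0 2"
    using assms by (auto simp: edge_solution_def intro!: holomorphic_intros)
  fix w :: complex assume "w \<in> ball 0 2"
  then have eq: "(w\<^sup>2 - 1) * \<zeta> w = edge_rhs N w"
    "(w\<^sup>2 - 1) * \<zeta>' w = edge_rhs N' w"
    using assms unfolding edge_solution_def by blast+
  show "(w\<^sup>2 - 1) * (\<zeta> w - \<zeta>' w) = (N 1 - N' 1 - (N (-1) - N' (-1))) / 2 * w +
      (N 1 - N' 1 + (N (-1) - N' (-1))) / 4 * (w\<^sup>2 + 1) - (N w - N' w)"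
    unfolding right_diff_distrib eq by (simp add: field_simps)
qed

text \<open>The reflected function solves the same division problem, and solutions are unique by the
  bound with M = 0.\<close>

lemma edge_solution_cnj:
  assumes z: "edge_solution N \<zeta>" and N: "\<And>w. w \<in> ball 0 2 \<Longrightarrow> N (cnj w) = cnj (N w)"
    and w: "w \<in> ball 0 2"
  shows "\<zeta> (cnj w) = cnj (\<zeta> w)"
proof -
  define \<zeta>' where "\<zeta>' = cnj \<circ> \<zeta> \<circ> cnj"
  have "\<zeta>' holomorphic_on ball 0 2"
  proof -
    have "cnj ` ball 0 2 = ball (0::complex) 2"
    proof (intro equalityI subsetI)
      fix x :: complex assume "x \<in> ball 0 2"
      then have "x = cnj (cnj x)" "cnj x \<in> ball 0 2" by auto
      then show "x \<in> cnj ` ball 0 2" by blast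
    qed auto
    then show ?thesis
      unfolding \<zeta>'_def using z by (intro holomorphic_on_compose_cnj_cnj) (auto simp: edge_solution_def)
  qed
  moreover have "(w\<^sup>2 - 1) * \<zeta>' w =
      edge_rhs N w" if w: "w \<in> ball 0 2" for w
  proof -
    have N1: "cnj (N 1) = N 1" "cnj (N (-1)) = N (-1)" using N[of 1] N[of "-1"] by auto
    have "cnj w \<in> ball 0 2" using w by simp
    then have "((cnj w)\<^sup>2 - 1) * \<zeta> (cnj w) =
        (N 1 - N (-1)) / 2 * cnj w + (N 1 + N (-1)) / 4 * ((cnj w)\<^sup>2 + 1) - N (cnj w)"
      using z unfolding edge_solution_def by blast
    from arg_cong[OF this, of cnj] show ?thesis
      using N[OF w] N1 by (simp add: \<zeta>'_def)
  qed
  ultimately have "edge_solution N \<zeta>'" by (simp add: edge_solution_def)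
  from edge_solution_bound[OF edge_solution_diff[OF this z], of 0 w] w
  have "\<zeta>' w = \<zeta> w" by simp
  then show ?thesis by (metis \<zeta>'_def comp_apply complex_cnj_cnj)
qed

text \<open>
  With \<open>\<psi> w = w (1 + \<zeta> w)\<close>, the equation \<open>1 / \<psi> + \<psi> + f \<psi> = \<alpha> + (1 + b) (w + 1 / w)\<close> reads
  \<open>(w\<^sup>2 - 1) \<zeta> = \<alpha> w + b (w\<^sup>2 + 1) - edge_defect f \<zeta>\<close>.
\<close>

definition edge_defect :: "(complex \<Rightarrow> complex) \<Rightarrow> (complex \<Rightarrow> complex) \<Rightarrow> complex \<Rightarrow> complex" where
  "edge_defect f \<zeta> w = (\<zeta> w)\<^sup>2 / (1 + \<zeta> w) + w * f (w * (1 + \<zeta> w))"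

lemma norm_one_plus_ge:
  fixes a :: complex
  assumes "norm a \<le> 1 / 40"
  shows "norm (1 + a) \<ge> 39 / 40" "1 + a \<noteq> 0"
proof -
  show 1: "norm (1 + a) \<ge> 39 / 40"
    using norm_diff_ineq[of 1 a] assms by simp
  then show "1 + a \<noteq> 0" by force
qed

section \<open>Contraction estimates and the fixed point\<close>

context
  fixes f :: "complex \<Rightarrow> complex" and \<delta> :: real
  assumes f: "f holomorphic_on ball 0 4" and f_le: "\<And>z. z \<in> ball 0 4 \<Longrightarrow> norm (f z) \<le> \<delta>"
    and \<delta>: "\<delta> \<le> 1 / 480"
begin

lemma edge_delta_nonneg: "\<delta> \<ge> 0"
  using f_le[of 0] by (auto intro: order_trans[OF norm_ge_zero])

text \<open>Cauchy's estimate on unit discs, which stay inside the disc of radius 4, bounds the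
  derivative by \<delta> on the disc of radius 3. By \<open>edge_arg\<close> all arguments of f lie
  there.\<close>

lemma edge_lipschitz:
  assumes "a \<in> ball 0 3" "b \<in> ball 0 3"
  shows "norm (f a - f b) \<le> \<delta> * norm (a - b)"
proof (rule field_differentiable_bound[OF convex_ball[of 0 3] _ _ assms(1,2)])
  fix z :: complex assume z: "z \<in> ball 0 3"
  have z4: "z \<in> ball 0 4" using z by auto
  have sub: "cball z 1 \<subseteq> ball 0 4"
  proof
    fix y assume "y \<in> cball z 1"
    then have "norm (y - z) \<le> 1" by (simp add: dist_norm norm_minus_commute)
    then have "norm y < 4" using norm_triangle_ineq[of "y - z" z] z by simp
    then show "y \<in> ball 0 4" by simp
  qed
  show "(f has_field_derivative deriv f z) (at z within ball 0 3)"
    using holomorphic_derivI[OF f open_ball z4] by (rule has_field_derivative_at_within)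
  have "norm ((deriv ^^ 1) f z) \<le> fact 1 * \<delta> / 1 ^ 1"
  proof (rule Cauchy_inequality)
    show "f holomorphic_on ball z 1"
      using f sub by (meson ball_subset_cball holomorphic_on_subset order_trans)
    show "continuous_on (cball z 1) f"
      using f sub by (meson holomorphic_on_imp_continuous_on continuous_on_subset)
    show "norm (f x) \<le> \<delta>" if "norm (z - x) = 1" for x
    proof -
      have "x \<in> cball z 1" using that by (simp add: dist_norm)
      then show ?thesis using sub by (intro f_le) blast
    qed
  qed auto
  then show "norm (deriv f z) \<le> \<delta>" by simp
qed

lemma edge_arg:
  fixes a w :: complex
  assumes "w \<in> ball 0 2" "norm a \<le> 1 / 40"
  shows "norm (w * (1 + a)) < 3"
proof -
  have "norm (1 + a) \<le> 41 / 40" using norm_triangle_ineq[of 1 a] assms by simp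
  then have "norm w * norm (1 + a) \<le> 2 * (41 / 40)" using assms by (intro mult_mono) auto
  then show ?thesis by (simp add: norm_mult)
qed

lemma edge_defect_holomorphic:
  assumes "\<zeta> holomorphic_on ball 0 2" "\<And>w. w \<in> ball 0 2 \<Longrightarrow> norm (\<zeta> w) \<le> 1 / 40"
  shows "edge_defect f \<zeta> holomorphic_on ball 0 2"
proof -
  have "(f \<circ> (\<lambda>w. w * (1 + \<zeta> w))) holomorphic_on ball 0 2"
    by (rule holomorphic_on_compose_gen[OF _ f])
      (use assms edge_arg in \<open>force intro!: holomorphic_intros\<close>)+
  then show ?thesis
    unfolding edge_defect_def[abs_def] o_def
    by (intro holomorphic_intros assms(1)) (use assms(2) norm_one_plus_ge(2) in auto)
qed

text \<open>Two contributions of at most 1/12 each: a^2 / (1 + a) has a derivative of order a, and f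
  has Lipschitz constant \<delta>. Together with the factor 3 of \<open>edge_solution_bound\<close>
  the iteration contracts by 1/2.\<close>

lemma edge_defect_lipschitz:
  assumes w: "w \<in> ball 0 2" and a: "norm (\<zeta> w) \<le> 1 / 40" "norm (\<zeta>' w) \<le> 1 / 40"
  shows "norm (edge_defect f \<zeta> w - edge_defect f \<zeta>' w) \<le> norm (\<zeta> w - \<zeta>' w) / 6"
proof -
  define x y where "x = \<zeta> w" and "y = \<zeta>' w"
  note nx = norm_one_plus_ge[OF a(1), folded x_def] and ny = norm_one_plus_ge[OF a(2), folded y_def]
  have "norm (f (w * (1 + x)) - f (w * (1 + y))) \<le> \<delta> * norm (w * (1 + x) - w * (1 + y))"
    using edge_arg[OF w] a by (intro edge_lipschitz) (auto simp: x_def y_def)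
  also have "w * (1 + x) - w * (1 + y) = w * (x - y)" by (simp add: algebra_simps)
  also have "\<delta> * norm (w * (x - y)) \<le> 1 / 480 * (2 * norm (x - y))"
    unfolding norm_mult using \<delta> edge_delta_nonneg w by (intro mult_mono) auto
  finally have "norm (w * (f (w * (1 + x)) - f (w * (1 + y)))) \<le> 2 * (1 / 480 * (2 * norm (x - y)))"
    unfolding norm_mult using w by (intro mult_mono) auto
  then have 1: "norm (w * (f (w * (1 + x)) - f (w * (1 + y)))) \<le> norm (x - y) / 12"
    using norm_ge_zero[of "x - y"] by linarith
  have eq: "x\<^sup>2 / (1 + x) - y\<^sup>2 / (1 + y) = (x - y) * ((x + y + x * y) / ((1 + x) * (1 + y)))"
    using nx(2) ny(2) by (simp add: divide_simps) (simp add: algebra_simps power2_eq_square)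
  have num: "norm (x + y + x * y) \<le> 1 / 40 + 1 / 40 + 1 / 40 * (1 / 40)"
    using a unfolding x_def y_def
    by (intro order_trans[OF norm_triangle_ineq] add_mono order_trans[OF norm_mult_ineq] mult_mono) auto
  have den: "norm ((1 + x) * (1 + y)) \<ge> 39 / 40 * (39 / 40)"
    unfolding norm_mult using nx ny by (intro mult_mono) auto
  have "norm ((x + y + x * y) / ((1 + x) * (1 + y))) \<le>
      (1 / 40 + 1 / 40 + 1 / 40 * (1 / 40)) / (39 / 40 * (39 / 40))"
    unfolding norm_divide using num den by (intro frac_le) auto
  also have "\<dots> \<le> 1 / 12" by simp
  finally have 2: "norm (x\<^sup>2 / (1 + x) - y\<^sup>2 / (1 + y)) \<le> norm (x - y) * (1 / 12)"
    unfolding eq norm_mult by (intro mult_left_mono) auto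
  have "edge_defect f \<zeta> w - edge_defect f \<zeta>' w =
      (x\<^sup>2 / (1 + x) - y\<^sup>2 / (1 + y)) + w * (f (w * (1 + x)) - f (w * (1 + y)))"
    by (simp add: edge_defect_def x_def y_def algebra_simps)
  also have "norm \<dots> \<le> norm (x - y) * (1 / 12) + norm (x - y) / 12"
    by (rule order_trans[OF norm_triangle_ineq add_mono[OF 2 1]])
  finally show ?thesis by (simp add: x_def y_def)
qed

text \<open>\<open>SOME\<close> picks a genuine solution as long as the previous iterate is
  holomorphic and bounded by 1/40, which \<open>edge_iterate_bounds\<close> maintains.\<close>

primrec edge_iterate :: "nat \<Rightarrow> complex \<Rightarrow> complex" where
  "edge_iterate 0 = (\<lambda>_. 0)"
| "edge_iterate (Suc n) = (SOME \<zeta>. edge_solution (edge_defect f (edge_iterate n)) \<zeta>)"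

lemma edge_iterate_step:
  assumes "edge_iterate n holomorphic_on ball 0 2"
    "\<And>w. w \<in> ball 0 2 \<Longrightarrow> norm (edge_iterate n w) \<le> 1 / 40"
  shows "edge_solution (edge_defect f (edge_iterate n)) (edge_iterate (Suc n))"
  unfolding edge_iterate.simps
  by (rule someI_ex[OF edge_solution_exists[OF edge_defect_holomorphic[OF assms]]])

text \<open>The first step has size 3 times 2 \<delta>, and the bound on the steps is halved each
  time, so all iterates stay below 12 \<delta>. The hypothesis that \<delta> is at most 1/480 turns
  this into the bound 1/40 under which the defect contracts.\<close>

lemma edge_iterate_bounds:
  "edge_iterate n holomorphic_on ball 0 2 \<and>
   (\<forall>w\<in>ball 0 2. norm (edge_iterate n w) \<le> 12 * \<delta> * (1 - 1 / 2 ^ n) \<and>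
      norm (edge_iterate (Suc n) w - edge_iterate n w) \<le> 6 * \<delta> / 2 ^ n)"
proof (induction n)
  let ?Z = edge_iterate
  case 0
  have "edge_solution (edge_defect f (?Z 0)) (?Z (Suc 0))"
    by (rule edge_iterate_step) auto
  moreover have "norm (edge_defect f (?Z 0) w) \<le> 2 * \<delta>" if "w \<in> ball 0 2" for w
  proof -
    have "norm (w * f w) \<le> 2 * \<delta>"
      unfolding norm_mult using that by (intro mult_mono f_le) auto
    then show ?thesis by (simp add: edge_defect_def)
  qed
  ultimately have "norm (?Z (Suc 0) w) \<le> 3 * (2 * \<delta>)" if "w \<in> ball 0 2" for w
    using that by (rule edge_solution_bound)
  then show ?case by (simp del: edge_iterate.simps(2))
next
  let ?Z = edge_iterate
  case (Suc n)
  have small: "12 * \<delta> * (1 - 1 / 2 ^ m) \<le> 1 / 40" for m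
  proof -
    have "12 * \<delta> * (1 - 1 / 2 ^ m) \<le> 12 * \<delta> * 1"
      using edge_delta_nonneg by (intro mult_left_mono) auto
    then show ?thesis using \<delta> by simp
  qed
  have n_le: "norm (?Z n w) \<le> 1 / 40" if "w \<in> ball 0 2" for w
    using Suc.IH that small[of n] by (meson order_trans)
  have sol: "edge_solution (edge_defect f (?Z n)) (?Z (Suc n))"
    using Suc.IH n_le by (intro edge_iterate_step) auto
  then have hol: "?Z (Suc n) holomorphic_on ball 0 2"
    by (simp add: edge_solution_def)
  have bd: "norm (?Z (Suc n) w) \<le> 12 * \<delta> * (1 - 1 / 2 ^ Suc n)" if "w \<in> ball 0 2" for w
  proof -
    have "norm (?Z (Suc n) w) \<le>
        norm (?Z n w) + norm (?Z (Suc n) w - ?Z n w)"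
      by (rule norm_triangle_sub)
    also have "\<dots> \<le> 12 * \<delta> * (1 - 1 / 2 ^ n) + 6 * \<delta> / 2 ^ n"
      using Suc.IH that by (intro add_mono) auto
    also have "\<dots> = 12 * \<delta> * (1 - 1 / 2 ^ Suc n)" by (simp add: algebra_simps)
    finally show ?thesis .
  qed
  have Suc_le: "norm (?Z (Suc n) w) \<le> 1 / 40" if "w \<in> ball 0 2" for w
    using bd[OF that] small[of "Suc n"] by linarith
  have sol': "edge_solution (edge_defect f (?Z (Suc n))) (?Z (Suc (Suc n)))"
    using hol Suc_le by (rule edge_iterate_step)
  have "norm (?Z (Suc (Suc n)) w - ?Z (Suc n) w) \<le> 3 * (6 * \<delta> / 2 ^ n / 6)"
    if w: "w \<in> ball 0 2" for w
    using edge_solution_diff[OF sol' sol] _ w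
  proof (rule edge_solution_bound)
    fix v :: complex assume v: "v \<in> ball 0 2"
    have "norm (edge_defect f (?Z (Suc n)) v - edge_defect f (?Z n) v) \<le>
        norm (?Z (Suc n) v - ?Z n v) / 6"
      using v Suc_le n_le by (intro edge_defect_lipschitz) auto
    also have "\<dots> \<le> 6 * \<delta> / 2 ^ n / 6"
      using Suc.IH v by (intro divide_right_mono) auto
    finally show "norm (edge_defect f (?Z (Suc n)) v - edge_defect f (?Z n) v) \<le>
        6 * \<delta> / 2 ^ n / 6" .
  qed
  then have "norm (?Z (Suc (Suc n)) w - ?Z (Suc n) w) \<le> 6 * \<delta> / 2 ^ Suc n"
    if "w \<in> ball 0 2" for w using that by simp
  with hol bd show ?case by blast
qed

text \<open>The geometric bounds give uniform convergence on the whole disc, so the limit is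
  holomorphic; equation and symmetry pass to it pointwise.\<close>

lemma edge_fixed_point:
  assumes fsym: "\<And>z. z \<in> ball 0 4 \<Longrightarrow> f (cnj z) = cnj (f z)"
  obtains \<zeta> where "edge_solution (edge_defect f \<zeta>) \<zeta>"
    "\<And>w. w \<in> ball 0 2 \<Longrightarrow> norm (\<zeta> w) \<le> 12 * \<delta>"
    "\<And>w. w \<in> ball 0 2 \<Longrightarrow> \<zeta> (cnj w) = cnj (\<zeta> w)"
proof -
  let ?Z = edge_iterate
  define \<zeta> where "\<zeta> w = suminf (\<lambda>n. ?Z (Suc n) w - ?Z n w)" for w
  have hol: "?Z n holomorphic_on ball 0 2" for n using edge_iterate_bounds by blast
  have le: "norm (?Z n w) \<le> 12 * \<delta>" if "w \<in> ball 0 2" for n w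
  proof -
    have "12 * \<delta> * (1 - 1 / 2 ^ n) \<le> 12 * \<delta> * 1"
      using edge_delta_nonneg by (intro mult_left_mono) auto
    then show ?thesis using edge_iterate_bounds[of n] that by fastforce
  qed
  have le': "norm (?Z n w) \<le> 1 / 40" if "w \<in> ball 0 2" for n w
    using le[OF that, of n] \<delta> by linarith
  have sol: "edge_solution (edge_defect f (?Z n)) (?Z (Suc n))" for n
    using hol le' by (rule edge_iterate_step)
  have tel: "(\<Sum>i<n. ?Z (Suc i) w - ?Z i w) = ?Z n w" for n w
    by (subst sum_lessThan_telescope) simp
  have "uniform_limit (ball 0 2) (\<lambda>n w. \<Sum>i<n. ?Z (Suc i) w - ?Z i w) \<zeta> sequentially"
    unfolding \<zeta>_def
  proof (rule Weierstrass_m_test)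
    show "norm (?Z (Suc n) w - ?Z n w) \<le> 6 * \<delta> * (1 / 2) ^ n" if "w \<in> ball 0 2" for n w
      using edge_iterate_bounds[of n] that by (simp add: power_divide)
    show "summable (\<lambda>n. 6 * \<delta> * (1 / 2) ^ n)" by (intro summable_mult summable_geometric) simp
  qed
  then have unif: "uniform_limit (ball 0 2) ?Z \<zeta> sequentially" unfolding tel .
  have lim: "(\<lambda>n. ?Z n w) \<longlonglongrightarrow> \<zeta> w" if "w \<in> ball 0 2" for w
    by (rule tendsto_uniform_limitI[OF unif that])
  have hol_z: "\<zeta> holomorphic_on ball 0 2"
  proof (rule holomorphic_uniform_sequence[OF open_ball hol])
    fix x :: complex assume "x \<in> ball 0 2"
    then obtain d where "d > 0" "cball x d \<subseteq> ball 0 2"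
      by (metis open_ball open_contains_cball)
    then show "\<exists>d>0. cball x d \<subseteq> ball 0 2 \<and> uniform_limit (cball x d) ?Z \<zeta> sequentially"
      using uniform_limit_on_subset[OF unif] by blast
  qed
  have z_le: "norm (\<zeta> w) \<le> 12 * \<delta>" if "w \<in> ball 0 2" for w
    by (rule tendsto_upperbound[OF tendsto_norm[OF lim[OF that]]]) (use le[OF that] in auto)
  have z_le': "norm (\<zeta> w) \<le> 1 / 40" if "w \<in> ball 0 2" for w
    using z_le[OF that] \<delta> by linarith
  have lim_def: "(\<lambda>n. edge_defect f (?Z n) w) \<longlonglongrightarrow> edge_defect f \<zeta> w" if w: "w \<in> ball 0 2" for w
  proof (rule LIM_zero_cancel, rule Lim_null_comparison)
    show "\<forall>\<^sub>F n in sequentially. norm (edge_defect f (?Z n) w - edge_defect f \<zeta> w) \<le>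
        norm (?Z n w - \<zeta> w) / 6"
      using w le' z_le' by (intro always_eventually allI edge_defect_lipschitz) auto
    have "(\<lambda>n. norm (?Z n w - \<zeta> w) / 6) \<longlonglongrightarrow> norm (\<zeta> w - \<zeta> w) / 6"
      by (intro tendsto_intros lim w) simp
    then show "(\<lambda>n. norm (?Z n w - \<zeta> w) / 6) \<longlonglongrightarrow> 0" by simp
  qed
  have "(w\<^sup>2 - 1) * \<zeta> w = edge_rhs (edge_defect f \<zeta>) w"
    if w: "w \<in> ball 0 2" for w
  proof (rule LIMSEQ_unique)
    show "(\<lambda>n. (w\<^sup>2 - 1) * ?Z (Suc n) w) \<longlonglongrightarrow> (w\<^sup>2 - 1) * \<zeta> w"
      by (intro tendsto_intros LIMSEQ_Suc lim w)
    have "(\<lambda>n. edge_rhs (edge_defect f (?Z n)) w) \<longlonglongrightarrow>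
      edge_rhs (edge_defect f \<zeta>) w"
      by (intro tendsto_intros lim_def w) auto
    then show "(\<lambda>n. (w\<^sup>2 - 1) * ?Z (Suc n) w) \<longlonglongrightarrow>
      edge_rhs (edge_defect f \<zeta>) w"
      using sol w unfolding edge_solution_def by simp
  qed
  then have fixpoint: "edge_solution (edge_defect f \<zeta>) \<zeta>"
    using hol_z unfolding edge_solution_def by blast
  have sym: "\<zeta> (cnj w) = cnj (\<zeta> w)" if w: "w \<in> ball 0 2" for w
  proof -
    have "\<forall>w\<in>ball 0 2. ?Z n (cnj w) = cnj (?Z n w)" for n
    proof (induction n)
      case (Suc n)
      show ?case
      proof
        fix w :: complex assume w: "w \<in> ball 0 2"
        show "?Z (Suc n) (cnj w) = cnj (?Z (Suc n) w)"
        proof (rule edge_solution_cnj[OF sol _ w])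
          fix v :: complex assume v: "v \<in> ball 0 2"
          have "v * (1 + ?Z n v) \<in> ball 0 4" using edge_arg[OF v le'[OF v, of n]] by simp
          from fsym[OF this] show "edge_defect f (?Z n) (cnj v) = cnj (edge_defect f (?Z n) v)"
            using Suc.IH v by (simp add: edge_defect_def)
        qed
      qed
    qed simp
    then have "(\<lambda>n. ?Z n (cnj w)) \<longlonglongrightarrow> cnj (\<zeta> w)"
      using tendsto_cnj[OF lim[OF w]] w by simp
    moreover have "(\<lambda>n. ?Z n (cnj w)) \<longlonglongrightarrow> \<zeta> (cnj w)" using w by (intro lim) simp
    ultimately show ?thesis using LIMSEQ_unique by blast
  qed
  show ?thesis by (rule that[OF fixpoint z_le sym])
qed

end

section \<open>Expansion of the uniformizing map\<close>

text \<open>Cauchy's inequality on the circle of radius 3/2 is the origin of the ratio 2/3 in all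
  later coefficient bounds. The coefficients are real because the conjugated series expands the same
  function.\<close>

lemma holomorphic_symmetric_coeffs:
  assumes h: "h holomorphic_on ball 0 2" and bd: "\<And>w. w \<in> ball 0 2 \<Longrightarrow> norm (h w) \<le> M"
    and sym: "\<And>w. w \<in> ball 0 2 \<Longrightarrow> h (cnj w) = cnj (h w)"
  obtains d :: "nat \<Rightarrow> real" where "\<And>k. \<bar>d k\<bar> \<le> M * (2 / 3) ^ k"
    "\<And>w. w \<in> ball 0 2 \<Longrightarrow> (\<lambda>k. of_real (d k) * w ^ k) sums h w"
proof -
  define c where "c k = (deriv ^^ k) h 0 / fact k" for k
  have sums: "(\<lambda>k. c k * w ^ k) sums h w" if "w \<in> ball 0 2" for w
    using holomorphic_power_series[OF h that] by (simp add: c_def)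
  have ev: "eventually (\<lambda>w::complex. w \<in> ball 0 2) (nhds 0)"
    by (intro eventually_nhds_in_open) auto
  have "h has_fps_expansion Abs_fps c"
    by (intro has_fps_expansionI) (use ev sums in \<open>auto elim: eventually_mono\<close>)
  moreover have "(\<lambda>k. cnj (c k) * w ^ k) sums h w" if "w \<in> ball 0 2" for w
  proof -
    have "(\<lambda>k. cnj (c k * cnj w ^ k)) sums cnj (h (cnj w))"
      using sums[of "cnj w"] that by (subst sums_cnj) auto
    then show ?thesis using sym[of w] that by simp
  qed
  then have "h has_fps_expansion Abs_fps (\<lambda>k. cnj (c k))"
    by (intro has_fps_expansionI) (use ev in \<open>auto elim: eventually_mono\<close>)
  ultimately have "Abs_fps c = Abs_fps (\<lambda>k. cnj (c k))"
    by (rule fps_expansion_unique_complex)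
  then have "c k = cnj (c k)" for k
    by (metis fps_nth_Abs_fps)
  then have real: "of_real (Re (c k)) = c k" for k
    by (metis Reals_cnj_iff of_real_Re)
  have sub: "cball 0 (3/2) \<subseteq> ball (0::complex) 2" by auto
  have "norm (c k) \<le> M * (2 / 3) ^ k" for k
  proof -
    have "norm ((deriv ^^ k) h 0) \<le> fact k * M / (3/2) ^ k"
    proof (rule Cauchy_inequality)
      show "h holomorphic_on ball 0 (3/2)"
        using h by (rule holomorphic_on_subset) auto
      show "continuous_on (cball 0 (3/2)) h"
        using holomorphic_on_imp_continuous_on[OF h] sub by (rule continuous_on_subset)
      show "norm (h x) \<le> M" if "norm (0 - x) = 3/2" for x
        using that by (intro bd) auto
    qed auto
    then show ?thesis by (simp add: c_def norm_divide power_divide field_simps)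
  qed
  then have "\<bar>Re (c k)\<bar> \<le> M * (2 / 3) ^ k" for k
    by (meson abs_Re_le_cmod order_trans)
  then show ?thesis
    by (rule that[of "\<lambda>k. Re (c k)"]) (use sums real in auto)
qed

text \<open>The last conjunct is K (\<psi> w) = \<alpha> + \<beta> (w + 1 / w) multiplied by \<psi>
  w = w (1 + \<zeta> w), which clears the poles at w = 0. The first one isolates the linear term - e
  \<kappa> w of \<zeta>; the rest is of second order in e and decays geometrically in k.\<close>

abbreviation uniformizes :: "real \<Rightarrow> real \<Rightarrow> real \<Rightarrow> (complex \<Rightarrow> complex) \<Rightarrow>
    real \<Rightarrow> real \<Rightarrow> (nat \<Rightarrow> real) \<Rightarrow> (complex \<Rightarrow> complex) \<Rightarrow> bool" where
  "uniformizes C e \<kappa> Q \<alpha> \<beta> z \<zeta> \<equiv>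
     (\<forall>k. \<bar>z k + (if k = 1 then e * \<kappa> else 0)\<bar> \<le> C * e\<^sup>2 * (2 / 3) ^ k) \<and>
     (\<forall>w\<in>ball 0 2. (\<lambda>k. of_real (z k) * w ^ k) sums \<zeta> w) \<and>
     (\<forall>w\<in>ball 0 2. let t = w * (1 + \<zeta> w) in inverse_kernel e \<kappa> Q t =
        (1 + \<zeta> w) * (of_real \<alpha> * w + of_real \<beta> * (w\<^sup>2 + 1)))"

theorem uniformization:
  fixes \<kappa> \<rho> B :: real
  assumes \<rho>: "\<rho> > 0" and Q: "Q holomorphic_on ball 0 \<rho>"
    and Q_le: "\<And>z. norm z < \<rho> \<Longrightarrow> norm (Q z) \<le> B"
    and Q_cnj: "\<And>z. norm z < \<rho> \<Longrightarrow> Q (cnj z) = cnj (Q z)"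
  obtains C e\<^sub>0 where "C > 0" "e\<^sub>0 > 0"
    "\<And>e. 0 < e \<Longrightarrow> e < e\<^sub>0 \<Longrightarrow> \<exists>\<alpha> \<beta> z \<zeta>. uniformizes C e \<kappa> Q \<alpha> \<beta> z \<zeta>"
proof -
  have B0: "B \<ge> 0" using Q_le[of 0] \<rho> by (auto intro: order_trans[OF norm_ge_zero])
  \<comment> \<open>The perturbation f below is at most e (4^2 |\<kappa>| + 4^3 B) on |t| < 4,
    whence A. The third bound in \<open>e\<^sub>0\<close> ensures that \<delta> = e A is at most
    1/480, and \<rho> / 4 keeps e t in the disc of Q. In C the summands bound the three second-order
    terms of \<open>N_le\<close>, and the factor 3 comes from the division.\<close>
  define A where "A = 16 * \<bar>\<kappa>\<bar> + 64 * B + 1"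
  define C where "C = 3 * (288 * A\<^sup>2 + 288 * \<bar>\<kappa>\<bar> * A + 54 * B + 1)"
  define e\<^sub>0 where "e\<^sub>0 = min 1 (min (\<rho> / 4) (1 / (480 * A)))"
  have A: "A \<ge> 1" using B0 by (simp add: A_def)
  have C: "C > 0" using A B0 by (auto simp: C_def intro!: add_nonneg_pos add_nonneg_nonneg)
  have e\<^sub>0: "e\<^sub>0 > 0" using \<rho> A by (simp add: e\<^sub>0_def)
  show ?thesis
  proof (rule that[OF C e\<^sub>0])
    fix e :: real assume e: "0 < e" "e < e\<^sub>0"
    then have e1: "e \<le> 1" "4 * e \<le> \<rho>" "e * A \<le> 1 / 480"
      using A by (auto simp: e\<^sub>0_def field_simps)
    define f where "f t = of_real (e * \<kappa>) * t\<^sup>2 + of_real (e\<^sup>2) * t ^ 3 * Q (of_real e * t)" for t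
    have in_ball: "norm (of_real e * t) < \<rho>" if "t \<in> ball 0 4" for t :: complex
    proof -
      have "norm (of_real e * t) < e * 4"
        using that e(1) by (simp add: norm_mult)
      then show ?thesis using e1(2) by simp
    qed
    have "(Q \<circ> (\<lambda>t. of_real e * t)) holomorphic_on ball 0 4"
      by (rule holomorphic_on_compose_gen[OF _ Q]) (use in_ball in \<open>auto intro!: holomorphic_intros\<close>)
    then have f_hol: "f holomorphic_on ball 0 4"
      unfolding f_def[abs_def] o_def by (intro holomorphic_intros)
    have f_le: "norm (f t) \<le> e * A" if t: "t \<in> ball 0 4" for t
    proof -
      have "norm (of_real (e * \<kappa>) * t\<^sup>2) \<le> e * \<bar>\<kappa>\<bar> * 4\<^sup>2"
        unfolding norm_mult norm_power using t e
        by (intro mult_mono power_mono) (auto simp: abs_mult norm_mult)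
      moreover have "norm (of_real (e\<^sup>2) * t ^ 3 * Q (of_real e * t)) \<le> e * 4 ^ 3 * B"
      proof -
        have "e\<^sup>2 \<le> e" using e e1 by (simp add: power2_eq_square mult_left_le)
        then show ?thesis
          unfolding norm_mult norm_power using t e B0 Q_le[OF in_ball[OF t]]
          by (intro mult_mono power_mono) (auto simp: norm_power)
      qed
      ultimately have "norm (f t) \<le> e * \<bar>\<kappa>\<bar> * 4\<^sup>2 + e * 4 ^ 3 * B"
        unfolding f_def by (intro order_trans[OF norm_triangle_ineq] add_mono)
      also have "\<dots> \<le> e * A" using e by (simp add: A_def algebra_simps)
      finally show ?thesis .
    qed
    have f_cnj: "f (cnj t) = cnj (f t)" if "t \<in> ball 0 4" for t
      using Q_cnj[OF in_ball[OF that]] by (simp add: f_def)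
    obtain \<zeta> where sol: "edge_solution (edge_defect f \<zeta>) \<zeta>"
      and z_le: "\<And>w. w \<in> ball 0 2 \<Longrightarrow> norm (\<zeta> w) \<le> 12 * (e * A)"
      and z_cnj: "\<And>w. w \<in> ball 0 2 \<Longrightarrow> \<zeta> (cnj w) = cnj (\<zeta> w)"
      by (rule edge_fixed_point[OF f_hol f_le e1(3) f_cnj]) (assumption, assumption, rule that)
    define N where "N = edge_defect f \<zeta>"
    have z_le': "norm (\<zeta> w) \<le> 1 / 40" if "w \<in> ball 0 2" for w
      using z_le[OF that] e1(3) by linarith
    have arg: "w * (1 + \<zeta> w) \<in> ball 0 4" "norm (w * (1 + \<zeta> w)) \<le> 3" if "w \<in> ball 0 2" for w
      using edge_arg[OF f_hol f_le e1(3) that z_le'[OF that]] by auto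
    have N_cnj: "N (cnj w) = cnj (N w)" if "w \<in> ball 0 2" for w
      using f_cnj[OF arg(1)[OF that]] z_cnj[OF that] by (simp add: N_def edge_defect_def)
    have "cnj (N 1) = N 1" "cnj (N (-1)) = N (-1)" using N_cnj[of 1] N_cnj[of "-1"] by auto
    then obtain n1 n2 where N1: "N 1 = of_real n1" "N (-1) = of_real n2"
      by (metis Reals_cases Reals_cnj_iff)
    define \<alpha> where "\<alpha> = (n1 - n2) / 2"
    define \<beta> where "\<beta> = 1 + (n1 + n2) / 4"
    \<comment> \<open>Linear response: for the right-hand side e \<kappa> w^3 the division problem
      has the exact solution - e \<kappa> w. Subtracting it leaves a defect of second order.\<close>
    have "edge_solution (\<lambda>w. N w - of_real (e * \<kappa>) * w ^ 3) (\<lambda>w. \<zeta> w - - (of_real (e * \<kappa>) * w))"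
    proof (rule edge_solution_diff)
      show "edge_solution N \<zeta>" using sol by (simp add: N_def)
      show "edge_solution (\<lambda>w. of_real (e * \<kappa>) * w ^ 3) (\<lambda>w. - (of_real (e * \<kappa>) * w))"
        unfolding edge_solution_def
        by (auto intro!: holomorphic_intros simp: algebra_simps power2_eq_square power3_eq_cube)
    qed
    then have sol': "edge_solution (\<lambda>w. N w - of_real (e * \<kappa>) * w ^ 3) (\<lambda>w. \<zeta> w + of_real (e * \<kappa>) * w)"
      by simp
    have N_le: "norm (N w - of_real (e * \<kappa>) * w ^ 3) \<le> (C / 3) * e\<^sup>2" if w: "w \<in> ball 0 2" for w
    proof -
      define a where "a = \<zeta> w"
      define t where "t = w * (1 + a)"
      have a: "norm a \<le> 12 * (e * A)" "norm a \<le> 1 / 40" using z_le[OF w] z_le'[OF w] by (auto simp: a_def)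
      have t: "t \<in> ball 0 4" "norm t \<le> 3" using arg[OF w] by (auto simp: t_def a_def)
      note na = norm_one_plus_ge[OF a(2)]
      have 1: "norm (a\<^sup>2 / (1 + a)) \<le> 288 * A\<^sup>2 * e\<^sup>2"
      proof -
        have "norm (a\<^sup>2 / (1 + a)) \<le> (12 * (e * A))\<^sup>2 / (1 / 2)"
          unfolding norm_divide norm_power using a na by (intro frac_le power_mono) auto
        then show ?thesis by (simp add: power_mult_distrib mult_ac)
      qed
      have 2: "norm (of_real (e * \<kappa>) * w ^ 3 * (2 * a + a\<^sup>2)) \<le> 288 * \<bar>\<kappa>\<bar> * A * e\<^sup>2"
      proof -
        have "norm (a * a) \<le> 1 * norm a" unfolding norm_mult using a(2) by (intro mult_right_mono) auto
        then have "norm (2 * a + a\<^sup>2) \<le> 3 * norm a"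
          using norm_triangle_ineq[of "2 * a" "a\<^sup>2"] by (simp add: norm_mult power2_eq_square)
        then have "norm (2 * a + a\<^sup>2) \<le> 3 * (12 * (e * A))" using a by linarith
        then have "norm (of_real (e * \<kappa>) * w ^ 3 * (2 * a + a\<^sup>2)) \<le>
            e * \<bar>\<kappa>\<bar> * 2 ^ 3 * (3 * (12 * (e * A)))"
          unfolding norm_mult[of "of_real (e * \<kappa>) * w ^ 3"] norm_mult[of "of_real (e * \<kappa>)" "w ^ 3"]
            norm_power[of w] using w e
          by (intro mult_mono power_mono) (auto simp: abs_mult norm_mult)
        then show ?thesis by (simp add: power2_eq_square mult_ac)
      qed
      have 3: "norm (w * (of_real (e\<^sup>2) * t ^ 3 * Q (of_real e * t))) \<le> 54 * B * e\<^sup>2"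
      proof -
        have "norm (w * (of_real (e\<^sup>2) * t ^ 3 * Q (of_real e * t))) \<le> 2 * (e\<^sup>2 * 3 ^ 3 * B)"
          unfolding norm_mult norm_power using w t Q_le[OF in_ball[OF t(1)]] B0
          by (intro mult_mono power_mono) (auto simp: norm_power)
        then show ?thesis by (simp add: mult_ac)
      qed
      have "N w - of_real (e * \<kappa>) * w ^ 3 = a\<^sup>2 / (1 + a) +
          of_real (e * \<kappa>) * w ^ 3 * (2 * a + a\<^sup>2) + w * (of_real (e\<^sup>2) * t ^ 3 * Q (of_real e * t))"
        unfolding N_def edge_defect_def a_def[symmetric] t_def[symmetric] f_def
        by (simp add: t_def algebra_simps power2_eq_square power3_eq_cube)
      also have "norm \<dots> \<le> 288 * A\<^sup>2 * e\<^sup>2 + 288 * \<bar>\<kappa>\<bar> * A * e\<^sup>2 + 54 * B * e\<^sup>2"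
        by (intro order_trans[OF norm_triangle_ineq] add_mono 1 2 3)
      also have "\<dots> \<le> (C / 3) * e\<^sup>2" by (simp add: C_def algebra_simps)
      finally show ?thesis .
    qed
    have h_le: "norm (\<zeta> w + of_real (e * \<kappa>) * w) \<le> C * e\<^sup>2" if "w \<in> ball 0 2" for w
      using edge_solution_bound[OF sol' N_le that] by simp
    obtain d where d: "\<And>k. \<bar>d k\<bar> \<le> C * e\<^sup>2 * (2 / 3) ^ k"
      and d_sums: "\<And>w. w \<in> ball 0 2 \<Longrightarrow>
        (\<lambda>k. of_real (d k) * w ^ k) sums (\<zeta> w + of_real (e * \<kappa>) * w)"
    proof (rule holomorphic_symmetric_coeffs)
      show "(\<lambda>w. \<zeta> w + of_real (e * \<kappa>) * w) holomorphic_on ball 0 2"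
        using sol' by (simp add: edge_solution_def)
      show "\<zeta> (cnj w) + of_real (e * \<kappa>) * cnj w = cnj (\<zeta> w + of_real (e * \<kappa>) * w)"
        if "w \<in> ball 0 2" for w using z_cnj[OF that] by simp
    qed (use h_le in auto)
    define z where "z k = d k - (if k = 1 then e * \<kappa> else 0)" for k
    have z_sums: "(\<lambda>k. of_real (z k) * w ^ k) sums \<zeta> w" if w: "w \<in> ball 0 2" for w
    proof -
      have "(\<lambda>k. if k = 1 then of_real (e * \<kappa>) * w ^ k else 0) sums (of_real (e * \<kappa>) * w ^ 1)"
        by (rule sums_single)
      from sums_diff[OF d_sums[OF w] this]
      have "(\<lambda>k. of_real (d k) * w ^ k - (if k = 1 then of_real (e * \<kappa>) * w ^ k else 0)) sums \<zeta> w"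
        by simp
      moreover have "of_real (d k) * w ^ k - (if k = 1 then of_real (e * \<kappa>) * w ^ k else 0) =
          of_real (z k) * w ^ k" for k
        by (simp add: z_def left_diff_distrib)
      ultimately show ?thesis by simp
    qed
    have eq: "let t = w * (1 + \<zeta> w) in
        inverse_kernel e \<kappa> Q t =
        (1 + \<zeta> w) * (of_real \<alpha> * w + of_real \<beta> * (w\<^sup>2 + 1))" if w: "w \<in> ball 0 2" for w
    proof -
      define a where "a = \<zeta> w"
      define t where "t = w * (1 + a)"
      note na = norm_one_plus_ge(2)[OF z_le'[OF w], folded a_def]
      have "(w\<^sup>2 - 1) * a = of_real \<alpha> * w + (of_real \<beta> - 1) * (w\<^sup>2 + 1) - N w"
        using sol w unfolding edge_solution_def N_def[symmetric] N1 a_def by (simp add: \<alpha>_def \<beta>_def)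
      then have "of_real \<alpha> * w + of_real \<beta> * (w\<^sup>2 + 1) = (w\<^sup>2 - 1) * a + (w\<^sup>2 + 1) + N w"
        by (simp add: algebra_simps)
      also have "N w = a\<^sup>2 / (1 + a) + w * f t"
        by (simp add: N_def edge_defect_def a_def t_def)
      finally have "(1 + a) * (of_real \<alpha> * w + of_real \<beta> * (w\<^sup>2 + 1)) =
          (1 + a) * ((w\<^sup>2 - 1) * a + (w\<^sup>2 + 1) + (a\<^sup>2 / (1 + a) + w * f t))"
        by (rule arg_cong)
      also have "\<dots> = (1 + a) * ((w\<^sup>2 - 1) * a + (w\<^sup>2 + 1)) + (1 + a) * (a\<^sup>2 / (1 + a)) +
          w * (1 + a) * f t"
        by (simp only: distrib_left mult_ac add_ac)
      finally have "(1 + a) * (of_real \<alpha> * w + of_real \<beta> * (w\<^sup>2 + 1)) =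
          (1 + a) * ((w\<^sup>2 - 1) * a + (w\<^sup>2 + 1)) + (1 + a) * (a\<^sup>2 / (1 + a)) + t * f t"
        by (simp only: t_def)
      also have "(1 + a) * (a\<^sup>2 / (1 + a)) = a\<^sup>2" using na by simp
      also have "(1 + a) * ((w\<^sup>2 - 1) * a + (w\<^sup>2 + 1)) + a\<^sup>2 + t * f t = 1 + t\<^sup>2 + t * f t"
        by (simp add: t_def algebra_simps power2_eq_square)
      also have "t * f t = of_real (e * \<kappa>) * t ^ 3 + of_real (e\<^sup>2) * t ^ 4 * Q (of_real e * t)"
        by (simp add: f_def algebra_simps power2_eq_square power3_eq_cube power4_eq_xxxx)
      finally show ?thesis by (simp add: Let_def a_def t_def add.assoc)
    qed
    show "\<exists>\<alpha> \<beta> z \<zeta>. uniformizes C e \<kappa> Q \<alpha> \<beta> z \<zeta>"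
      using z_sums eq d
      by (intro exI[of _ \<alpha>] exI[of _ \<beta>] exI[of _ z] exI[of _ \<zeta>]) (auto simp: z_def)
  qed
qed

section \<open>Laws on an interval given by their uniformization\<close>

lemma integral_cos_multiple:
  fixes m :: int
  shows "(LINT \<theta>|lborel. indicator {0..pi} \<theta> * cos (m * \<theta>)) = (if m = 0 then pi else 0)"
    and "integrable lborel (\<lambda>\<theta>. indicator {0..pi} \<theta> * cos (of_int m * \<theta>) :: real)"
proof -
  define F where "F \<theta> = (if m = 0 then \<theta> else sin (m * \<theta>) / m)" for \<theta> :: real
  have deriv: "(F has_real_derivative cos (m * \<theta>)) (at \<theta>)" for \<theta> :: real
    unfolding F_def by (cases "m = 0") (auto intro!: derivative_eq_intros)
  have cont: "isCont (\<lambda>\<theta>. cos (of_int m * \<theta>)) \<theta>" for \<theta> :: real by (intro continuous_intros)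
  have "(LINT \<theta>|lborel. cos (m * \<theta>) * indicator {0..pi} \<theta>) = F pi - F 0"
    by (rule integral_FTC_Icc_real[OF _ deriv cont]) simp
  also have "\<dots> = (if m = 0 then pi else 0)"
  proof -
    have "sin (of_int m * pi) = 0" by (auto simp: sin_zero_iff_int2)
    then show ?thesis by (simp add: F_def)
  qed
  finally show "(LINT \<theta>|lborel. indicator {0..pi} \<theta> * cos (m * \<theta>)) = (if m = 0 then pi else 0)"
    by (simp add: mult.commute)
  show "integrable lborel (\<lambda>\<theta>. indicator {0..pi} \<theta> * cos (of_int m * \<theta>) :: real)"
    using borel_integrable_atLeastAtMost[of 0 pi "\<lambda>\<theta>. cos (of_int m * \<theta>)"] cont
    by (simp add: mult.commute)
qed

lemma integral_sin_sin:
  fixes j k :: nat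
  assumes "k > 0"
  shows "(LINT \<theta>|lborel. indicator {0..pi} \<theta> * (sin (j * \<theta>) * sin (k * \<theta>))) =
    (if j = k then pi / 2 else 0)"
proof -
  have "indicator {0..pi} \<theta> * (sin (j * \<theta>) * sin (k * \<theta>)) =
      (indicator {0..pi} \<theta> * cos (of_int (int j - int k) * \<theta>) -
       indicator {0..pi} \<theta> * cos (of_int (int j + int k) * \<theta>)) / 2" for \<theta> :: real
    by (simp add: sin_times_sin algebra_simps)
  then have "(LINT \<theta>|lborel. indicator {0..pi} \<theta> * (sin (j * \<theta>) * sin (k * \<theta>))) =
      ((if int j - int k = 0 then pi else 0) - (if int j + int k = 0 then pi else 0)) / 2"
    by (simp only: integral_divide_zero Bochner_Integration.integral_diff[OF integral_cos_multiple(2) integral_cos_multiple(2)] integral_cos_multiple(1))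
  then show ?thesis using assms by auto
qed

lemma abs_sin_multiple_le: "\<bar>sin (real k * \<theta>)\<bar> \<le> real k * \<bar>sin \<theta>\<bar>"
proof (induction k)
  case (Suc k)
  have "\<bar>sin (real (Suc k) * \<theta>)\<bar> = \<bar>sin (real k * \<theta>) * cos \<theta> + cos (real k * \<theta>) * sin \<theta>\<bar>"
    by (simp add: distrib_right sin_add algebra_simps)
  also have "\<dots> \<le> \<bar>sin (real k * \<theta>)\<bar> * \<bar>cos \<theta>\<bar> + \<bar>cos (real k * \<theta>)\<bar> * \<bar>sin \<theta>\<bar>"
    by (metis abs_mult abs_triangle_ineq)
  also have "\<dots> \<le> (real k * \<bar>sin \<theta>\<bar>) * 1 + 1 * \<bar>sin \<theta>\<bar>"
    using Suc by (intro add_mono mult_mono) auto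
  finally show ?case by (simp add: algebra_simps)
qed simp

text \<open>Imaginary part of the geometric series in w cis \<theta>: up to a factor 2, the
  conjugate Poisson kernel.\<close>

lemma sums_power_sin:
  fixes w \<theta> :: real
  assumes "\<bar>w\<bar> < 1"
  shows "(\<lambda>k. w ^ k * sin (real k * \<theta>)) sums (w * sin \<theta> / (1 - 2 * w * cos \<theta> + w\<^sup>2))"
proof -
  define z where "z = of_real w * cis \<theta>"
  have z: "norm z < 1" using assms by (simp add: z_def norm_mult)
  have pow: "Im (z ^ k) = w ^ k * sin (real k * \<theta>)" for k
    by (simp add: z_def power_mult_distrib Complex.DeMoivre flip: of_real_power)
  have "(\<lambda>k. Im (z ^ k)) sums Im (1 / (1 - z))"
    by (rule sums_Im[OF geometric_sums[OF z]])
  moreover have "(Re (1 - z))\<^sup>2 + (Im (1 - z))\<^sup>2 = 1 - 2 * w * cos \<theta> + w\<^sup>2"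
    by (simp add: z_def power_mult_distrib power2_diff sin_squared_eq algebra_simps)
  then have "Im (1 / (1 - z)) = w * sin \<theta> / (1 - 2 * w * cos \<theta> + w\<^sup>2)"
    by (simp add: Im_divide) (simp add: z_def)
  ultimately show ?thesis unfolding pow by simp
qed

text \<open>
  The law of \<open>\<alpha> + 2 \<beta> cos \<theta>\<close> whose Cauchy transform at \<open>\<alpha> + \<beta> (w + 1 / w)\<close> is
  \<open>\<psi> w = (\<Sum>k. a k * w ^ k)\<close>; its density there is \<open>Im (\<psi> (cis \<theta>)) / \<pi>\<close>.
\<close>

locale joukowski_law =
  fixes \<alpha> \<beta> :: real and a :: "nat \<Rightarrow> real"
  assumes \<beta>_pos: "\<beta> > 0" and a_0: "a 0 = 0" and \<beta>_a_1: "\<beta> * a 1 = 1"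
    and summable_a: "summable (\<lambda>k. real k * \<bar>a k\<bar>)"
    and a_pos: "suminf (\<lambda>k. real (k + 2) * \<bar>a (k + 2)\<bar>) \<le> a 1"
begin

definition s :: "real \<Rightarrow> real" where
  "s \<theta> = suminf (\<lambda>k. a k * sin (real k * \<theta>))"

text \<open>\<open>s \<theta>\<close> is Im (\<psi> (cis \<theta>)), and the weight is the density
  \<open>s \<theta> / pi\<close> times the Jacobian 2 \<beta> sin \<theta>. On the angle all
  integrals become trigonometric.\<close>

definition weight :: "real \<Rightarrow> real" where
  "weight \<theta> = indicator {0..pi} \<theta> * (2 * \<beta> / pi * s \<theta> * sin \<theta>)"

definition angle_law :: "real measure" where
  "angle_law = density lborel (\<lambda>\<theta>. ennreal (weight \<theta>))"

definition position :: "real \<Rightarrow> real" where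
  "position \<theta> = \<alpha> + 2 * \<beta> * cos \<theta>"

definition law :: "real measure" where
  "law = distr angle_law borel position"

text \<open>The argument is clamped because \<open>arccos\<close> is unspecified outside \<open>[-1, 1]\<close>.\<close>

definition dens :: "real \<Rightarrow> real" where
  "dens x = indicator {\<alpha> - 2 * \<beta>..\<alpha> + 2 * \<beta>} x * (s (arccos (max (- 1) (min 1 ((x - \<alpha>) / (2 * \<beta>))))) / pi)"

text \<open>Sine coefficients extend oddly, so at k = 0 the index k - 1 calls for - a 1, whereas
  truncated subtraction gives a 0; hence the separate case.\<close>

definition \<tau> :: "nat \<Rightarrow> real" where
  "\<tau> k = (if k = 0 then 1 else \<beta> * (a (k + 1) - a (k - 1)) / 2)"

section \<open>Positivity, density and moments of the law\<close>

lemma summable_abs_a: "summable (\<lambda>k. \<bar>a k\<bar>)"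
proof (rule summable_comparison_test'[OF summable_a, of 1])
  fix k :: nat assume "k \<ge> 1"
  then have "1 * \<bar>a k\<bar> \<le> real k * \<bar>a k\<bar>" by (intro mult_right_mono) auto
  then show "norm \<bar>a k\<bar> \<le> real k * \<bar>a k\<bar>" by simp
qed

lemma summable_s: "summable (\<lambda>k. a k * sin (real k * \<theta>))"
  by (rule summable_comparison_test'[OF summable_abs_a, of 0])
    (simp add: abs_mult mult_left_le)

lemma s_measurable [measurable]: "s \<in> borel_measurable borel"
  unfolding s_def[abs_def] by measurable

lemma position_measurable [measurable]: "position \<in> borel_measurable borel"
  unfolding position_def[abs_def] by measurable

lemma weight_measurable [measurable]: "weight \<in> borel_measurable borel"
  unfolding weight_def[abs_def] by measurable

lemma dens_measurable [measurable]: "dens \<in> borel_measurable borel"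
proof -
  have "continuous_on UNIV (\<lambda>x. arccos (max (- 1) (min 1 ((x - \<alpha>) / (2 * \<beta>)))))"
    using \<beta>_pos by (intro continuous_intros) auto
  from borel_measurable_continuous_onI[OF this] show ?thesis
    unfolding dens_def[abs_def] by measurable
qed

lemma position_bounds: "position \<theta> \<in> {\<alpha> - 2 * \<beta>..\<alpha> + 2 * \<beta>}"
proof -
  have "0 \<le> 1 + cos \<theta>" using cos_ge_minus_one[of \<theta>] by linarith
  then have "0 \<le> 2 * \<beta> * (1 + cos \<theta>)" "0 \<le> 2 * \<beta> * (1 - cos \<theta>)"
    using \<beta>_pos by (auto intro!: mult_nonneg_nonneg)
  then show ?thesis by (simp add: position_def algebra_simps)
qed

text \<open>On [0, pi] the modulus of sin (k \<theta>) is at most k sin \<theta>, so by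
  \<open>a_pos\<close> the higher terms together are dominated by a 1 sin \<theta>. The factor sin
  \<theta> keeps this valid up to the endpoints, where the density vanishes.\<close>

lemma s_nonneg:
  assumes "\<theta> \<in> {0..pi}"
  shows "s \<theta> \<ge> 0"
proof -
  have sin: "sin \<theta> \<ge> 0" using assms by (intro sin_ge_zero) auto
  let ?f = "\<lambda>k. a k * sin (real k * \<theta>)"
  have shift: "summable (\<lambda>k. ?f (k + 2))"
    using summable_s by (subst summable_iff_shift)
  have shift': "summable (\<lambda>k. real (k + 2) * \<bar>a (k + 2)\<bar>)"
    using summable_a by (subst summable_iff_shift[of "\<lambda>k. real k * \<bar>a k\<bar>"])
  have "s \<theta> = suminf (\<lambda>k. ?f (k + 2)) + (\<Sum>k<2. ?f k)"
    unfolding s_def by (rule suminf_split_initial_segment[OF summable_s])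
  also have "(\<Sum>k<2. ?f k) = a 1 * sin \<theta>"
    by (simp add: numeral_2_eq_2 a_0)
  finally have s: "s \<theta> = suminf (\<lambda>k. ?f (k + 2)) + a 1 * sin \<theta>" .
  have "suminf (\<lambda>k. - ?f (k + 2)) \<le> suminf (\<lambda>k. real (k + 2) * \<bar>a (k + 2)\<bar> * sin \<theta>)"
  proof (rule suminf_le)
    fix k
    have "- ?f (k + 2) \<le> \<bar>a (k + 2)\<bar> * \<bar>sin (real (k + 2) * \<theta>)\<bar>"
      by (metis abs_ge_minus_self abs_mult)
    also have "\<dots> \<le> \<bar>a (k + 2)\<bar> * (real (k + 2) * \<bar>sin \<theta>\<bar>)"
      by (intro mult_left_mono abs_sin_multiple_le) auto
    finally show "- ?f (k + 2) \<le> real (k + 2) * \<bar>a (k + 2)\<bar> * sin \<theta>"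
      using sin by (simp add: mult_ac)
  qed (use shift shift' in \<open>auto intro: summable_minus summable_mult2\<close>)
  also have "\<dots> = suminf (\<lambda>k. real (k + 2) * \<bar>a (k + 2)\<bar>) * sin \<theta>"
    using shift' by (rule suminf_mult2 [symmetric])
  also have "\<dots> \<le> a 1 * sin \<theta>"
    using a_pos sin by (rule mult_right_mono)
  finally show ?thesis
    using suminf_minus[OF shift] unfolding s by simp
qed

lemma weight_nonneg: "weight \<theta> \<ge> 0"
proof (cases "\<theta> \<in> {0..pi}")
  case True
  then show ?thesis
    using s_nonneg \<beta>_pos sin_ge_zero[of \<theta>] by (auto simp: weight_def)
qed (simp add: weight_def)

lemma dens_nonneg: "dens x \<ge> 0"
proof (cases "x \<in> {\<alpha> - 2 * \<beta>..\<alpha> + 2 * \<beta>}")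
  case True
  have "arccos (max (- 1) (min 1 ((x - \<alpha>) / (2 * \<beta>)))) \<in> {0..pi}"
    using arccos_bounded[of "max (- 1) (min 1 ((x - \<alpha>) / (2 * \<beta>)))"] by auto
  then show ?thesis using s_nonneg by (simp add: dens_def)
qed (simp add: dens_def)

lemma nn_integral_angle_law:
  assumes [measurable]: "f \<in> borel_measurable borel"
  shows "(\<integral>\<^sup>+\<theta>. f \<theta> \<partial>angle_law) = (\<integral>\<^sup>+\<theta>. ennreal (weight \<theta>) * f \<theta> \<partial>lborel)"
  unfolding angle_law_def by (subst nn_integral_density) auto

lemma integral_angle_law:
  fixes f :: "real \<Rightarrow> real"
  assumes [measurable]: "f \<in> borel_measurable borel"
  shows "(LINT \<theta>|angle_law. f \<theta>) = (LINT \<theta>|lborel. weight \<theta> * f \<theta>)"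
  unfolding angle_law_def by (subst integral_real_density) (auto simp: weight_nonneg)

lemma law_eq_density: "law = density lborel (\<lambda>x. ennreal (dens x))"
proof (rule measure_eqI)
  show "sets law = sets (density lborel (\<lambda>x. ennreal (dens x)))" by (simp add: law_def)
  fix A assume "A \<in> sets law"
  then have [measurable]: "A \<in> sets borel" by (simp add: law_def)
  \<comment> \<open>The substitution rule asks for an increasing map, but \<open>position\<close>
    decreases on [0, pi]; hence the opposite sign here and the reflection of \<theta> to pi -
    \<theta> afterwards.\<close>
  define g where "g \<theta> = \<alpha> - 2 * \<beta> * cos \<theta>" for \<theta>
  let ?F = "\<lambda>x. ennreal (dens x) * indicator A x"
  have "emeasure (density lborel (\<lambda>x. ennreal (dens x))) A = (\<integral>\<^sup>+x. ?F x \<partial>lborel)"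
    by (subst emeasure_density) auto
  also have "\<dots> = (\<integral>\<^sup>+x. ?F x * indicator {g 0..g pi} x \<partial>lborel)"
    by (intro nn_integral_cong) (auto simp: dens_def g_def split: split_indicator)
  also have "\<dots> = (\<integral>\<^sup>+\<theta>. ?F (g \<theta>) * ennreal (2 * \<beta> * sin \<theta>) * indicator {0..pi} \<theta> \<partial>lborel)"
  proof (rule nn_integral_substitution_aux)
    show "(g has_real_derivative 2 * \<beta> * sin \<theta>) (at \<theta>)" for \<theta>
      unfolding g_def by (auto intro!: derivative_eq_intros)
    show "2 * \<beta> * sin \<theta> \<ge> 0" if "\<theta> \<in> {0..pi}" for \<theta>
      using that \<beta>_pos sin_ge_zero[of \<theta>] by auto
  qed (auto intro!: continuous_intros)
  also have "\<dots> = (\<integral>\<^sup>+\<theta>. ?F (g (pi - \<theta>)) * ennreal (2 * \<beta> * sin (pi - \<theta>)) * indicator {0..pi} (pi - \<theta>) \<partial>lborel)"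
    by (subst nn_integral_real_affine[where c = "- 1" and t = pi]) (auto simp: g_def)
  also have "\<dots> = (\<integral>\<^sup>+\<theta>. ennreal (weight \<theta>) * indicator A (position \<theta>) \<partial>lborel)"
  proof (intro nn_integral_cong)
    fix \<theta> :: real
    show "?F (g (pi - \<theta>)) * ennreal (2 * \<beta> * sin (pi - \<theta>)) * indicator {0..pi} (pi - \<theta>) =
        ennreal (weight \<theta>) * indicator A (position \<theta>)"
    proof (cases "\<theta> \<in> {0..pi}")
      case True
      have pos: "g (pi - \<theta>) = position \<theta>" by (simp add: g_def position_def)
      have "(position \<theta> - \<alpha>) / (2 * \<beta>) = cos \<theta>"
        using \<beta>_pos by (simp add: position_def)
      then have d: "dens (position \<theta>) = s \<theta> / pi"
        using True position_bounds[of \<theta>] by (simp add: dens_def arccos_cos)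
      have e: "ennreal (s \<theta> / pi) * ennreal (2 * \<beta> * sin \<theta>) = ennreal (weight \<theta>)"
        using True s_nonneg[OF True] \<beta>_pos sin_ge_zero[of \<theta>]
        by (subst ennreal_mult [symmetric]) (auto simp: weight_def mult_ac)
      have "?F (g (pi - \<theta>)) * ennreal (2 * \<beta> * sin (pi - \<theta>)) * indicator {0..pi} (pi - \<theta>) =
          (ennreal (s \<theta> / pi) * ennreal (2 * \<beta> * sin \<theta>)) * indicator A (position \<theta>)"
        using True unfolding pos d by (simp add: mult_ac)
      with e show ?thesis by simp
    qed (auto simp: weight_def)
  qed
  also have "\<dots> = (\<integral>\<^sup>+\<theta>. indicator A (position \<theta>) \<partial>angle_law)"
    by (subst nn_integral_angle_law) auto
  also have "\<dots> = (\<integral>\<^sup>+x. indicator A x \<partial>law)"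
    unfolding law_def by (subst nn_integral_distr) (auto simp: angle_law_def)
  also have "\<dots> = emeasure law A"
    using \<open>A \<in> sets law\<close> by simp
  finally show "emeasure law A = emeasure (density lborel (\<lambda>x. ennreal (dens x))) A" ..
qed

text \<open>Absolute summability of a allows termwise integration, and orthogonality of the sines
  leaves a single term.\<close>

lemma integral_s_sin:
  assumes "k > 0"
  shows "(LINT \<theta>|lborel. indicator {0..pi} \<theta> * (s \<theta> * sin (real k * \<theta>))) = pi / 2 * a k"
    and "integrable lborel (\<lambda>\<theta>. indicator {0..pi} \<theta> * (s \<theta> * sin (real k * \<theta>)))"
proof -
  let ?f = "\<lambda>j \<theta>. a j * (indicator {0..pi} \<theta> * (sin (real j * \<theta>) * sin (real k * \<theta>)))"
  have bound: "norm (?f j \<theta>) \<le> \<bar>a j\<bar> * indicator {0..pi} \<theta>" for j \<theta>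
  proof -
    have "\<bar>sin (real j * \<theta>)\<bar> * \<bar>sin (real k * \<theta>)\<bar> \<le> 1 * 1" by (intro mult_mono) auto
    then have "\<bar>a j\<bar> * (indicator {0..pi} \<theta> * (\<bar>sin (real j * \<theta>)\<bar> * \<bar>sin (real k * \<theta>)\<bar>)) \<le>
        \<bar>a j\<bar> * (indicator {0..pi} \<theta> * 1)" by (intro mult_left_mono) auto
    then show ?thesis by (simp add: abs_mult)
  qed
  have ind: "integrable lborel (\<lambda>\<theta>. \<bar>a j\<bar> * indicator {0..pi} \<theta>)" for j
    by (intro integrable_mult_right integrable_real_indicator) auto
  have int: "integrable lborel (?f j)" for j
    by (rule Bochner_Integration.integrable_bound[OF ind[of j]]) (use bound in auto)
  have AE: "AE \<theta> in lborel. summable (\<lambda>j. norm (?f j \<theta>))"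
  proof (rule AE_I2)
    fix \<theta>
    show "summable (\<lambda>j. norm (?f j \<theta>))"
      by (rule summable_comparison_test'[OF summable_mult2[OF summable_abs_a, of "indicator {0..pi} \<theta>"], of 0])
        (use bound in simp)
  qed
  have "(LINT \<theta>|lborel. norm (?f j \<theta>)) \<le> \<bar>a j\<bar> * pi" for j
  proof -
    have "(LINT \<theta>|lborel. norm (?f j \<theta>)) \<le> (LINT \<theta>|lborel. \<bar>a j\<bar> * indicator {0..pi} \<theta>)"
      by (intro integral_mono integrable_norm int ind bound)
    then show ?thesis by simp
  qed
  then have sm: "summable (\<lambda>j. LINT \<theta>|lborel. norm (?f j \<theta>))"
    by (intro summable_comparison_test'[OF summable_mult2[OF summable_abs_a, of pi], of 0]) auto
  have eq: "suminf (\<lambda>j. ?f j \<theta>) = indicator {0..pi} \<theta> * (s \<theta> * sin (real k * \<theta>))" for \<theta>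
  proof -
    have "(\<lambda>j. (a j * sin (real j * \<theta>)) * (indicator {0..pi} \<theta> * sin (real k * \<theta>))) sums
        (s \<theta> * (indicator {0..pi} \<theta> * sin (real k * \<theta>)))"
      unfolding s_def by (intro sums_mult2 summable_sums summable_s)
    then show ?thesis by (simp add: sums_iff mult_ac)
  qed
  have "(LINT \<theta>|lborel. suminf (\<lambda>j. ?f j \<theta>)) = suminf (\<lambda>j. integral\<^sup>L lborel (?f j))"
    by (rule integral_suminf[OF int AE sm])
  also have "(\<lambda>j. integral\<^sup>L lborel (?f j)) = (\<lambda>j. if j = k then pi / 2 * a j else 0)"
    using integral_sin_sin[OF assms] by (auto simp: fun_eq_iff)
  also have "suminf (\<lambda>j. if j = k then pi / 2 * a j else 0) = pi / 2 * a k"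
    using sums_single[of k "\<lambda>j. pi / 2 * a j"] by (simp add: sums_iff)
  finally show "(LINT \<theta>|lborel. indicator {0..pi} \<theta> * (s \<theta> * sin (real k * \<theta>))) = pi / 2 * a k"
    unfolding eq .
  show "integrable lborel (\<lambda>\<theta>. indicator {0..pi} \<theta> * (s \<theta> * sin (real k * \<theta>)))"
    using integrable_suminf[OF int AE sm] unfolding eq .
qed

lemma integral_weight_cos:
  "(LINT \<theta>|lborel. weight \<theta> * cos (real k * \<theta>)) = \<tau> k"
  "integrable lborel (\<lambda>\<theta>. weight \<theta> * cos (real k * \<theta>))"
proof -
  let ?S = "\<lambda>k \<theta>. indicator {0..pi} \<theta> * (s \<theta> * sin (real k * \<theta>))"
  have S: "integrable lborel (?S j)" "(LINT \<theta>|lborel. ?S j \<theta>) = pi / 2 * a j" for j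
    using integral_s_sin[of j] a_0 by (cases "j = 0"; simp)+
  have "(LINT \<theta>|lborel. weight \<theta> * cos (real k * \<theta>)) = \<tau> k \<and>
    integrable lborel (\<lambda>\<theta>. weight \<theta> * cos (real k * \<theta>))"
  proof (cases k)
    case 0
    have "weight \<theta> * cos (real k * \<theta>) = 2 * \<beta> / pi * ?S 1 \<theta>" for \<theta>
      by (simp add: 0 weight_def)
    then have "integrable lborel (\<lambda>\<theta>. weight \<theta> * cos (real k * \<theta>))"
      "(LINT \<theta>|lborel. weight \<theta> * cos (real k * \<theta>)) = 2 * \<beta> / pi * (pi / 2 * a 1)"
      by (simp_all only: integral_mult_right_zero S integrable_mult_right)
    then show ?thesis using \<beta>_a_1 0 by (simp add: \<tau>_def)
  next
    case (Suc l)
    have "weight \<theta> * cos (real k * \<theta>) = \<beta> / pi * (?S (k + 1) \<theta> - ?S l \<theta>)" for \<theta>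
    proof -
      have "sin \<theta> * cos (real k * \<theta>) = (sin (real (k + 1) * \<theta>) - sin (real l * \<theta>)) / 2"
        by (simp add: Suc sin_times_cos algebra_simps)
      then have "indicator {0..pi} \<theta> * (2 * \<beta> / pi * s \<theta> * (sin \<theta> * cos (real k * \<theta>))) =
          \<beta> / pi * (?S (k + 1) \<theta> - ?S l \<theta>)"
        by (simp only:) (simp add: field_simps)
      then show ?thesis by (simp add: weight_def mult_ac)
    qed
    then have "integrable lborel (\<lambda>\<theta>. weight \<theta> * cos (real k * \<theta>))"
      "(LINT \<theta>|lborel. weight \<theta> * cos (real k * \<theta>)) = \<beta> / pi * (pi / 2 * a (k + 1) - pi / 2 * a l)"
      by (simp_all only: integral_mult_right_zero Bochner_Integration.integral_diff[OF S(1) S(1)] S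
          integrable_mult_right Bochner_Integration.integrable_diff[OF S(1) S(1)])
    moreover have "\<beta> / pi * (pi / 2 * a (k + 1) - pi / 2 * a l) = \<tau> k"
      by (simp add: Suc \<tau>_def field_simps)
    ultimately show ?thesis by simp
  qed
  then show "(LINT \<theta>|lborel. weight \<theta> * cos (real k * \<theta>)) = \<tau> k"
    "integrable lborel (\<lambda>\<theta>. weight \<theta> * cos (real k * \<theta>))" by auto
qed

lemma prob_space_angle_law: "prob_space angle_law"
proof (rule prob_spaceI)
  have "emeasure angle_law (space angle_law) = (\<integral>\<^sup>+\<theta>. ennreal (weight \<theta>) \<partial>lborel)"
    by (simp add: angle_law_def emeasure_density)
  also have "\<dots> = ennreal (LINT \<theta>|lborel. weight \<theta>)"
    using integral_weight_cos(2)[of 0] by (intro nn_integral_eq_integral) (auto simp: weight_nonneg)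
  also have "\<dots> = 1" using integral_weight_cos(1)[of 0] by (simp add: \<tau>_def)
  finally show "emeasure angle_law (space angle_law) = 1" .
qed

sublocale angle: prob_space angle_law
  by (rule prob_space_angle_law)

lemma sets_angle_law [measurable_cong, simp]: "sets angle_law = sets borel"
  by (simp add: angle_law_def)

lemma space_angle_law [simp]: "space angle_law = UNIV"
  by (simp add: angle_law_def)

lemma real_distribution_law: "real_distribution law"
  unfolding law_def by (intro real_distribution.intro real_distribution_axioms.intro angle.prob_space_distr) auto

lemma AE_law: "AE x in law. x \<in> {\<alpha> - 2 * \<beta>..\<alpha> + 2 * \<beta>}"
  unfolding law_def using position_bounds by (subst AE_distr_iff) auto

lemma compactly_supported_law: "compactly_supported law"
  unfolding compactly_supported_def using AE_law by (intro exI[of _ "{\<alpha> - 2 * \<beta>..\<alpha> + 2 * \<beta>}"]) auto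

lemma integral_law:
  fixes f :: "real \<Rightarrow> real"
  assumes [measurable]: "f \<in> borel_measurable borel"
  shows "(LINT x|law. f x) = (LINT \<theta>|angle_law. f (position \<theta>))"
  unfolding law_def by (subst integral_distr) auto

lemma integral_angle_cos: "(LINT \<theta>|angle_law. cos (real k * \<theta>)) = \<tau> k"
  using integral_weight_cos(1) by (simp add: integral_angle_law)

lemma integrable_angle_cos: "integrable angle_law (\<lambda>\<theta>. cos (real k * \<theta>))"
  by (rule angle.integrable_const_bound[of _ 1]) auto

lemma moment_law_1: "moment law 1 = \<alpha> + 2 * \<beta> * \<tau> 1"
proof -
  have "moment law 1 = (LINT \<theta>|angle_law. \<alpha> + 2 * \<beta> * cos (real 1 * \<theta>))"
    unfolding moment_def by (subst integral_law) (simp_all add: position_def)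
  also have "\<dots> = \<alpha> + 2 * \<beta> * \<tau> 1"
    using integral_angle_cos[of 1] integrable_angle_cos[of 1] angle.prob_space by simp
  finally show ?thesis .
qed

lemma moment_law_2: "moment law 2 = \<alpha>\<^sup>2 + 4 * \<alpha> * \<beta> * \<tau> 1 + 2 * \<beta>\<^sup>2 * (1 + \<tau> 2)"
proof -
  have c2: "cos (real 2 * \<theta>) = 2 * (cos \<theta>)\<^sup>2 - 1" for \<theta>
    using cos_double_cos[of \<theta>] by simp
  have "(position \<theta>)\<^sup>2 = \<alpha>\<^sup>2 + 4 * \<alpha> * \<beta> * cos (real 1 * \<theta>) + 2 * \<beta>\<^sup>2 * (1 + cos (real 2 * \<theta>))" for \<theta>
    unfolding c2 by (simp add: position_def power2_eq_square algebra_simps)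
  then have "moment law 2 =
      (LINT \<theta>|angle_law. \<alpha>\<^sup>2 + 4 * \<alpha> * \<beta> * cos (real 1 * \<theta>) + 2 * \<beta>\<^sup>2 * (1 + cos (real 2 * \<theta>)))"
    unfolding moment_def by (subst integral_law) simp_all
  also have "\<dots> = \<alpha>\<^sup>2 + 4 * \<alpha> * \<beta> * \<tau> 1 + 2 * \<beta>\<^sup>2 * (1 + \<tau> 2)"
    using integral_angle_cos[of 1] integrable_angle_cos[of 1] integral_angle_cos[of 2]
      integrable_angle_cos[of 2] angle.prob_space by simp
  finally show ?thesis .
qed

text \<open>The integrand is 1 / (y - x) at y = \<alpha> + \<beta> (w + 1 / w). In the angle its
  denominator becomes \<beta> |1 - w cis \<theta>|^2, and the factor sin \<theta> of the weight
  produces the kernel of \<open>sums_power_sin\<close>, whose terms pick out the sine coefficients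
  of s.\<close>

lemma cauchy_transform_law:
  assumes w: "\<bar>w\<bar> < 1" "w \<noteq> 0"
  shows "(LINT x|law. w / (\<beta> * (1 + w\<^sup>2) + \<alpha> * w - x * w)) = suminf (\<lambda>k. a k * w ^ k)"
proof -
  let ?S = "\<lambda>k \<theta>. indicator {0..pi} \<theta> * (s \<theta> * sin (real k * \<theta>))"
  let ?f = "\<lambda>k \<theta>. 2 / pi * (w ^ k * ?S k \<theta>)"
  define A where "A = suminf (\<lambda>k. \<bar>a k\<bar>)"
  have S: "integrable lborel (?S j)" "(LINT \<theta>|lborel. ?S j \<theta>) = pi / 2 * a j" for j
    using integral_s_sin[of j] a_0 by (cases "j = 0"; simp)+
  have s_le: "\<bar>s \<theta>\<bar> \<le> A" for \<theta>
  proof -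
    have "\<bar>s \<theta>\<bar> \<le> suminf (\<lambda>k. \<bar>a k * sin (real k * \<theta>)\<bar>)"
      unfolding s_def
      by (rule summable_rabs, rule summable_comparison_test'[OF summable_abs_a, of 0])
        (simp add: abs_mult mult_left_le)
    also have "\<dots> \<le> A" unfolding A_def
      by (intro suminf_le summable_abs_a summable_comparison_test'[OF summable_abs_a, of 0])
        (auto simp: abs_mult mult_left_le)
    finally show ?thesis .
  qed
  have A0: "A \<ge> 0" using s_le[of 0] by linarith
  have bound: "norm (?f k \<theta>) \<le> A * \<bar>w\<bar> ^ k * indicator {0..pi} \<theta>" for k \<theta>
  proof -
    have "\<bar>s \<theta>\<bar> * \<bar>sin (real k * \<theta>)\<bar> \<le> A * 1" using s_le A0 by (intro mult_mono) auto
    then have b: "\<bar>w\<bar> ^ k * (indicator {0..pi} \<theta> * (\<bar>s \<theta>\<bar> * \<bar>sin (real k * \<theta>)\<bar>)) \<le>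
        \<bar>w\<bar> ^ k * (indicator {0..pi} \<theta> * (A * 1))" by (intro mult_left_mono) auto
    have c: "2 / pi \<le> 1" using pi_ge_two by simp
    have "2 / pi * (\<bar>w\<bar> ^ k * (indicator {0..pi} \<theta> * (\<bar>s \<theta>\<bar> * \<bar>sin (real k * \<theta>)\<bar>))) \<le>
        1 * (\<bar>w\<bar> ^ k * (indicator {0..pi} \<theta> * (A * 1)))"
      by (rule mult_mono[OF c b]) auto
    then show ?thesis by (simp add: abs_mult power_abs mult_ac)
  qed
  have ind: "integrable lborel (\<lambda>\<theta>. A * \<bar>w\<bar> ^ k * indicator {0..pi} \<theta>)" for k
    by (intro integrable_mult_right integrable_real_indicator) auto
  have int: "integrable lborel (?f k)" for k
    using S by (intro integrable_mult_right)
  have geo: "summable (\<lambda>k. A * \<bar>w\<bar> ^ k * c)" for c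
    using w by (intro summable_mult2 summable_mult summable_geometric) auto
  have AE: "AE \<theta> in lborel. summable (\<lambda>k. norm (?f k \<theta>))"
  proof (rule AE_I2)
    fix \<theta>
    show "summable (\<lambda>k. norm (?f k \<theta>))"
      by (rule summable_comparison_test'[OF geo[of "indicator {0..pi} \<theta>"], of 0]) (use bound in simp)
  qed
  have "(LINT \<theta>|lborel. norm (?f k \<theta>)) \<le> A * \<bar>w\<bar> ^ k * pi" for k
  proof -
    have "(LINT \<theta>|lborel. norm (?f k \<theta>)) \<le> (LINT \<theta>|lborel. A * \<bar>w\<bar> ^ k * indicator {0..pi} \<theta>)"
      by (intro integral_mono integrable_norm int ind bound)
    then show ?thesis by simp
  qed
  then have sm: "summable (\<lambda>k. LINT \<theta>|lborel. norm (?f k \<theta>))"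
    by (intro summable_comparison_test'[OF geo[of pi], of 0]) auto
  have pos: "1 - 2 * w * cos \<theta> + w\<^sup>2 > 0" for \<theta>
  proof -
    have "\<bar>2 * w * cos \<theta>\<bar> \<le> 2 * \<bar>w\<bar> * 1"
      unfolding abs_mult by (intro mult_mono) auto
    moreover have "0 < (1 - \<bar>w\<bar>)\<^sup>2" using w by simp
    then have "0 < 1 - 2 * \<bar>w\<bar> + w\<^sup>2" by (simp add: power2_eq_square algebra_simps)
    ultimately show ?thesis by linarith
  qed
  have eq: "suminf (\<lambda>k. ?f k \<theta>) = weight \<theta> * (w / (\<beta> * (1 + w\<^sup>2) + \<alpha> * w - position \<theta> * w))" for \<theta>
  proof -
    have "(\<lambda>k. (w ^ k * sin (real k * \<theta>)) * (2 / pi * (indicator {0..pi} \<theta> * s \<theta>))) sums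
        (w * sin \<theta> / (1 - 2 * w * cos \<theta> + w\<^sup>2) * (2 / pi * (indicator {0..pi} \<theta> * s \<theta>)))"
      by (intro sums_mult2 sums_power_sin w)
    then have "suminf (\<lambda>k. ?f k \<theta>) =
        w * sin \<theta> / (1 - 2 * w * cos \<theta> + w\<^sup>2) * (2 / pi * (indicator {0..pi} \<theta> * s \<theta>))"
      by (simp add: sums_iff mult_ac)
    also have "\<dots> = weight \<theta> * (w / (\<beta> * (1 - 2 * w * cos \<theta> + w\<^sup>2)))"
      using \<beta>_pos by (simp add: weight_def mult_ac)
    also have "\<beta> * (1 - 2 * w * cos \<theta> + w\<^sup>2) = \<beta> * (1 + w\<^sup>2) + \<alpha> * w - position \<theta> * w"
      by (simp add: position_def algebra_simps)
    finally show ?thesis .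
  qed
  have "(LINT \<theta>|lborel. suminf (\<lambda>k. ?f k \<theta>)) = suminf (\<lambda>k. integral\<^sup>L lborel (?f k))"
    by (rule integral_suminf[OF int AE sm])
  also have "(\<lambda>k. integral\<^sup>L lborel (?f k)) = (\<lambda>k. a k * w ^ k)"
  proof
    fix k
    show "integral\<^sup>L lborel (?f k) = a k * w ^ k"
      unfolding integral_mult_right_zero S(2) by simp
  qed
  finally show ?thesis
    unfolding eq by (subst integral_law) (simp_all add: integral_angle_law)
qed

end

section \<open>Logarithmic energy\<close>

text \<open>Off the diagonal, a null set, the extended kernel agrees with \<open>ln\<close>;
  integrability makes both parts finite, so the difference in \<open>ereal\<close> is an ordinary
  one.\<close>

lemma free_entropy_eq_integral:
  assumes AE: "AE z in \<nu> \<Otimes>\<^sub>M \<nu>. fst z \<noteq> snd z"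
    and int: "integrable (\<nu> \<Otimes>\<^sub>M \<nu>) (\<lambda>(x, y). ln \<bar>x - y\<bar>)"
  shows "free_entropy \<nu> = ereal ((LINT (x, y)|(\<nu> \<Otimes>\<^sub>M \<nu>). ln \<bar>x - y\<bar>) + 3 / 4 + ln (2 * pi) / 2)"
proof -
  let ?f = "\<lambda>z::real \<times> real. case z of (x, y) \<Rightarrow> ln \<bar>x - y\<bar>"
  have e2: "e2ennreal (ereal r) = ennreal r" for r by (simp add: ennreal.abs_eq)
  have "(\<integral>\<^sup>+ z. e2ennreal (log_dist z) \<partial>(\<nu> \<Otimes>\<^sub>M \<nu>)) = (\<integral>\<^sup>+ z. ennreal (?f z) \<partial>(\<nu> \<Otimes>\<^sub>M \<nu>))"
    by (rule nn_integral_cong_AE) (use AE in eventually_elim, auto simp: log_dist_def e2)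
  moreover have "(\<integral>\<^sup>+ z. e2ennreal (- log_dist z) \<partial>(\<nu> \<Otimes>\<^sub>M \<nu>)) = (\<integral>\<^sup>+ z. ennreal (- ?f z) \<partial>(\<nu> \<Otimes>\<^sub>M \<nu>))"
    by (rule nn_integral_cong_AE) (use AE in eventually_elim, auto simp: log_dist_def e2)
  moreover have fin: "(\<integral>\<^sup>+ z. ennreal (?f z) \<partial>(\<nu> \<Otimes>\<^sub>M \<nu>)) \<noteq> \<infinity>"
    "(\<integral>\<^sup>+ z. ennreal (- ?f z) \<partial>(\<nu> \<Otimes>\<^sub>M \<nu>)) \<noteq> \<infinity>"
    using int by (auto simp: real_integrable_def)
  moreover have enn: "enn2ereal A = ereal (enn2real A)" if "A \<noteq> \<infinity>" for A
    using that by (cases A) auto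
  ultimately have "free_entropy \<nu> =
      ereal (enn2real (\<integral>\<^sup>+ z. ennreal (?f z) \<partial>(\<nu> \<Otimes>\<^sub>M \<nu>))) -
      ereal (enn2real (\<integral>\<^sup>+ z. ennreal (- ?f z) \<partial>(\<nu> \<Otimes>\<^sub>M \<nu>))) +
      ereal (3 / 4 + ln (2 * pi) / 2)"
    by (simp only: free_entropy_def enn[OF fin(1)] enn[OF fin(2)])
  then show ?thesis
    using real_lebesgue_integral_def[OF int] by simp
qed

section \<open>The logarithmic kernel at radius r\<close>

text \<open>The kernel \<open>ln \<bar>1 - r * cis x\<bar>\<close>.\<close>

definition circle_log :: "real \<Rightarrow> real \<Rightarrow> real" where
  "circle_log r x = ln (1 - 2 * r * cos x + r\<^sup>2) / 2"

lemma circle_log_measurable [measurable]: "circle_log r \<in> borel_measurable borel"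
  unfolding circle_log_def[abs_def] by measurable

lemma circle_arg_eq: "1 - 2 * r * cos x + r\<^sup>2 = (cmod (1 - of_real r * cis x))\<^sup>2"
  by (simp add: cmod_power2 power_mult_distrib power2_diff sin_squared_eq algebra_simps)

lemma circle_arg_pos:
  fixes r x :: real
  assumes "0 \<le> r" "r < 1"
  shows "1 - 2 * r * cos x + r\<^sup>2 > 0"
proof -
  have "cmod (of_real r * cis x) < 1" using assms by (simp add: norm_mult)
  then have "1 - of_real r * cis x \<noteq> 0" by (metis eq_iff_diff_eq_0 less_irrefl norm_one)
  then show ?thesis unfolding circle_arg_eq by simp
qed

lemma circle_log_sums:
  assumes "0 \<le> r" "r < 1"
  shows "(\<lambda>k. r ^ k / real k * cos (real k * x)) sums (- circle_log r x)"
proof -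
  define z where "z = of_real r * cis x"
  have z: "cmod z < 1" using assms by (simp add: z_def norm_mult)
  then have ne: "1 - z \<noteq> 0" by (metis eq_iff_diff_eq_0 less_irrefl norm_one)
  have "(\<lambda>n. - ((- (- z)) ^ n) / of_nat n) sums ln (1 + - z)"
    using z by (intro Ln_series') simp
  then have "(\<lambda>n. Re (z ^ n / of_nat n)) sums Re (- ln (1 - z))"
    by (intro sums_Re) (use sums_minus in force)
  moreover have "(\<lambda>n. Re (z ^ n / of_nat n)) = (\<lambda>n. r ^ n / real n * cos (real n * x))"
    by (simp add: fun_eq_iff z_def power_mult_distrib Complex.DeMoivre Re_divide_of_nat flip: of_real_power)
  moreover have "Re (- ln (1 - z)) = - circle_log r x"
    unfolding circle_log_def circle_arg_eq z_def[symmetric] using ne by (simp add: ln_realpow)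
  ultimately show ?thesis by (simp only:)
qed

lemma circle_log_le:
  assumes "0 \<le> r" "r < 1"
  shows "circle_log r x \<le> ln 2"
proof -
  have "cmod (1 - of_real r * cis x) \<le> 1 + r"
    using norm_triangle_ineq4[of 1 "of_real r * cis x"] assms by (simp add: norm_mult)
  then have "(cmod (1 - of_real r * cis x))\<^sup>2 \<le> 2\<^sup>2" using assms by (intro power_mono) auto
  then have "ln (1 - 2 * r * cos x + r\<^sup>2) \<le> ln (2\<^sup>2)"
    using circle_arg_pos[OF assms, of x] unfolding circle_arg_eq by (intro ln_mono) auto
  also have "ln (2\<^sup>2) = 2 * ln (2::real)" by (subst ln_realpow) auto
  finally show ?thesis by (simp add: circle_log_def)
qed

lemma circle_log_ge:
  assumes r: "0 \<le> r" "r < 1" and x: "cos x \<noteq> 1"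
  shows "circle_log 1 x - ln 2 \<le> circle_log r x"
proof -
  have pos: "2 - 2 * cos x > 0" using x cos_le_one[of x] by linarith
  have "0 \<le> 1 + cos x" using cos_ge_minus_one[of x] by linarith
  \<comment> \<open>The difference 4 (1 - 2 r cos x + r^2) - (2 - 2 cos x) is affine in cos x, hence
    a combination of 1 - cos x and 1 + cos x; its coefficients, used here and in the next step, are
    nonnegative.\<close>
  then have "0 \<le> (1 + cos x) * (2 * (1 - r)\<^sup>2)" by (rule mult_nonneg_nonneg) simp
  moreover have "0 \<le> (1 - cos x) * (2 * r\<^sup>2 + 4 * r)"
    using r by (intro mult_nonneg_nonneg) auto
  ultimately have "0 \<le> (1 - cos x) * (2 * r\<^sup>2 + 4 * r) + (1 + cos x) * (2 * (1 - r)\<^sup>2)"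
    by (rule add_nonneg_nonneg[rotated])
  then have "2 - 2 * cos x \<le> 2\<^sup>2 * (1 - 2 * r * cos x + r\<^sup>2)"
    by (simp add: power2_eq_square algebra_simps)
  then have "ln (2 - 2 * cos x) \<le> ln (2\<^sup>2 * (1 - 2 * r * cos x + r\<^sup>2))"
    using pos by (intro ln_mono) auto
  also have "\<dots> = ln (2\<^sup>2) + ln (1 - 2 * r * cos x + r\<^sup>2)"
    using circle_arg_pos[OF r] by (intro ln_mult_pos) auto
  also have "ln (2\<^sup>2 :: real) = 2 * ln 2" by (subst ln_realpow) auto
  finally show ?thesis by (simp add: circle_log_def)
qed

lemma circle_log_tendsto:
  assumes x: "cos x \<noteq> 1" and r: "r \<longlonglongrightarrow> 1"
  shows "(\<lambda>n. circle_log (r n) x) \<longlonglongrightarrow> circle_log 1 x"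
proof -
  have "1 - 2 * 1 * cos x + 1\<^sup>2 \<noteq> 0" using x by simp
  then show ?thesis unfolding circle_log_def by (intro tendsto_intros r) auto
qed

text \<open>The product of |1 - cis (\<theta> - \<phi>)| and |1 - cis (\<theta> + \<phi>)| is |2 cos
  \<theta> - 2 cos \<phi>|. This splits the kernel of the energy into two circle kernels, which can
  be regularized by a radius r < 1.\<close>

lemma circle_log_1_add:
  assumes "cos \<theta> \<noteq> cos \<phi>"
  shows "circle_log 1 (\<theta> - \<phi>) + circle_log 1 (\<theta> + \<phi>) = ln \<bar>2 * cos \<theta> - 2 * cos \<phi>\<bar>"
    and "cos (\<theta> - \<phi>) \<noteq> 1" "cos (\<theta> + \<phi>) \<noteq> 1"
proof -
  have eq: "(2 - 2 * cos (\<theta> - \<phi>)) * (2 - 2 * cos (\<theta> + \<phi>)) = (2 * cos \<theta> - 2 * cos \<phi>)\<^sup>2"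
  proof -
    have "(2 - 2 * cos (\<theta> - \<phi>)) * (2 - 2 * cos (\<theta> + \<phi>)) =
        4 * ((1 - cos \<theta> * cos \<phi>)\<^sup>2 - (sin \<theta>)\<^sup>2 * (sin \<phi>)\<^sup>2)"
      by (simp add: cos_add cos_diff power2_eq_square algebra_simps)
    also have "\<dots> = (2 * cos \<theta> - 2 * cos \<phi>)\<^sup>2"
      unfolding sin_squared_eq by (simp add: power2_eq_square algebra_simps)
    finally show ?thesis .
  qed
  have "(2 * cos \<theta> - 2 * cos \<phi>)\<^sup>2 \<noteq> 0" using assms by simp
  then show ne: "cos (\<theta> - \<phi>) \<noteq> 1" "cos (\<theta> + \<phi>) \<noteq> 1" unfolding eq[symmetric] by auto
  then have "2 - 2 * cos (\<theta> - \<phi>) > 0" "2 - 2 * cos (\<theta> + \<phi>) > 0"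
    using cos_le_one[of "\<theta> - \<phi>"] cos_le_one[of "\<theta> + \<phi>"] by linarith+
  then have "ln (2 - 2 * cos (\<theta> - \<phi>)) + ln (2 - 2 * cos (\<theta> + \<phi>)) = ln ((2 * cos \<theta> - 2 * cos \<phi>)\<^sup>2)"
    unfolding eq[symmetric] by (subst ln_mult) auto
  also have "\<dots> = ln (\<bar>2 * cos \<theta> - 2 * cos \<phi>\<bar> ^ 2)" by simp
  also have "\<dots> = 2 * ln \<bar>2 * cos \<theta> - 2 * cos \<phi>\<bar>"
    using assms by (subst ln_realpow) auto
  finally show "circle_log 1 (\<theta> - \<phi>) + circle_log 1 (\<theta> + \<phi>) = ln \<bar>2 * cos \<theta> - 2 * cos \<phi>\<bar>"
    by (simp add: circle_log_def)
qed

section \<open>Energy of a uniformized law\<close>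

context joukowski_law
begin

sublocale pair: pair_prob_space angle_law angle_law ..

abbreviation angle_pair :: "(real \<times> real) measure" where
  "angle_pair \<equiv> angle_law \<Otimes>\<^sub>M angle_law"

text \<open>Since \<open>x / 0 = 0\<close>, the terms may be summed from \<open>k = 0\<close>.\<close>

abbreviation energy_term :: "nat \<Rightarrow> real" where
  "energy_term k \<equiv> 2 / real k * (\<tau> k)\<^sup>2"

abbreviation pair_log :: "real \<Rightarrow> real \<times> real \<Rightarrow> real" where
  "pair_log r z \<equiv> circle_log r (fst z - snd z) + circle_log r (fst z + snd z)"

lemma AE_pair_angle: "AE z in angle_pair. cos (fst z) \<noteq> cos (snd z)"
proof (rule pair.AE_pair_measure)
  show "{z \<in> space angle_pair. cos (fst z) \<noteq> cos (snd z)} \<in> sets angle_pair"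
    by measurable
  have range: "AE \<theta> in angle_law. \<theta> \<in> {0..pi}"
    unfolding angle_law_def by (subst AE_density) (auto simp: weight_def split: split_indicator)
  have "AE \<phi> in angle_law. \<phi> \<noteq> \<theta>" for \<theta>
    unfolding angle_law_def using AE_lborel_singleton[of \<theta>] by (subst AE_density) auto
  with range have AE_in: "AE \<phi> in angle_law. \<phi> \<noteq> \<theta> \<and> \<phi> \<in> {0..pi}" for \<theta>
    by (auto intro: AE_conjI)
  have inner: "AE \<phi> in angle_law. cos \<theta> \<noteq> cos \<phi>" if "\<theta> \<in> {0..pi}" for \<theta>
  proof -
    from AE_in[of \<theta>] show ?thesis
      by eventually_elim (use that cos_inj_pi[of \<theta>] in auto)
  qed
  show "AE \<theta> in angle_law. AE \<phi> in angle_law. cos (fst (\<theta>, \<phi>)) \<noteq> cos (snd (\<theta>, \<phi>))"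
    using range by eventually_elim (use inner in auto)
qed

lemma abs_tau_le: "\<bar>\<tau> k\<bar> \<le> 1"
proof -
  have "\<bar>\<tau> k\<bar> \<le> (LINT \<theta>|angle_law. \<bar>cos (real k * \<theta>)\<bar>)"
    unfolding integral_angle_cos [symmetric] by (rule integral_abs_bound)
  also have "\<dots> \<le> 1"
    by (rule angle.integral_le_const) (auto intro!: integrable_angle_cos integrable_abs)
  finally show ?thesis .
qed

text \<open>As |\<tau> k| is at most 1, its square is at most |\<tau> k|, which is summable like the
  coefficients a.\<close>

lemma summable_tau: "summable energy_term"
proof -
  have "summable (\<lambda>k. \<bar>a (k + 2)\<bar>)" using summable_abs_a by (subst summable_iff_shift)
  then have "summable (\<lambda>k. \<beta> * (\<bar>a (k + 2)\<bar> + \<bar>a k\<bar>))"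
    by (intro summable_mult summable_add summable_abs_a)
  then have "summable (\<lambda>k. energy_term (Suc k))"
  proof (rule summable_comparison_test'[of _ 0])
    fix k
    have "(\<tau> (Suc k))\<^sup>2 = \<bar>\<tau> (Suc k)\<bar> * \<bar>\<tau> (Suc k)\<bar>" by (simp add: power2_eq_square)
    also have "\<dots> \<le> 1 * \<bar>\<tau> (Suc k)\<bar>" by (intro mult_right_mono abs_tau_le) auto
    also have "\<bar>\<tau> (Suc k)\<bar> = \<beta> / 2 * \<bar>a (k + 2) - a k\<bar>"
      using \<beta>_pos by (simp add: \<tau>_def abs_mult)
    also have "1 * \<dots> \<le> \<beta> / 2 * (\<bar>a (k + 2)\<bar> + \<bar>a k\<bar>)"
      using \<beta>_pos by (auto intro!: mult_left_mono)
    finally have "(\<tau> (Suc k))\<^sup>2 \<le> \<beta> / 2 * (\<bar>a (k + 2)\<bar> + \<bar>a k\<bar>)" .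
    then have "energy_term (Suc k) \<le> 2 * (\<beta> / 2 * (\<bar>a (k + 2)\<bar> + \<bar>a k\<bar>))"
      by (intro mult_mono) (auto simp: field_simps)
    then show "norm (energy_term (Suc k)) \<le> \<beta> * (\<bar>a (k + 2)\<bar> + \<bar>a k\<bar>)"
      by simp
  qed
  then show ?thesis by (subst (asm) summable_Suc_iff)
qed

text \<open>For r < 1 the cosine series are dominated by a geometric one. The addition formula turns
  each pair of terms into a function of \<theta> times a function of \<phi>, so the product measure
  yields the square of \<tau> k.\<close>

lemma integral_circle_log:
  assumes r: "0 \<le> r" "r < 1"
  shows "(LINT z|angle_pair. pair_log r z) =
      - suminf (\<lambda>k. r ^ k * energy_term k)"
    and "integrable angle_pair (pair_log r)"
proof -
  let ?f = "\<lambda>k z. - (2 * r ^ k / real k) * (cos (real k * fst z) * cos (real k * snd z))"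
  have bound: "norm (?f k z) \<le> 2 * r ^ k" for k z
  proof -
    have "\<bar>cos (real k * fst z)\<bar> * \<bar>cos (real k * snd z)\<bar> \<le> 1 * 1" by (intro mult_mono) auto
    moreover have "2 * r ^ k / real k \<le> 2 * r ^ k"
    proof (cases "k = 0")
      case False
      then have "2 * r ^ k * 1 \<le> 2 * r ^ k * real k" using r by (intro mult_left_mono) auto
      then show ?thesis using False by (simp add: divide_le_eq)
    qed (use r in auto)
    ultimately have "2 * r ^ k / real k * (\<bar>cos (real k * fst z)\<bar> * \<bar>cos (real k * snd z)\<bar>) \<le> 2 * r ^ k * 1"
      using r by (intro mult_mono) auto
    then show ?thesis using r by (simp add: abs_mult)
  qed
  have geo: "summable (\<lambda>k. 2 * r ^ k)" using r by (intro summable_mult summable_geometric) auto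
  have prod_int: "integrable angle_pair (\<lambda>z. cos (real k * fst z) * cos (real k * snd z))" for k
    by (rule pair.P.integrable_const_bound[of _ 1])
      (auto simp: abs_mult intro!: mult_le_one)
  have int: "integrable angle_pair (?f k)" for k
    by (intro integrable_mult_right prod_int)
  have AE: "AE z in angle_pair. summable (\<lambda>k. norm (?f k z))"
    by (intro AE_I2 summable_comparison_test'[OF geo, of 0]) (use bound in simp)
  have "(LINT z|angle_pair. norm (?f k z)) \<le> 2 * r ^ k" for k
    by (rule pair.P.integral_le_const[OF integrable_norm[OF int] AE_I2[OF bound]])
  then have sm: "summable (\<lambda>k. LINT z|angle_pair. norm (?f k z))"
    by (intro summable_comparison_test'[OF geo, of 0]) auto
  have eq: "suminf (\<lambda>k. ?f k z) = pair_log r z" for z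
  proof -
    have "(\<lambda>k. - (r ^ k / real k * cos (real k * (fst z - snd z)) + r ^ k / real k * cos (real k * (fst z + snd z))))
        sums - (- circle_log r (fst z - snd z) + - circle_log r (fst z + snd z))"
      by (intro sums_minus sums_add circle_log_sums r)
    moreover have "- (r ^ k / real k * cos (real k * (fst z - snd z)) + r ^ k / real k * cos (real k * (fst z + snd z))) = ?f k z" for k
    proof -
      have c: "cos (real k * (fst z - snd z)) + cos (real k * (fst z + snd z)) =
          2 * (cos (real k * fst z) * cos (real k * snd z))"
        by (simp add: distrib_left right_diff_distrib cos_add cos_diff)
      show ?thesis unfolding distrib_left [symmetric] c by simp
    qed
    ultimately show ?thesis by (simp add: sums_iff)
  qed
  have prod: "(LINT z|angle_pair. cos (real k * fst z) * cos (real k * snd z)) = \<tau> k * \<tau> k" for k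
  proof -
    have "(LINT z|angle_pair. cos (real k * fst z) * cos (real k * snd z)) =
        (LINT x|angle_law. LINT y|angle_law. cos (real k * fst (x, y)) * cos (real k * snd (x, y)))"
      by (rule pair.integral_fst' [OF prod_int, symmetric])
    then show ?thesis by (simp add: integral_angle_cos)
  qed
  have "(LINT z|angle_pair. suminf (\<lambda>k. ?f k z)) = suminf (\<lambda>k. integral\<^sup>L angle_pair (?f k))"
    by (rule integral_suminf[OF int AE sm])
  also have "(\<lambda>k. integral\<^sup>L angle_pair (?f k)) = (\<lambda>k. - (r ^ k * energy_term k))"
  proof
    fix k
    show "integral\<^sup>L angle_pair (?f k) = - (r ^ k * energy_term k)"
      unfolding integral_mult_right_zero prod by (simp add: power2_eq_square)
  qed
  also have "suminf (\<lambda>k. - (r ^ k * energy_term k)) = - suminf (\<lambda>k. r ^ k * energy_term k)"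
  proof (rule suminf_minus, rule summable_comparison_test'[OF summable_tau, of 0])
    fix k
    have "r ^ k * energy_term k \<le> 1 * energy_term k"
      using r by (intro mult_right_mono power_le_one) auto
    then show "norm (r ^ k * energy_term k) \<le> energy_term k"
      using r by (simp add: abs_mult)
  qed
  finally show "(LINT z|angle_pair. pair_log r z) =
      - suminf (\<lambda>k. r ^ k * energy_term k)"
    unfolding eq .
  show "integrable angle_pair (pair_log r)"
    using integrable_suminf[OF int AE sm] unfolding eq .
qed

text \<open>
  For \<open>r \<rightarrow> 1\<close> Fatou's lemma gives the integrability of the singular kernel, and that kernel in turn
  dominates \<open>pair_log r\<close> because \<open>\<bar>1 - cis x\<bar> \<le> 2 * \<bar>1 - r * cis x\<bar>\<close>.
\<close>

lemma angle_energy: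
  shows "integrable angle_pair (\<lambda>z. ln \<bar>2 * cos (fst z) - 2 * cos (snd z)\<bar>)" (is ?int)
    and "(LINT z|angle_pair. ln \<bar>2 * cos (fst z) - 2 * cos (snd z)\<bar>) =
      - suminf energy_term"
proof -
  define r where "r n = 1 - 1 / real (Suc n)" for n
  have r: "0 \<le> r n" "r n < 1" for n by (auto simp: r_def field_simps)
  have r_lim: "r \<longlonglongrightarrow> 1"
    unfolding r_def[abs_def] using tendsto_diff[OF tendsto_const[of 1] LIMSEQ_inverse_real_of_nat]
    by (simp add: inverse_eq_divide)
  define K where "K z = ln \<bar>2 * cos (fst z) - 2 * cos (snd z)\<bar>" for z :: "real \<times> real"
  define Kr where "Kr n z = circle_log (r n) (fst z - snd z) + circle_log (r n) (fst z + snd z)" for n z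
  have [measurable]: "K \<in> borel_measurable angle_pair" "Kr n \<in> borel_measurable angle_pair" for n
    unfolding K_def[abs_def] Kr_def[abs_def] by measurable
  have Kr_le: "Kr n z \<le> 2 * ln 2" for n z
    unfolding Kr_def using circle_log_le[OF r, of n "fst z - snd z"] circle_log_le[OF r, of n "fst z + snd z"] by linarith
  have Kr_ge: "AE z in angle_pair. K z - 2 * ln 2 \<le> Kr n z" for n
    using AE_pair_angle
  proof eventually_elim
    case (elim z)
    note c = circle_log_1_add[OF elim]
    show ?case
      using circle_log_ge[OF r c(2), of n] circle_log_ge[OF r c(3), of n] c(1)
      unfolding K_def Kr_def by linarith
  qed
  have Kr_lim: "AE z in angle_pair. (\<lambda>n. Kr n z) \<longlonglongrightarrow> K z"
    using AE_pair_angle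
  proof eventually_elim
    case (elim z)
    note c = circle_log_1_add[OF elim]
    show ?case
      unfolding K_def Kr_def c(1) [symmetric]
      by (intro tendsto_add circle_log_tendsto r_lim c)
  qed
  define E where "E = suminf energy_term"
  define Er where "Er n = suminf (\<lambda>k. r n ^ k * energy_term k)" for n
  have term_le: "norm (r n ^ k * energy_term k) \<le> energy_term k" for n k
  proof -
    have "r n ^ k * energy_term k \<le> 1 * energy_term k"
      using r[of n] by (intro mult_right_mono power_le_one) auto
    then show ?thesis using r[of n] by (simp add: abs_mult)
  qed
  have Er_le: "Er n \<le> E" for n
    unfolding Er_def E_def
  proof (rule suminf_le[OF _ _ summable_tau])
    show "r n ^ k * energy_term k \<le> energy_term k" for k
      by (rule order_trans[OF abs_ge_self term_le[of n k, unfolded real_norm_def]])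
    show "summable (\<lambda>k. r n ^ k * energy_term k)"
      using term_le[of n] by (intro summable_comparison_test'[OF summable_tau, of 0]) auto
  qed
  \<comment> \<open>Abel summation: the terms are dominated by those at r = 1, which are
    summable.\<close>
  have Er_lim: "Er \<longlonglongrightarrow> E"
  proof -
    have "((\<lambda>n. suminf (\<lambda>k. r n ^ k * energy_term k)) \<longlongrightarrow> suminf energy_term) sequentially"
    proof (rule tannerys_theorem[THEN conjunct2, THEN conjunct2])
      show "(\<lambda>n. r n ^ k * energy_term k) \<longlonglongrightarrow> energy_term k" for k
        using tendsto_mult[OF tendsto_power[OF r_lim, of k] tendsto_const[of "energy_term k"]] by simp
      show "\<forall>\<^sub>F (k, n) in at_top \<times>\<^sub>F sequentially. norm (r n ^ k * energy_term k) \<le> energy_term k"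
        using term_le by (intro always_eventually) auto
    qed (use summable_tau in simp_all)
    then show ?thesis by (simp only: Er_def[abs_def] E_def)
  qed
  have Kr_int: "integrable angle_pair (Kr n)" "(LINT z|angle_pair. Kr n z) = - Er n" for n
    using integral_circle_log[OF r[of n]] by (auto simp: Kr_def[abs_def] Er_def)
  \<comment> \<open>Each \<open>circle_log\<close> is at most ln 2, so 2 ln 2 - Kr n is nonnegative
    with integral 2 ln 2 + Er n, bounded in n. This is the input to Fatou's lemma.\<close>
  have nn: "(\<integral>\<^sup>+z. ennreal (2 * ln 2 - Kr n z) \<partial>angle_pair) \<le> ennreal (2 * ln 2 + E)" for n
  proof -
    have "(\<integral>\<^sup>+z. ennreal (2 * ln 2 - Kr n z) \<partial>angle_pair) = ennreal (LINT z|angle_pair. 2 * ln 2 - Kr n z)"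
      using Kr_int(1) Kr_le[of n] by (intro nn_integral_eq_integral) (auto simp: algebra_simps)
    also have "(LINT z|angle_pair. 2 * ln 2 - Kr n z) = 2 * ln 2 + Er n"
      using Kr_int[of n] pair.P.prob_space by simp
    finally show ?thesis using Er_le[of n] by (auto intro: ennreal_leI)
  qed
  have "(\<integral>\<^sup>+z. ennreal (2 * ln 2 - K z) \<partial>angle_pair) = (\<integral>\<^sup>+z. liminf (\<lambda>n. ennreal (2 * ln 2 - Kr n z)) \<partial>angle_pair)"
  proof (rule nn_integral_cong_AE, use Kr_lim in eventually_elim)
    case (elim z)
    then have "(\<lambda>n. ennreal (2 * ln 2 - Kr n z)) \<longlonglongrightarrow> ennreal (2 * ln 2 - K z)"
      by (intro tendsto_ennrealI tendsto_intros)
    then show ?case by (intro lim_imp_Liminf [symmetric]) auto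
  qed
  also have "\<dots> \<le> liminf (\<lambda>n. \<integral>\<^sup>+z. ennreal (2 * ln 2 - Kr n z) \<partial>angle_pair)"
    by (rule nn_integral_liminf) measurable
  also have "\<dots> \<le> liminf (\<lambda>n. ennreal (2 * ln 2 + E))"
    using nn by (intro Liminf_mono) auto
  also have "\<dots> < \<infinity>" by (simp add: Liminf_const)
  finally have fin: "(\<integral>\<^sup>+z. ennreal (2 * ln 2 - K z) \<partial>angle_pair) < \<infinity>" .
  have nonneg: "AE z in angle_pair. 0 \<le> 2 * ln 2 - K z"
    using Kr_lim
  proof eventually_elim
    case (elim z)
    have "K z \<le> 2 * ln 2"
      by (rule tendsto_upperbound[OF elim]) (use Kr_le in auto)
    then show ?case by simp
  qed
  have int0: "integrable angle_pair (\<lambda>z. 2 * ln 2 - K z)"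
    using fin nonneg by (intro integrableI_nonneg) auto
  have "integrable angle_pair (\<lambda>z. 2 * ln 2 - (2 * ln 2 - K z))"
    by (rule Bochner_Integration.integrable_diff[OF _ int0]) simp
  then have K_int: "integrable angle_pair K" by simp
  then show ?int by (simp add: K_def[abs_def])
  have "(\<lambda>n. LINT z|angle_pair. Kr n z) \<longlonglongrightarrow> (LINT z|angle_pair. K z)"
  proof (rule integral_dominated_convergence[where w = "\<lambda>z. \<bar>K z\<bar> + 2 * ln 2"])
    show "integrable angle_pair (\<lambda>z. \<bar>K z\<bar> + 2 * ln 2)" using K_int by auto
    show "AE z in angle_pair. norm (Kr n z) \<le> \<bar>K z\<bar> + 2 * ln 2" for n
      using Kr_ge[of n]
    proof eventually_elim
      case (elim z)
      have "0 \<le> ln (2::real)" by simp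
      with elim Kr_le[of n z] show ?case unfolding real_norm_def by linarith
    qed
  qed (use Kr_lim in auto)
  moreover have "(\<lambda>n. LINT z|angle_pair. Kr n z) \<longlonglongrightarrow> - E"
    unfolding Kr_int(2) by (intro tendsto_minus Er_lim)
  ultimately show "(LINT z|angle_pair. ln \<bar>2 * cos (fst z) - 2 * cos (snd z)\<bar>) = - suminf energy_term"
    using LIMSEQ_unique by (fastforce simp: K_def E_def)
qed

text \<open>A difference of positions is \<beta> times a difference of values of 2 cos, which adds
  ln \<beta> to the energy on the angles; \<open>law_eq_density\<close> then moves the integral to
  Lebesgue measure.\<close>

theorem log_energy_law:
  defines "E \<equiv> ln \<beta> - suminf energy_term"
  shows "free_entropy law = ereal (E + 3 / 4 + ln (2 * pi) / 2)"
    and "integrable (lborel \<Otimes>\<^sub>M lborel) (\<lambda>(x, y). ln \<bar>x - y\<bar> * dens x * dens y)"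
    and "(LINT (x, y)|(lborel \<Otimes>\<^sub>M lborel). ln \<bar>x - y\<bar> * dens x * dens y) = E"
proof -
  interpret law: real_distribution law by (rule real_distribution_law)
  let ?h = "\<lambda>(\<theta>, \<phi>). (position \<theta>, position \<phi>)"
  have pair_law: "law \<Otimes>\<^sub>M law = distr angle_pair (borel \<Otimes>\<^sub>M borel) ?h"
    unfolding law_def
    by (rule pair_measure_distr) (auto simp: law.sigma_finite_measure_axioms simp flip: law_def)
  have pos_diff: "position \<theta> - position \<phi> = \<beta> * (2 * cos \<theta> - 2 * cos \<phi>)" for \<theta> \<phi>
    by (simp add: position_def algebra_simps)
  have AE: "AE z in law \<Otimes>\<^sub>M law. fst z \<noteq> snd z"
    unfolding pair_law
  proof (subst AE_distr_iff)
    show "AE z in angle_pair. fst (?h z) \<noteq> snd (?h z)"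
      using AE_pair_angle by eventually_elim (use \<beta>_pos in \<open>auto simp: position_def split: prod.splits\<close>)
  qed measurable
  have AE_eq: "AE z in angle_pair. (case ?h z of (x, y) \<Rightarrow> ln \<bar>x - y\<bar>) = ln \<beta> + ln \<bar>2 * cos (fst z) - 2 * cos (snd z)\<bar>"
    using AE_pair_angle
  proof eventually_elim
    case (elim z)
    then show ?case
      using \<beta>_pos by (cases z) (simp add: pos_diff abs_mult ln_mult)
  qed
  have int_rhs: "integrable angle_pair (\<lambda>z. ln \<beta> + ln \<bar>2 * cos (fst z) - 2 * cos (snd z)\<bar>)"
    using angle_energy(1) by simp
  have "integrable angle_pair (\<lambda>z. case ?h z of (x, y) \<Rightarrow> ln \<bar>x - y\<bar>)"
    by (rule integrable_cong_AE_imp[OF int_rhs]) (use AE_eq in \<open>auto elim: eventually_mono\<close>)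
  then have int: "integrable (law \<Otimes>\<^sub>M law) (\<lambda>(x, y). ln \<bar>x - y\<bar>)"
    unfolding pair_law by (subst integrable_distr_eq) auto
  have "(LINT (x, y)|(law \<Otimes>\<^sub>M law). ln \<bar>x - y\<bar>) = (LINT z|angle_pair. (case ?h z of (x, y) \<Rightarrow> ln \<bar>x - y\<bar>))"
    unfolding pair_law by (subst integral_distr) auto
  also have "\<dots> = (LINT z|angle_pair. ln \<beta> + ln \<bar>2 * cos (fst z) - 2 * cos (snd z)\<bar>)"
    by (rule integral_cong_AE) (use AE_eq in auto)
  also have "\<dots> = E"
    using angle_energy pair.P.prob_space by (simp add: E_def)
  finally have val: "(LINT (x, y)|(law \<Otimes>\<^sub>M law). ln \<bar>x - y\<bar>) = E" .
  show "free_entropy law = ereal (E + 3 / 4 + ln (2 * pi) / 2)"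
    using free_entropy_eq_integral[OF AE int] unfolding val .
  have dens_law: "law \<Otimes>\<^sub>M law = density (lborel \<Otimes>\<^sub>M lborel) (\<lambda>z. ennreal (dens (fst z) * dens (snd z)))"
  proof -
    have "law \<Otimes>\<^sub>M law = density (lborel \<Otimes>\<^sub>M lborel) (\<lambda>(x, y). ennreal (dens x) * ennreal (dens y))"
      unfolding law_eq_density
      by (rule pair_measure_density)
        (auto simp: lborel.sigma_finite_measure_axioms law.sigma_finite_measure_axioms simp flip: law_eq_density)
    then show ?thesis by (simp add: ennreal_mult dens_nonneg split_beta')
  qed
  have comm: "dens (fst z) * dens (snd z) * (case z of (x, y) \<Rightarrow> ln \<bar>x - y\<bar>) =
      (case z of (x, y) \<Rightarrow> ln \<bar>x - y\<bar> * dens x * dens y)" for z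
    by (cases z) simp
  show "integrable (lborel \<Otimes>\<^sub>M lborel) (\<lambda>(x, y). ln \<bar>x - y\<bar> * dens x * dens y)"
    using int unfolding dens_law by (subst (asm) integrable_real_density) (auto simp: dens_nonneg comm)
  show "(LINT (x, y)|(lborel \<Otimes>\<^sub>M lborel). ln \<bar>x - y\<bar> * dens x * dens y) = E"
    using val unfolding dens_law by (subst (asm) integral_real_density) (auto simp: dens_nonneg comm)
qed

end

section \<open>Identification of laws by their moments\<close>

text \<open>The Taylor polynomials of the characteristic function depend on the moments only.
  Compact support bounds the n-th absolute moment by L^n, so they converge at every t.\<close>

lemma real_distribution_eqI_moments:
  assumes \<nu>: "real_distribution \<nu>" "compactly_supported \<nu>"
    and \<nu>': "real_distribution \<nu>'" "compactly_supported \<nu>'"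
    and eq: "\<And>k. moment \<nu> k = moment \<nu>' k"
  shows "\<nu> = \<nu>'"
proof (rule Levy_uniqueness[OF \<nu>(1) \<nu>'(1)], rule ext)
  fix t :: real
  define p where "p n = (\<Sum>k\<le>n. ((\<i> * t) ^ k / fact k) * moment \<nu> k)" for n
  have *: "(\<lambda>n. p n) \<longlonglongrightarrow> char N t"
    if N: "real_distribution N" "compactly_supported N" and eqN: "\<And>k. moment \<nu> k = moment N k" for N
  proof -
    interpret real_distribution N by fact
    obtain L where L: "L > 0" "AE x in N. \<bar>x\<bar> \<le> L" "\<And>k. integrable N (\<lambda>x. x ^ k)"
      using compactly_supported_moments[OF N] by metis
    have bd: "cmod (p n - char N t) \<le> 2 * ((\<bar>t\<bar> * L) ^ n / fact n)" for n
    proof -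
      have pN: "p n = (\<Sum>k\<le>n. ((\<i> * t) ^ k / fact k) * expectation (\<lambda>x. x ^ k))"
        by (simp only: p_def eqN) (simp only: moment_def)
      have "cmod (char N t - p n) \<le> (2 * \<bar>t\<bar> ^ n / fact n) * expectation (\<lambda>x. \<bar>x\<bar> ^ n)"
        using char_approx1[of n t, OF L(3)] unfolding pN .
      also have "expectation (\<lambda>x. \<bar>x\<bar> ^ n) \<le> L ^ n"
      proof (rule integral_le_const)
        show "integrable N (\<lambda>x. \<bar>x\<bar> ^ n)"
          using integrable_abs[OF L(3)[of n]] by (simp add: power_abs)
        show "AE x in N. \<bar>x\<bar> ^ n \<le> L ^ n"
          using L(2) by eventually_elim (auto intro: power_mono)
      qed
      finally show ?thesis
        by (simp add: norm_minus_commute power_mult_distrib mult_left_mono divide_right_mono)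
    qed
    have "(\<lambda>n. 2 * ((\<bar>t\<bar> * L) ^ n / fact n)) \<longlonglongrightarrow> 2 * 0"
    proof (intro tendsto_mult_left)
      have "summable (\<lambda>n. (\<bar>t\<bar> * L) ^ n / fact n)"
        using summable_exp[of "\<bar>t\<bar> * L"] by (simp add: field_simps)
      then show "(\<lambda>n. (\<bar>t\<bar> * L) ^ n / fact n) \<longlonglongrightarrow> 0" by (rule summable_LIMSEQ_zero)
    qed
    then have "(\<lambda>n. 2 * ((\<bar>t\<bar> * L) ^ n / fact n)) \<longlonglongrightarrow> 0"
      by (simp only: mult_zero_right)
    then have "(\<lambda>n. p n - char N t) \<longlonglongrightarrow> 0"
      by (rule Lim_null_comparison[OF always_eventually[OF allI[OF bd]]])
    then show ?thesis by (rule LIM_zero_cancel)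
  qed
  from *[OF \<nu>] *[OF \<nu>' eq] show "char \<nu> t = char \<nu>' t" using LIMSEQ_unique by blast
qed

section \<open>Comparison of Cauchy transforms near infinity\<close>

text \<open>Identity theorem along real points u w that tend to 0 without reaching it: the zeros of
  F - G accumulate at 0.\<close>

lemma has_fps_expansion_eqI:
  fixes F G :: "complex \<Rightarrow> complex" and u :: "real \<Rightarrow> complex"
  assumes F: "F has_fps_expansion f" and G: "G has_fps_expansion g"
    and u: "(u \<longlongrightarrow> 0) (at 0)" "eventually (\<lambda>w. u w \<noteq> 0 \<and> F (u w) = G (u w)) (at 0)"
  shows "f = g"
proof -
  have "(\<lambda>z. F z - G z) has_fps_expansion f - g"
    using F G by (intro fps_expansion_intros)
  from has_fps_expansion_imp_holomorphic[OF this] obtain s where s: "open s" "0 \<in> s"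
    "(\<lambda>z. F z - G z) holomorphic_on s" by metis
  obtain R where R: "R > 0" "ball 0 R \<subseteq> s" using s open_contains_ball by metis
  have hol: "(\<lambda>z. F z - G z) holomorphic_on ball 0 R"
    using s(3) R(2) by (rule holomorphic_on_subset)
  define U where "U = {z \<in> ball 0 R. F z - G z = 0}"
  have lim: "0 islimpt U"
    unfolding islimpt_approachable
  proof (intro allI impI)
    fix e :: real assume e: "e > 0"
    have "eventually (\<lambda>w. dist (u w) 0 < min e R) (at 0)"
      using u(1) e R(1) by (intro tendstoD) auto
    with u(2) have "eventually (\<lambda>w. u w \<in> U \<and> u w \<noteq> 0 \<and> dist (u w) 0 < e) (at 0)"
      by eventually_elim (auto simp: U_def)
    then show "\<exists>x'\<in>U. x' \<noteq> 0 \<and> dist x' 0 < e"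
      using eventually_happens[of _ "at (0::real)"] by auto
  qed
  have zero: "F z - G z = 0" if "z \<in> ball 0 R" for z
    by (rule analytic_continuation[OF hol open_ball _ _ _ lim _ that]) (use R in \<open>auto simp: U_def\<close>)
  have "eventually (\<lambda>z::complex. z \<in> ball 0 R) (nhds 0)"
    using R by (intro eventually_nhds_in_open) auto
  then have "eventually (\<lambda>z. G z = F z) (nhds 0)"
    by eventually_elim (use zero in auto)
  then have "G has_fps_expansion f"
    using F by (subst has_fps_expansion_cong[OF _ refl]) (auto elim: eventually_mono)
  then show ?thesis using fps_expansion_unique_complex G by blast
qed

lemma moment_gf_of_real:
  assumes \<nu>: "real_distribution \<nu>" "compactly_supported \<nu>"
    and L: "AE x in \<nu>. \<bar>x\<bar> \<le> L" "L \<ge> 0" and s: "\<bar>s\<bar> * L < 1"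
  shows "moment_gf \<nu> (of_real s) = of_real (LINT x|\<nu>. 1 / (1 - s * x))"
proof -
  interpret real_distribution \<nu> by fact
  have int_pow: "integrable \<nu> (\<lambda>x. x ^ k)" for k
    using compactly_supported_moments[OF \<nu>] by metis
  let ?f = "\<lambda>k x. s ^ k * x ^ k"
  have int: "integrable \<nu> (?f k)" for k
    by (intro integrable_mult_right int_pow)
  have bound: "norm (?f k x) \<le> (\<bar>s\<bar> * L) ^ k" if "\<bar>x\<bar> \<le> L" for k x
    using that by (simp add: abs_mult power_abs power_mult_distrib power_mono mult_left_mono)
  have geo: "summable (\<lambda>k. (\<bar>s\<bar> * L) ^ k)" using s L(2) by (intro summable_geometric) simp
  have AE: "AE x in \<nu>. summable (\<lambda>k. norm (?f k x))"
    using L(1) by eventually_elim (intro summable_comparison_test'[OF geo, of 0], use bound in simp)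
  have "(LINT x|\<nu>. norm (?f k x)) \<le> (\<bar>s\<bar> * L) ^ k" for k
  proof -
    have "AE x in \<nu>. norm (?f k x) \<le> (\<bar>s\<bar> * L) ^ k"
      using L(1) by eventually_elim (rule bound)
    then show ?thesis by (rule integral_le_const[OF integrable_norm[OF int]])
  qed
  then have sm: "summable (\<lambda>k. LINT x|\<nu>. norm (?f k x))"
    by (intro summable_comparison_test'[OF geo, of 0]) auto
  have m: "integral\<^sup>L \<nu> (?f k) = moment \<nu> k * s ^ k" for k
    by (simp add: moment_def)
  have "AE x in \<nu>. 1 / (1 - s * x) = suminf (\<lambda>k. ?f k x)"
    using L(1)
  proof eventually_elim
    case (elim x)
    have "\<bar>s\<bar> * \<bar>x\<bar> \<le> \<bar>s\<bar> * L" using elim by (intro mult_left_mono) auto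
    then have "norm (s * x) < 1" using s by (simp add: abs_mult)
    from geometric_sums[OF this] show ?case
      by (simp add: sums_iff power_mult_distrib)
  qed
  then have "(LINT x|\<nu>. 1 / (1 - s * x)) = (LINT x|\<nu>. suminf (\<lambda>k. ?f k x))"
    by (intro integral_cong_AE) auto
  also have "\<dots> = suminf (\<lambda>k. moment \<nu> k * s ^ k)"
    unfolding m [symmetric] by (rule integral_suminf[OF int AE sm])
  finally have "(LINT x|\<nu>. 1 / (1 - s * x)) = suminf (\<lambda>k. moment \<nu> k * s ^ k)" .
  moreover have "summable (\<lambda>k. moment \<nu> k * s ^ k)"
  proof (rule summable_comparison_test'[OF sm, of 0])
    show "norm (moment \<nu> k * s ^ k) \<le> (LINT x|\<nu>. norm (?f k x))" for k
      unfolding m [symmetric] by (rule integral_norm_bound)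
  qed
  ultimately show ?thesis
    by (simp add: moment_gf_def eval_fps_def suminf_of_real)
qed

text \<open>At s = 1 / (\<alpha> + \<beta> (w + 1 / w)) both moment series satisfy s M(s) = \<psi>
  w, for the constructed law by \<open>cauchy_transform_law\<close>. These s are nonzero and tend to
  0 with w, so the series agree, and with them all moments.\<close>

lemma (in joukowski_law) law_unique:
  assumes \<nu>: "real_distribution \<nu>" "compactly_supported \<nu>"
    and ev: "eventually (\<lambda>w::real. let s = w / (\<beta> * (1 + w\<^sup>2) + \<alpha> * w) in
      of_real s * moment_gf \<nu> (of_real s) = of_real (suminf (\<lambda>k. a k * w ^ k))) (at 0)"
  shows "\<nu> = law"
proof (rule real_distribution_eqI_moments[OF \<nu> real_distribution_law compactly_supported_law])
  fix k
  define d where "d w = \<beta> * (1 + w\<^sup>2) + \<alpha> * w" for w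
  define s' where "s' w = w / d w" for w
  define L where "L = \<bar>\<alpha>\<bar> + 2 * \<beta>"
  have d_lim: "(d \<longlongrightarrow> \<beta>) (at 0)"
  proof -
    have "(d \<longlongrightarrow> \<beta> * (1 + 0\<^sup>2) + \<alpha> * 0) (at 0)"
      unfolding d_def[abs_def] by (intro tendsto_intros)
    then show ?thesis by simp
  qed
  have s_lim: "(s' \<longlongrightarrow> 0) (at 0)"
    unfolding s'_def[abs_def] using tendsto_divide[OF tendsto_ident_at d_lim] \<beta>_pos by simp
  have "AE x in law. \<bar>x\<bar> \<le> L"
    using AE_law by eventually_elim (auto simp: L_def)
  note gf = moment_gf_of_real[OF real_distribution_law compactly_supported_law this]
  have L0: "L > 0" using \<beta>_pos by (simp add: L_def add_nonneg_pos)
  have ev_d: "eventually (\<lambda>w. d w > 0) (at 0)"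
    using d_lim \<beta>_pos by (rule order_tendstoD)
  have ev_s: "eventually (\<lambda>w. \<bar>s' w\<bar> < 1 / L) (at 0)"
    using order_tendstoD(2)[OF tendsto_rabs_zero[OF s_lim], of "1 / L"] L0 by simp
  have ev_1: "eventually (\<lambda>w::real. \<bar>w\<bar> < 1) (at 0)"
    using order_tendstoD(2)[OF tendsto_rabs_zero[OF tendsto_ident_at], of 1] by simp
  have ev_ne: "eventually (\<lambda>w::real. w \<noteq> 0) (at 0)"
    by (simp add: eventually_at_filter)
  have "eventually (\<lambda>w. complex_of_real (s' w) \<noteq> 0 \<and>
      moment_gf \<nu> (of_real (s' w)) = moment_gf law (of_real (s' w))) (at 0)"
    using ev ev_d ev_s ev_1 ev_ne
  proof eventually_elim
    case (elim w)
    have s0: "s' w \<noteq> 0" using elim by (simp add: s'_def)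
    have "\<bar>s' w\<bar> * L < 1" using elim(3) L0 by (simp add: field_simps)
    then have "moment_gf law (of_real (s' w)) = of_real (LINT x|law. 1 / (1 - s' w * x))"
      using L0 by (intro gf) auto
    moreover have "s' w * (LINT x|law. 1 / (1 - s' w * x)) = (LINT x|law. w / (d w - x * w))"
    proof -
      have "s' w * (1 / (1 - s' w * x)) = w / (d w - x * w)" for x
      proof -
        have "1 - s' w * x = (d w - x * w) / d w" using elim(2) by (simp add: s'_def field_simps)
        then show ?thesis using elim(2) by (simp add: s'_def)
      qed
      then show ?thesis by (subst integral_mult_right_zero [symmetric]) simp
    qed
    moreover have "(LINT x|law. w / (d w - x * w)) = suminf (\<lambda>k. a k * w ^ k)"
      using cauchy_transform_law[of w] elim by (simp add: d_def)
    ultimately have "of_real (s' w) * moment_gf law (of_real (s' w)) = complex_of_real (suminf (\<lambda>k. a k * w ^ k))"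
      by (metis of_real_mult)
    also have "\<dots> = of_real (s' w) * moment_gf \<nu> (of_real (s' w))"
      using elim(1) by (simp add: Let_def s'_def d_def)
    finally show ?case using s0 by simp
  qed
  then have "fps_of_real (moment_fps \<nu>) = fps_of_real (moment_fps law)"
    by (intro has_fps_expansion_eqI[OF moment_gf_has_fps_expansion[OF \<nu>]
        moment_gf_has_fps_expansion[OF real_distribution_law compactly_supported_law]])
      (use tendsto_of_real[OF s_lim] in auto)
  then have "fps_of_real (moment_fps \<nu>) $ k = fps_of_real (moment_fps law) $ k" by simp
  then show "moment \<nu> k = moment law k" by simp
qed

text \<open>The case \<psi> w = w with \<alpha> = 0 and \<beta> = 1. Among k >= 1 only \<tau> 2 =
  -1/2 is nonzero and gives the energy -1/4.\<close>

theorem free_entropy_semicircle: "free_entropy semicircle = ereal (- 1 / 4 + 3 / 4 + ln (2 * pi) / 2)"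
proof -
  define a where "a k = (if k = 1 then 1 else 0 :: real)" for k :: nat
  interpret joukowski_law 0 1 a
  proof
    have "(\<lambda>k. if k = 1 then 1 else 0 :: real) sums 1" by (rule sums_single)
    moreover have "(\<lambda>k. real k * \<bar>a k\<bar>) = (\<lambda>k. if k = 1 then 1 else 0)" by (auto simp: a_def)
    ultimately show "summable (\<lambda>k. real k * \<bar>a k\<bar>)" by (simp add: sums_iff)
  qed (auto simp: a_def)
  have s: "s \<theta> = sin \<theta>" for \<theta>
  proof -
    have "(\<lambda>k. a k * sin (real k * \<theta>)) = (\<lambda>k. if k = 1 then sin \<theta> else 0)" by (auto simp: a_def)
    then show ?thesis using sums_single[of 1 "\<lambda>_. sin \<theta>"] by (simp add: s_def sums_iff)
  qed
  have "dens x = sqrt (max 0 (4 - x\<^sup>2)) / (2 * pi)" for x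
  proof (cases "\<bar>x\<bar> \<le> 2")
    case True
    have "sin (arccos (x / 2)) = sqrt (1 - (x / 2)\<^sup>2)"
      using True by (intro sin_arccos) auto
    also have "\<dots> = sqrt ((4 - x\<^sup>2) / 2\<^sup>2)" by (simp add: power_divide diff_divide_distrib)
    also have "\<dots> = sqrt (4 - x\<^sup>2) / 2" unfolding real_sqrt_divide by simp
    finally have sin: "sin (arccos (x / 2)) = sqrt (4 - x\<^sup>2) / 2" .
    have "x\<^sup>2 \<le> 2\<^sup>2" using True power_mono[of "\<bar>x\<bar>" 2 2] by simp
    moreover have "dens x = sin (arccos (x / 2)) / pi"
      using True by (simp add: dens_def s abs_le_iff)
    ultimately show ?thesis unfolding sin by simp
  next
    case False
    then have "2\<^sup>2 \<le> \<bar>x\<bar>\<^sup>2" by (intro power_mono) auto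
    then show ?thesis using False by (auto simp: dens_def indicator_def)
  qed
  then have law: "semicircle = law"
    unfolding law_eq_density semicircle_def by simp
  have "\<tau> k = (if k = 0 then 1 else if k = 2 then - 1 / 2 else 0)" for k
    by (auto simp: \<tau>_def a_def)
  then have "energy_term = (\<lambda>k. if k = 2 then 1 / 4 else 0)"
    by (auto simp: fun_eq_iff power_divide)
  then have "suminf energy_term = 1 / 4"
    using sums_single[of 2 "\<lambda>_. 1 / 4 :: real"] by (simp add: sums_iff)
  then show ?thesis using log_energy_law(1) unfolding law by simp
qed

section \<open>Expansion of the energy\<close>

text \<open>Collects the constants of the error terms r, g, \<delta>^2, h / 6 and T of
  \<open>energy_expansion\<close>, with e^4 weakened to e^3; C |\<kappa>| is the one that arises at
  order e^3.\<close>

definition energy_error :: "real \<Rightarrow> real \<Rightarrow> real" where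
  "energy_error C \<kappa> = 256 * (C + \<bar>\<kappa>\<bar>) ^ 4 + 17 * C\<^sup>2 + 12 * C * (C + \<bar>\<kappa>\<bar>)\<^sup>2 +
     C * (\<bar>\<kappa>\<bar> + 2 * C)\<^sup>2 + C * \<bar>\<kappa>\<bar> + C\<^sup>2"

text \<open>Since z0 is known only to order e^2, ln \<beta> is not expanded in it. The variance
  gives 2 ln \<beta> = ln (1 + \<alpha>^2) - ln (1 + 2 \<delta>) with \<delta> = \<beta> z2 / 2, so
  ln \<beta> equals \<alpha>^2 / 2 - \<delta> up to order e^4.\<close>

lemma energy_expansion:
  fixes e \<kappa> C \<beta> \<alpha> :: real
  assumes e: "0 < e" "e \<le> 1" and C: "C > 0"
    and small: "C * e\<^sup>2 \<le> 1 / 4" "(C + \<bar>\<kappa>\<bar>) * e \<le> 1 / 8"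
    and z: "\<bar>z0\<bar> \<le> C * e\<^sup>2" "\<bar>z1 + e * \<kappa>\<bar> \<le> C * e\<^sup>2" "\<bar>z2\<bar> \<le> C * e\<^sup>2" "\<bar>z3\<bar> \<le> C * e\<^sup>2"
    and \<beta>: "\<beta> * (1 + z0) = 1"
    and t: "t1 = \<beta> * z1 / 2" "t2 = (\<beta> * z2 - 1) / 2" "t3 = \<beta> * (z3 - z1) / 2"
    and \<alpha>: "\<alpha> = - 2 * \<beta> * t1" and var: "2 * \<beta>\<^sup>2 * (1 + t2) = 1 + \<alpha>\<^sup>2"
    and T: "\<bar>T\<bar> \<le> 12 * C\<^sup>2 * e ^ 4"
  shows "\<bar>ln \<beta> - (2 * t1\<^sup>2 + t2\<^sup>2 + 2 / 3 * t3\<^sup>2 + T) + 1 / 4 + e\<^sup>2 * \<kappa>\<^sup>2 / 6\<bar> \<le>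
    energy_error C \<kappa> * e ^ 3"
proof -
  define A where "A = C + \<bar>\<kappa>\<bar>"
  have A: "A > 0" using C by (simp add: A_def)
  have e2: "e\<^sup>2 \<le> e" using e by (simp add: power2_eq_square mult_left_le)
  have e43: "e ^ 4 \<le> e ^ 3" using e by (intro power_decreasing) auto
  have z0: "\<bar>z0\<bar> \<le> 1 / 4" using z(1) small(1) by linarith
  then have z0': "1 + z0 \<ge> 3 / 4" by linarith
  have b: "\<beta> = 1 / (1 + z0)" using \<beta> z0' by (simp add: field_simps)
  have b_pos: "\<beta> > 0" using z0' by (simp add: b)
  have b_le: "\<beta> \<le> 2" using z0' by (simp add: b field_simps)
  have "\<beta> - 1 = - \<beta> * z0" using \<beta> by (simp add: algebra_simps)
  then have "\<bar>\<beta> - 1\<bar> = \<beta> * \<bar>z0\<bar>" using b_pos by (simp add: abs_mult)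
  also have "\<dots> \<le> 2 * (C * e\<^sup>2)" using b_pos b_le z(1) by (intro mult_mono) auto
  finally have b1: "\<bar>\<beta> - 1\<bar> \<le> 2 * (C * e\<^sup>2)" .
  have "\<beta>\<^sup>2 - 1 = (\<beta> - 1) * (\<beta> + 1)" by (simp add: power2_eq_square algebra_simps)
  then have "\<bar>\<beta>\<^sup>2 - 1\<bar> = \<bar>\<beta> - 1\<bar> * (\<beta> + 1)" using b_pos by (simp add: abs_mult)
  also have "\<dots> \<le> 2 * (C * e\<^sup>2) * 3" using b1 b_pos b_le by (intro mult_mono) auto
  finally have b2: "\<bar>\<beta>\<^sup>2 - 1\<bar> \<le> 6 * C * e\<^sup>2" by simp
  have b_sq: "\<beta>\<^sup>2 \<le> 4" using power_mono[OF b_le, of 2] b_pos by simp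
  have "\<bar>z1\<bar> \<le> \<bar>z1 + e * \<kappa>\<bar> + \<bar>e * \<kappa>\<bar>" by linarith
  also have "\<dots> \<le> C * e + e * \<bar>\<kappa>\<bar>"
    using z(2) C e2 e by (intro add_mono) (auto simp: abs_mult intro: order_trans[OF _ mult_left_mono])
  finally have z1: "\<bar>z1\<bar> \<le> A * e" by (simp add: A_def algebra_simps)
  have z1_sq: "z1\<^sup>2 \<le> A\<^sup>2 * e\<^sup>2"
    using power_mono[OF z1, of 2] by (simp add: power_mult_distrib)
  define \<delta> where "\<delta> = \<beta> * z2 / 2"
  have "\<bar>\<delta>\<bar> = \<beta> * \<bar>z2\<bar> / 2" using b_pos by (simp add: \<delta>_def abs_mult)
  also have "\<dots> \<le> 2 * (C * e\<^sup>2) / 2" using b_pos b_le z(3) by (intro divide_right_mono mult_mono) auto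
  finally have \<delta>: "\<bar>\<delta>\<bar> \<le> C * e\<^sup>2" by simp
  have \<delta>_sq: "\<delta>\<^sup>2 \<le> C\<^sup>2 * e ^ 4"
    using power_mono[OF \<delta>, of 2] by (simp add: power_mult_distrib flip: power_mult)
  have t2: "t2 = - 1 / 2 + \<delta>" by (simp add: t(2) \<delta>_def field_simps)
  have \<alpha>_sq: "\<alpha>\<^sup>2 = \<beta>\<^sup>2 * (\<beta>\<^sup>2 * z1\<^sup>2)" by (simp add: \<alpha> t(1) power2_eq_square)
  have "\<alpha>\<^sup>2 \<le> 4 * (4 * (A\<^sup>2 * e\<^sup>2))"
    unfolding \<alpha>_sq using b_sq z1_sq by (intro mult_mono) auto
  then have \<alpha>_le: "\<alpha>\<^sup>2 \<le> 16 * A\<^sup>2 * e\<^sup>2" by simp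
  have "(A * e)\<^sup>2 \<le> (1 / 8)\<^sup>2" using small(2) A e by (intro power_mono) (auto simp: A_def)
  then have "A\<^sup>2 * e\<^sup>2 \<le> 1 / 64" by (simp add: power_mult_distrib power_divide)
  then have \<alpha>_half: "\<alpha>\<^sup>2 \<le> 1 / 2" using \<alpha>_le by linarith
  have \<alpha>_4: "(\<alpha>\<^sup>2)\<^sup>2 \<le> 256 * A ^ 4 * e ^ 4"
    using power_mono[OF \<alpha>_le, of 2] by (simp add: power_mult_distrib flip: power_mult)
  have \<delta>_half: "\<bar>2 * \<delta>\<bar> \<le> 1 / 2" using \<delta> small(1) by linarith
  have "\<beta>\<^sup>2 * (1 + 2 * \<delta>) = 2 * \<beta>\<^sup>2 * (1 + t2)" by (simp add: t2 algebra_simps)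
  then have "\<beta>\<^sup>2 * (1 + 2 * \<delta>) = 1 + \<alpha>\<^sup>2" using var by simp
  moreover have "ln (\<beta>\<^sup>2 * (1 + 2 * \<delta>)) = 2 * ln \<beta> + ln (1 + 2 * \<delta>)"
    using b_pos \<delta>_half by (simp add: ln_mult_pos ln_realpow)
  ultimately have ln: "2 * ln \<beta> + ln (1 + 2 * \<delta>) = ln (1 + \<alpha>\<^sup>2)" by simp
  define r where "r = ln \<beta> - (\<alpha>\<^sup>2 / 2 - \<delta>)"
  have "\<bar>ln (1 + \<alpha>\<^sup>2) - \<alpha>\<^sup>2\<bar> \<le> 2 * (\<alpha>\<^sup>2)\<^sup>2"
    using \<alpha>_half by (intro abs_ln_one_plus_x_minus_x_bound) auto
  moreover have "\<bar>ln (1 + 2 * \<delta>) - 2 * \<delta>\<bar> \<le> 2 * (2 * \<delta>)\<^sup>2"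
    using \<delta>_half by (intro abs_ln_one_plus_x_minus_x_bound) auto
  moreover have "2 * (2 * \<delta>)\<^sup>2 = 8 * \<delta>\<^sup>2" by (simp add: power2_eq_square)
  ultimately have "\<bar>r\<bar> \<le> (\<alpha>\<^sup>2)\<^sup>2 + 4 * \<delta>\<^sup>2" unfolding r_def using ln by linarith
  then have r: "\<bar>r\<bar> \<le> 256 * A ^ 4 * e ^ 4 + 4 * (C\<^sup>2 * e ^ 4)" using \<alpha>_4 \<delta>_sq by linarith
  \<comment> \<open>What survives of \<alpha>^2 / 2 - 2 t1^2; the factor \<beta>^2 - 1 makes it of
    fourth order.\<close>
  define g where "g = \<beta>\<^sup>2 * z1\<^sup>2 * (\<beta>\<^sup>2 - 1) / 2"
  have g: "\<bar>g\<bar> \<le> 12 * C * A\<^sup>2 * e ^ 4"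
  proof -
    have "\<bar>g\<bar> = \<beta>\<^sup>2 * z1\<^sup>2 * \<bar>\<beta>\<^sup>2 - 1\<bar> / 2" by (simp add: g_def abs_mult)
    also have "\<dots> \<le> 4 * (A\<^sup>2 * e\<^sup>2) * (6 * C * e\<^sup>2) / 2"
      using b_sq z1_sq b2 by (intro divide_right_mono mult_mono) auto
    also have "\<dots> = 12 * C * A\<^sup>2 * e ^ 4" by (simp add: power2_eq_square power4_eq_xxxx)
    finally show ?thesis .
  qed
  define y where "y = z3 - z1 - e * \<kappa>"
  have y: "\<bar>y\<bar> \<le> 2 * C * e\<^sup>2" using z(2,4) unfolding y_def by linarith
  have "\<bar>z3 - z1\<bar> \<le> e * \<bar>\<kappa>\<bar> + 2 * C * e"
  proof -
    have "\<bar>z3 - z1\<bar> \<le> \<bar>e * \<kappa>\<bar> + \<bar>y\<bar>" unfolding y_def by linarith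
    moreover have "2 * C * e\<^sup>2 \<le> 2 * C * e" using C e2 by (intro mult_left_mono) auto
    moreover have "\<bar>e * \<kappa>\<bar> = e * \<bar>\<kappa>\<bar>" using e by (simp add: abs_mult)
    ultimately show ?thesis using y by linarith
  qed
  then have "\<bar>z3 - z1\<bar> \<le> (\<bar>\<kappa>\<bar> + 2 * C) * e" by (simp add: algebra_simps)
  from power_mono[OF this, of 2] have zz: "(z3 - z1)\<^sup>2 \<le> (\<bar>\<kappa>\<bar> + 2 * C)\<^sup>2 * e\<^sup>2"
    by (simp add: power_mult_distrib)
  \<comment> \<open>As 2/3 t3^2 is \<beta>^2 (z3 - z1)^2 / 6, the quantity h / 6 compares it with
    the main term.\<close>
  define h where "h = e\<^sup>2 * \<kappa>\<^sup>2 - \<beta>\<^sup>2 * (z3 - z1)\<^sup>2"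
  have h_eq: "h = - ((\<beta>\<^sup>2 - 1) * (z3 - z1)\<^sup>2) - 2 * (e * \<kappa>) * y - y\<^sup>2"
    by (simp add: h_def y_def power2_eq_square algebra_simps)
  have "\<bar>(\<beta>\<^sup>2 - 1) * (z3 - z1)\<^sup>2\<bar> \<le> (6 * C * e\<^sup>2) * ((\<bar>\<kappa>\<bar> + 2 * C)\<^sup>2 * e\<^sup>2)"
    unfolding abs_mult using b2 zz by (intro mult_mono) auto
  also have "\<dots> = 6 * C * (\<bar>\<kappa>\<bar> + 2 * C)\<^sup>2 * e ^ 4" by (simp add: power2_eq_square power4_eq_xxxx)
  finally have h1: "\<bar>(\<beta>\<^sup>2 - 1) * (z3 - z1)\<^sup>2\<bar> \<le> 6 * C * (\<bar>\<kappa>\<bar> + 2 * C)\<^sup>2 * e ^ 4" .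
  have "\<bar>2 * (e * \<kappa>) * y\<bar> \<le> 2 * (e * \<bar>\<kappa>\<bar>) * (2 * C * e\<^sup>2)"
    unfolding abs_mult using y e by (intro mult_mono) auto
  also have "\<dots> = 4 * C * \<bar>\<kappa>\<bar> * e ^ 3" by (simp add: power2_eq_square power3_eq_cube)
  finally have h2: "\<bar>2 * (e * \<kappa>) * y\<bar> \<le> 4 * C * \<bar>\<kappa>\<bar> * e ^ 3" .
  have h3: "y\<^sup>2 \<le> 4 * C\<^sup>2 * e ^ 4"
    using power_mono[OF y, of 2] by (simp add: power_mult_distrib flip: power_mult)
  have h: "\<bar>h\<bar> \<le> 6 * C * (\<bar>\<kappa>\<bar> + 2 * C)\<^sup>2 * e ^ 4 + 4 * C * \<bar>\<kappa>\<bar> * e ^ 3 + 4 * C\<^sup>2 * e ^ 4"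
    unfolding h_eq using h1 h2 h3 zero_le_power2[of y] by linarith
  have h6: "\<bar>h / 6\<bar> \<le> C * (\<bar>\<kappa>\<bar> + 2 * C)\<^sup>2 * e ^ 4 + C * \<bar>\<kappa>\<bar> * e ^ 3 + C\<^sup>2 * e ^ 4"
  proof -
    have weaken: "\<bar>x / 6\<bar> \<le> p + k + c" if "\<bar>x\<bar> \<le> 6 * p + 4 * k + 4 * c" "0 \<le> k" "0 \<le> c"
      for x p k c :: real
      using that by linarith
    have "0 \<le> C * \<bar>\<kappa>\<bar> * e ^ 3" "0 \<le> C\<^sup>2 * e ^ 4"
      using C e by (intro mult_nonneg_nonneg zero_le_power; simp)+
    then show ?thesis by (intro weaken) (use h in \<open>simp_all only: mult.assoc\<close>)
  qed
  define X where "X = 256 * A ^ 4 + 17 * C\<^sup>2 + 12 * C * A\<^sup>2 + C * (\<bar>\<kappa>\<bar> + 2 * C)\<^sup>2 + C\<^sup>2"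
  have decomp: "ln \<beta> - (2 * t1\<^sup>2 + t2\<^sup>2 + 2 / 3 * t3\<^sup>2 + T) + 1 / 4 + e\<^sup>2 * \<kappa>\<^sup>2 / 6 =
      r + g - \<delta>\<^sup>2 + h / 6 - T"
    by (simp add: r_def g_def h_def \<alpha> t2 t(1,3) power2_eq_square field_simps)
  have "\<bar>r + g - \<delta>\<^sup>2 + h / 6 - T\<bar> \<le> (256 * A ^ 4 * e ^ 4 + 4 * (C\<^sup>2 * e ^ 4)) + 12 * C * A\<^sup>2 * e ^ 4 + C\<^sup>2 * e ^ 4 +
      (C * (\<bar>\<kappa>\<bar> + 2 * C)\<^sup>2 * e ^ 4 + C * \<bar>\<kappa>\<bar> * e ^ 3 + C\<^sup>2 * e ^ 4) + 12 * C\<^sup>2 * e ^ 4"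
  proof -
    have triangle: "\<bar>x1 + x2 - x3 + x4 - x5\<bar> \<le> b1 + b2 + b3 + b4 + b5"
      if "\<bar>x1\<bar> \<le> b1" "\<bar>x2\<bar> \<le> b2" "\<bar>x3\<bar> \<le> b3" "\<bar>x4\<bar> \<le> b4" "\<bar>x5\<bar> \<le> b5"
      for x1 x2 x3 x4 x5 b1 b2 b3 b4 b5 :: real
      using that by linarith
    have d: "\<bar>\<delta>\<^sup>2\<bar> \<le> C\<^sup>2 * e ^ 4" using \<delta>_sq by simp
    show ?thesis by (rule triangle[OF r g d h6 T])
  qed
  also have "\<dots> = X * e ^ 4 + C * \<bar>\<kappa>\<bar> * e ^ 3"
  proof -
    have "256 * a4 * e4 + 4 * (c2 * e4) + b * e4 + c2 * e4 + (p * e4 + k + c2 * e4) + 12 * c2 * e4 =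
        (256 * a4 + 17 * c2 + b + p + c2) * e4 + k" for a4 b c2 p e4 k :: real
      by algebra
    then show ?thesis unfolding X_def .
  qed
  also have "\<dots> \<le> X * e ^ 3 + C * \<bar>\<kappa>\<bar> * e ^ 3"
  proof (intro add_right_mono mult_left_mono[OF e43])
    show "0 \<le> X"
      unfolding X_def using A C by (intro add_nonneg_nonneg mult_nonneg_nonneg zero_le_power) auto
  qed
  also have "\<dots> = (256 * A ^ 4 + 17 * C\<^sup>2 + 12 * C * A\<^sup>2 + C * (\<bar>\<kappa>\<bar> + 2 * C)\<^sup>2 +
      C * \<bar>\<kappa>\<bar> + C\<^sup>2) * e ^ 3"
    unfolding X_def by (simp only: distrib_right add_ac)
  finally show ?thesis unfolding decomp A_def energy_error_def .
qed

lemma perturbed_energy: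
  fixes z :: "nat \<Rightarrow> real"
  assumes e: "0 < e" "e \<le> 1" and C: "C > 0"
    and small: "40 * (C + 2 * \<bar>\<kappa>\<bar>) * e \<le> 1"
    and z: "\<And>k. \<bar>z k + (if k = 1 then e * \<kappa> else 0)\<bar> \<le> C * e\<^sup>2 * (2 / 3) ^ k"
    and \<beta>: "\<beta> * (1 + z 0) = 1"
  defines "a \<equiv> (\<lambda>k. if k = 0 then 0 else (if k = 1 then 1 else 0) + z (k - 1))"
  shows "joukowski_law \<beta> a"
    and "moment (joukowski_law.law \<alpha> \<beta> a) 1 = 0 \<Longrightarrow> moment (joukowski_law.law \<alpha> \<beta> a) 2 = 1 \<Longrightarrow>
      \<bar>ln \<beta> - suminf (\<lambda>k. 2 / real k * (joukowski_law.\<tau> \<beta> a k)\<^sup>2) + 1 / 4 + e\<^sup>2 * \<kappa>\<^sup>2 / 6\<bar> \<le>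
      energy_error C \<kappa> * e ^ 3"
proof -
  \<comment> \<open>D e (2/3)^k bounds every coefficient z k; the factor 2 at |\<kappa>| pays for
    the ratio 2/3 at k = 1.\<close>
  define D where "D = C + 2 * \<bar>\<kappa>\<bar>"
  have "40 * (D * e) \<le> 1" using small by (simp only: D_def mult.assoc)
  then have D: "D > 0" "D * e \<le> 1 / 40" using C by (simp_all add: D_def add_pos_nonneg)
  have e2: "e\<^sup>2 \<le> e" using e by (simp add: power2_eq_square mult_left_le)
  have Ce: "C * e\<^sup>2 \<le> C * e" using C e2 by (intro mult_left_mono) auto
  have CD: "C * e \<le> D * e" using e by (intro mult_right_mono) (auto simp: D_def)
  have zD: "\<bar>z k\<bar> \<le> D * e * (2 / 3) ^ k" for k
  proof (cases "k = 1")
    case True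
    have "\<bar>z 1\<bar> \<le> \<bar>z 1 + e * \<kappa>\<bar> + e * \<bar>\<kappa>\<bar>" using e abs_mult[of e \<kappa>] by linarith
    also have "\<dots> \<le> C * e * (2 / 3) + 2 * (e * \<bar>\<kappa>\<bar>) * (2 / 3)"
    proof -
      have "\<bar>z 1 + e * \<kappa>\<bar> \<le> C * e\<^sup>2 * (2 / 3)" using z[of 1] by simp
      moreover have "0 \<le> e * \<bar>\<kappa>\<bar>" using e by simp
      ultimately show ?thesis using Ce by linarith
    qed
    finally show ?thesis using True by (simp add: D_def algebra_simps)
  next
    case False
    have "\<bar>z k\<bar> \<le> C * e\<^sup>2 * (2 / 3) ^ k" using z[of k] False by simp
    also have "\<dots> \<le> D * e * (2 / 3) ^ k" using Ce CD by (intro mult_right_mono) auto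
    finally show ?thesis .
  qed
  have z0: "\<bar>z 0\<bar> \<le> 1 / 40" using zD[of 0] D by simp
  have a_Suc: "a (Suc k) = (if k = 0 then 1 else 0) + z k" for k by (simp add: a_def)
  \<comment> \<open>Without its first term this sum is 8, so the sum of k |a k| over k >= 2 is at
    most 8 D e <= 1/5, well below a 1 >= 39/40.\<close>
  have geo: "(\<lambda>k. real (Suc k) * (2 / 3 :: real) ^ k) sums 9"
    using geometric_deriv_sums[of "2 / 3 :: real"] by (simp add: power2_eq_square)
  then have geo_D: "(\<lambda>k. D * e * (real (Suc k) * (2 / 3) ^ k)) sums (D * e * 9)"
    by (rule sums_mult)
  have term_le: "real (Suc k) * \<bar>a (Suc k)\<bar> \<le> D * e * (real (Suc k) * (2 / 3) ^ k)" if "k > 0" for k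
  proof -
    have "real (Suc k) * \<bar>z k\<bar> \<le> real (Suc k) * (D * e * (2 / 3) ^ k)"
      using zD by (intro mult_left_mono) auto
    then show ?thesis using that by (simp add: a_Suc mult_ac)
  qed
  have "summable (\<lambda>k. real (Suc k) * \<bar>a (Suc k)\<bar>)"
    by (rule summable_comparison_test'[OF sums_summable[OF geo_D], of 1])
      (use term_le in auto)
  then have sum_a: "summable (\<lambda>k. real k * \<bar>a k\<bar>)" by (subst (asm) summable_Suc_iff)
  have b_pos: "\<beta> > 0"
  proof -
    have "1 + z 0 > 0" using z0 by linarith
    moreover have "\<beta> * (1 + z 0) > 0" using \<beta> by simp
    ultimately show ?thesis by (simp add: zero_less_mult_iff)
  qed
  have "suminf (\<lambda>k. real (k + 2) * \<bar>a (k + 2)\<bar>) \<le> suminf (\<lambda>k. D * e * (real (Suc (Suc k)) * (2 / 3) ^ Suc k))"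
  proof (rule suminf_le)
    show "real (k + 2) * \<bar>a (k + 2)\<bar> \<le> D * e * (real (Suc (Suc k)) * (2 / 3) ^ Suc k)" for k
      using term_le[of "Suc k"] by simp
    show "summable (\<lambda>k. real (k + 2) * \<bar>a (k + 2)\<bar>)"
      using sum_a by (subst summable_iff_shift[of "\<lambda>k. real k * \<bar>a k\<bar>"])
    show "summable (\<lambda>k. D * e * (real (Suc (Suc k)) * (2 / 3) ^ Suc k))"
      using sums_summable[OF geo_D] by (subst summable_Suc_iff)
  qed
  also have "\<dots> = D * e * 9 - D * e"
    using suminf_split_head[OF sums_summable[OF geo_D]] geo_D by (simp add: sums_iff)
  also have "\<dots> \<le> a 1" using D z0 a_Suc[of 0] by simp
  finally have a_pos: "suminf (\<lambda>k. real (k + 2) * \<bar>a (k + 2)\<bar>) \<le> a 1" .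
  show jl: "joukowski_law \<beta> a"
    by unfold_locales (use b_pos \<beta> sum_a a_pos a_Suc[of 0] in \<open>auto simp: a_def\<close>)
  interpret joukowski_law \<alpha> \<beta> a by (rule jl)
  assume m: "moment law 1 = 0" "moment law 2 = 1"
  \<comment> \<open>For k >= 3, \<tau> k involves z k and z (k - 2). From k = 4 on the first-order
    coefficient z 1 no longer occurs, so every square is of order e^4.\<close>
  define T where "T = suminf (\<lambda>k. 2 / real (k + 4) * (\<tau> (k + 4))\<^sup>2)"
  have tau: "\<tau> 1 = \<beta> * z 1 / 2" "\<tau> 2 = (\<beta> * z 2 - 1) / 2" "\<tau> 3 = \<beta> * (z 3 - z 1) / 2"
    using \<beta> by (simp_all add: \<tau>_def eval_nat_numeral a_Suc a_0 algebra_simps)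
  have b_le: "\<beta> \<le> 2"
  proof (rule ccontr)
    assume "\<not> \<beta> \<le> 2"
    then have "\<beta> * (1 + z 0) > 2 * (1 / 2)" using z0 by (intro mult_strict_mono) auto
    then show False using \<beta> by simp
  qed
  have geo4: "(\<lambda>k. 4 * C\<^sup>2 * e ^ 4 * (2 / 3) ^ k) sums (12 * C\<^sup>2 * e ^ 4)"
    using sums_mult[OF geometric_sums[of "2 / 3 :: real"], of "4 * C\<^sup>2 * e ^ 4"] by (simp add: mult.assoc)
  have T_term: "norm (2 / real (k + 4) * (\<tau> (k + 4))\<^sup>2) \<le> 4 * C\<^sup>2 * e ^ 4 * (2 / 3) ^ k" for k
  proof -
    have pw: "(2 / 3 :: real) ^ (k + j) \<le> (2 / 3) ^ k" for j by (intro power_decreasing) auto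
    have zk: "\<bar>z (k + j)\<bar> \<le> C * e\<^sup>2 * (2 / 3) ^ k" if "j \<ge> 2" for j
    proof -
      have "\<bar>z (k + j)\<bar> \<le> C * e\<^sup>2 * (2 / 3) ^ (k + j)" using z[of "k + j"] that by auto
      also have "\<dots> \<le> C * e\<^sup>2 * (2 / 3) ^ k" using C pw by (intro mult_left_mono) auto
      finally show ?thesis .
    qed
    have "\<tau> (k + 4) = \<beta> / 2 * (z (k + 4) - z (k + 2))"
      by (simp add: \<tau>_def a_Suc eval_nat_numeral)
    from arg_cong[OF this, of abs] have "\<bar>\<tau> (k + 4)\<bar> = \<beta> / 2 * \<bar>z (k + 4) - z (k + 2)\<bar>"
      unfolding abs_mult using b_pos by simp
    also have "\<dots> \<le> 1 * (2 * (C * e\<^sup>2 * (2 / 3) ^ k))"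
      using b_pos b_le zk[of 4] zk[of 2] by (intro mult_mono) auto
    finally have "\<bar>\<tau> (k + 4)\<bar> \<le> 2 * (C * e\<^sup>2 * (2 / 3) ^ k)" by simp
    from power_mono[OF this, of 2] have "(\<tau> (k + 4))\<^sup>2 \<le> 4 * C\<^sup>2 * e ^ 4 * ((2 / 3) ^ k)\<^sup>2"
      by (simp add: power_mult_distrib flip: power_mult)
    also have "((2 / 3) ^ k)\<^sup>2 \<le> ((2 / 3) ^ k :: real)"
      by (simp add: power2_eq_square mult_left_le power_le_one)
    then have "4 * C\<^sup>2 * e ^ 4 * ((2 / 3) ^ k)\<^sup>2 \<le> 4 * C\<^sup>2 * e ^ 4 * (2 / 3) ^ k"
      using e by (intro mult_left_mono) auto
    finally have "(\<tau> (k + 4))\<^sup>2 \<le> 4 * C\<^sup>2 * e ^ 4 * (2 / 3) ^ k" .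
    then have "2 / real (k + 4) * (\<tau> (k + 4))\<^sup>2 \<le> 1 * (4 * C\<^sup>2 * e ^ 4 * (2 / 3) ^ k)"
      by (intro mult_mono) auto
    then show ?thesis by simp
  qed
  have "\<bar>T\<bar> \<le> suminf (\<lambda>k. norm (2 / real (k + 4) * (\<tau> (k + 4))\<^sup>2))"
    unfolding T_def real_norm_def
    by (rule summable_rabs, rule summable_comparison_test'[OF sums_summable[OF geo4], of 0])
      (use T_term in simp)
  also have "\<dots> \<le> suminf (\<lambda>k. 4 * C\<^sup>2 * e ^ 4 * (2 / 3) ^ k)"
    by (intro suminf_le T_term sums_summable[OF geo4] summable_comparison_test'[OF sums_summable[OF geo4], of 0])
      (use T_term in simp)
  also have "\<dots> = 12 * C\<^sup>2 * e ^ 4" using geo4 by (simp add: sums_iff)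
  finally have T: "\<bar>T\<bar> \<le> 12 * C\<^sup>2 * e ^ 4" .
  have "suminf energy_term = T + (\<Sum>k<4. energy_term k)"
    unfolding T_def by (rule suminf_split_initial_segment[OF summable_tau])
  also have "(\<Sum>k<4. energy_term k) = 2 * (\<tau> 1)\<^sup>2 + (\<tau> 2)\<^sup>2 + 2 / 3 * (\<tau> 3)\<^sup>2"
    by (simp add: eval_nat_numeral)
  finally have sum: "suminf energy_term = 2 * (\<tau> 1)\<^sup>2 + (\<tau> 2)\<^sup>2 + 2 / 3 * (\<tau> 3)\<^sup>2 + T"
    by simp
  have \<alpha>: "\<alpha> = - 2 * \<beta> * \<tau> 1" using m(1) unfolding moment_law_1 by simp
  have var: "2 * \<beta>\<^sup>2 * (1 + \<tau> 2) = 1 + \<alpha>\<^sup>2"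
  proof -
    have "4 * \<alpha> * \<beta> * \<tau> 1 = - 2 * \<alpha>\<^sup>2" by (simp add: \<alpha> power2_eq_square)
    then show ?thesis using m(2) unfolding moment_law_2 by simp
  qed
  have "\<bar>z k\<bar> \<le> C * e\<^sup>2" if "k \<noteq> 1" for k
  proof -
    have "C * e\<^sup>2 * (2 / 3) ^ k \<le> C * e\<^sup>2 * 1"
      using C by (intro mult_left_mono power_le_one) auto
    then show ?thesis using z[of k] that by simp
  qed
  moreover have "\<bar>z 1 + e * \<kappa>\<bar> \<le> C * e\<^sup>2"
  proof -
    have "0 \<le> C * e\<^sup>2" using C by simp
    moreover have "\<bar>z 1 + e * \<kappa>\<bar> \<le> C * e\<^sup>2 * (2 / 3)" using z[of 1] by simp
    ultimately show ?thesis by linarith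
  qed
  moreover have "C * e\<^sup>2 \<le> 1 / 4" using Ce CD D by linarith
  moreover have "(C + \<bar>\<kappa>\<bar>) * e \<le> 1 / 8"
  proof -
    have "(C + \<bar>\<kappa>\<bar>) * e \<le> D * e" using e by (intro mult_right_mono) (auto simp: D_def)
    then show ?thesis using D by linarith
  qed
  ultimately show "\<bar>ln \<beta> - suminf energy_term + 1 / 4 + e\<^sup>2 * \<kappa>\<^sup>2 / 6\<bar> \<le>
      energy_error C \<kappa> * e ^ 3"
    unfolding sum by (intro energy_expansion[OF e C _ _ _ _ _ _ \<beta> tau \<alpha> var T]) auto
qed

theorem corollary2p12:
  fixes \<mu> :: "real measure"
  assumes "real_distribution \<mu>" and "compactly_supported \<mu>"
    and "moment \<mu> 1 = 0" and "moment \<mu> 2 = 1"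
  shows "\<exists>c\<^sub>1>0. \<exists>c>0. \<forall>n::nat. real n \<ge> c\<^sub>1 \<longrightarrow>
    (\<forall>\<mu>\<^sub>n. normalized_sum_law \<mu> n \<mu>\<^sub>n \<longrightarrow>
      (\<exists>p \<in> borel_measurable borel.
        (\<forall>x. p x \<ge> 0) \<and> \<mu>\<^sub>n = density lborel (\<lambda>x. ennreal (p x)) \<and>
        integrable (lborel \<Otimes>\<^sub>M lborel) (\<lambda>(x, y). ln \<bar>x - y\<bar> * p x * p y) \<and>
        free_entropy \<mu>\<^sub>n =
          ereal ((LINT (x, y)|(lborel \<Otimes>\<^sub>M lborel). ln \<bar>x - y\<bar> * p x * p y)
                 + 3 / 4 + ln (2 * pi) / 2) \<and>
        (\<exists>\<theta>::real. \<bar>\<theta>\<bar> \<le> 1 \<and>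
          free_entropy \<mu>\<^sub>n =
            free_entropy semicircle - ereal ((moment \<mu> 3)\<^sup>2 / (6 * real n))
              + ereal (\<theta> * c / real n powr (3 / 2)))))"
proof -
  define \<kappa> where "\<kappa> = moment \<mu> 3"
  obtain \<rho> B Q where \<rho>: "\<rho> > 0" and Q: "Q holomorphic_on ball 0 \<rho>"
    and Q_le: "\<And>z. norm z < \<rho> \<Longrightarrow> norm (Q z) \<le> B"
    and Q_cnj: "\<And>z. norm z < \<rho> \<Longrightarrow> Q (cnj z) = cnj (Q z)"
    and clt: "\<And>n \<nu> e. n > 0 \<Longrightarrow> normalized_sum_law \<mu> n \<nu> \<Longrightarrow> e = 1 / sqrt (real n) \<Longrightarrow>
      real_distribution \<nu> \<and> compactly_supported \<nu> \<and> moment \<nu> 1 = 0 \<and> moment \<nu> 2 = 1 \<and>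
      eventually (\<lambda>t. let s = t / (1 + t\<^sup>2 + of_real (e * moment \<mu> 3) * t ^ 3 +
          of_real (e\<^sup>2) * t ^ 4 * Q (of_real e * t))
        in s * moment_gf \<nu> s = t) (nhds 0)"
    by (rule free_clt_gf[OF assms]) (rule that)
  obtain C e\<^sub>0 where C: "C > 0" and e\<^sub>0: "e\<^sub>0 > 0"
    and unif: "\<And>e. 0 < e \<Longrightarrow> e < e\<^sub>0 \<Longrightarrow> \<exists>\<alpha> \<beta> z \<zeta>. uniformizes C e \<kappa> Q \<alpha> \<beta> z \<zeta>"
    by (rule uniformization[OF \<rho> Q Q_le Q_cnj]) (assumption, assumption, rule that)
  define K where "K = energy_error C \<kappa>"
  have K: "K > 0" using C unfolding K_def energy_error_def by (intro add_nonneg_pos add_nonneg_nonneg) auto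
  \<comment> \<open>Combines the range of \<open>uniformization\<close> with the smallness asked for
    by \<open>perturbed_energy\<close>. The summand 1 in the threshold for n below makes e <
    \<open>e\<^sub>1\<close> strict.\<close>
  define e\<^sub>1 where "e\<^sub>1 = min e\<^sub>0 (min 1 (1 / (40 * (C + 2 * \<bar>\<kappa>\<bar>))))"
  have D: "C + 2 * \<bar>\<kappa>\<bar> > 0" using C by (simp add: add_pos_nonneg)
  have e\<^sub>1: "e\<^sub>1 > 0" using e\<^sub>0 D by (simp add: e\<^sub>1_def)
  show ?thesis
  proof (rule exI[of _ "1 / e\<^sub>1\<^sup>2 + 1"], rule conjI, use e\<^sub>1 in \<open>simp add: add_pos_pos\<close>,
      rule exI[of _ K], rule conjI, rule K, intro allI impI)
    fix n :: nat and \<nu>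
    assume n: "real n \<ge> 1 / e\<^sub>1\<^sup>2 + 1" and nu: "normalized_sum_law \<mu> n \<nu>"
    define e where "e = 1 / sqrt (real n)"
    have "1 / e\<^sub>1\<^sup>2 > 0" using e\<^sub>1 by simp
    then have "real n > 0" using n by linarith
    then have n0: "n > 0" by simp
    have "sqrt (1 / e\<^sub>1\<^sup>2) < sqrt (real n)" using n by (intro real_sqrt_less_mono) simp
    then have "1 / e\<^sub>1 < sqrt (real n)" using e\<^sub>1 by (simp add: real_sqrt_divide)
    then have "e < e\<^sub>1" using e\<^sub>1 n0 by (simp add: e_def field_simps)
    then have e: "0 < e" "e < e\<^sub>0" "e \<le> 1" "e < 1 / (40 * (C + 2 * \<bar>\<kappa>\<bar>))"
      using n0 by (auto simp: e_def e\<^sub>1_def)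
    have small: "40 * (C + 2 * \<bar>\<kappa>\<bar>) * e \<le> 1"
      using mult_strict_left_mono[OF e(4), of "40 * (C + 2 * \<bar>\<kappa>\<bar>)"] D by simp
    have nu_props: "real_distribution \<nu>" "compactly_supported \<nu>" "moment \<nu> 1 = 0" "moment \<nu> 2 = 1"
      and gf: "inverts e \<kappa> Q \<nu>"
      using clt[OF n0 nu e_def] unfolding \<kappa>_def by blast+
    obtain \<alpha> \<beta> :: real and z :: "nat \<Rightarrow> real" and \<zeta> where
      z: "\<And>k. \<bar>z k + (if k = 1 then e * \<kappa> else 0)\<bar> \<le> C * e\<^sup>2 * (2 / 3) ^ k"
      and z_sums: "\<And>w. w \<in> ball 0 2 \<Longrightarrow> (\<lambda>k. of_real (z k) * w ^ k) sums \<zeta> w"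
      and eq: "\<And>w. w \<in> ball 0 2 \<Longrightarrow> let t = w * (1 + \<zeta> w) in
        inverse_kernel e \<kappa> Q t =
        (1 + \<zeta> w) * (of_real \<alpha> * w + of_real \<beta> * (w\<^sup>2 + 1))"
      using unif[OF e(1,2)] by blast
    have zeta0: "\<zeta> 0 = of_real (z 0)"
      using z_sums[of 0] powser_sums_zero[of "\<lambda>k. complex_of_real (z k)"] sums_unique2 by auto
    \<comment> \<open>At w = 0 the uniformization equation reduces to 1 = (1 + \<zeta> 0) \<beta>,
      the normalization of total mass.\<close>
    have \<beta>: "\<beta> * (1 + z 0) = 1"
    proof -
      have "complex_of_real (\<beta> * (1 + z 0)) = of_real 1"
        using eq[of 0] by (simp add: Let_def zeta0 mult.commute)
      then show ?thesis by (simp only: of_real_eq_iff)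
    qed
    \<comment> \<open>The Taylor coefficients of \<psi> w = w (1 + \<zeta> w).\<close>
    define a where "a = (\<lambda>k. if k = 0 then 0 else (if k = 1 then 1 else 0) + z (k - 1))"
    note pe = perturbed_energy[OF e(1,3) C small z \<beta>, folded a_def K_def]
    interpret joukowski_law \<alpha> \<beta> a by (rule pe(1))
    have a_sums: "(\<lambda>k. of_real (a k * w ^ k)) sums (of_real w * (1 + \<zeta> (of_real w)))"
      if w: "\<bar>w\<bar> < 2" for w
    proof -
      have "(\<lambda>k. if k = 0 then 1 else 0 :: complex) sums 1" by (rule sums_single)
      moreover have "(\<lambda>k. of_real (z k) * (of_real w) ^ k) sums \<zeta> (of_real w)"
        using w by (intro z_sums) simp
      ultimately have "(\<lambda>k. of_real w * ((if k = 0 then 1 else 0) + of_real (z k) * (of_real w) ^ k))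
          sums (of_real w * (1 + \<zeta> (of_real w)))"
        by (intro sums_mult sums_add)
      moreover have "of_real w * ((if k = 0 then 1 else 0) + of_real (z k) * (of_real w) ^ k) =
          complex_of_real (a (Suc k) * w ^ Suc k)" for k
        by (simp add: a_def algebra_simps)
      ultimately have "(\<lambda>k. complex_of_real (a (Suc k) * w ^ Suc k)) sums (of_real w * (1 + \<zeta> (of_real w)))"
        by simp
      then show ?thesis by (subst (asm) sums_Suc_iff) (simp add: a_def)
    qed
    have psi: "of_real w * (1 + \<zeta> (of_real w)) = complex_of_real (suminf (\<lambda>k. a k * w ^ k))"
      if w: "\<bar>w\<bar> < 2" for w
    proof -
      have "(\<lambda>k. a k * w ^ k) sums Re (of_real w * (1 + \<zeta> (of_real w)))"
        using sums_Re[OF a_sums[OF w]] by simp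
      then have "summable (\<lambda>k. a k * w ^ k)" by (rule sums_summable)
      from summable_sums[OF this] have "(\<lambda>k. complex_of_real (a k * w ^ k)) sums of_real (suminf (\<lambda>k. a k * w ^ k))"
        by (rule sums_of_real)
      then show ?thesis using a_sums[OF w] sums_unique2 by blast
    qed
    have zeta_lim: "((\<lambda>w::real. \<zeta> (of_real w)) \<longlongrightarrow> of_real (z 0)) (at 0)"
    proof -
      have "eventually (\<lambda>w::complex. w \<in> ball 0 2) (nhds 0)"
        by (intro eventually_nhds_in_open) auto
      then have "\<zeta> has_fps_expansion Abs_fps (\<lambda>k. of_real (z k))"
        by (intro has_fps_expansionI) (use z_sums in \<open>auto elim: eventually_mono\<close>)
      then have "isCont \<zeta> 0" by (rule has_fps_expansion_imp_continuous)
      then have "isCont \<zeta> (complex_of_real 0)" by simp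
      from isCont_tendsto_compose[OF this tendsto_of_real[OF tendsto_ident_at]] show ?thesis
        by (simp add: zeta0)
    qed
    have t_lim: "((\<lambda>w::real. of_real w * (1 + \<zeta> (of_real w))) \<longlongrightarrow> 0) (at 0)"
      by (rule tendsto_eq_intros zeta_lim tendsto_of_real tendsto_ident_at | simp)+
    have ne: "complex_of_real (1 + z 0) \<noteq> 0" using \<beta> by (metis mult_zero_right of_real_eq_0_iff zero_neq_one)
    have "eventually (\<lambda>w::real. 1 + \<zeta> (of_real w) \<noteq> 0) (at 0)"
      using tendsto_add[OF tendsto_const[of 1] zeta_lim] ne
      by (intro tendsto_imp_eventually_ne[of _ "1 + of_real (z 0)"]) auto
    moreover have "eventually (\<lambda>w::real. \<bar>w\<bar> < 2) (at 0)"
      using order_tendstoD(2)[OF tendsto_rabs_zero[OF tendsto_ident_at], of 2] by simp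
    \<comment> \<open>The germ identity is evaluated along t = \<psi> w. The uniformization equation
      then identifies s with 1 / (\<alpha> + \<beta> (w + 1 / w)) after cancelling 1 + \<zeta> w,
      which is nonzero near 0.\<close>
    moreover have "eventually (\<lambda>w::real. 
        let t = of_real w * (1 + \<zeta> (of_real w)); s = t / inverse_kernel e \<kappa> Q t
        in s * moment_gf \<nu> s = t) (at 0)"
      using eventually_compose_filterlim[OF gf t_lim] by (simp only: Let_def)
    ultimately have "eventually (\<lambda>w::real. let s = w / (\<beta> * (1 + w\<^sup>2) + \<alpha> * w) in
      of_real s * moment_gf \<nu> (of_real s) = of_real (suminf (\<lambda>k. a k * w ^ k))) (at 0)"
    proof eventually_elim
      case (elim w)
      define t where "t = complex_of_real w * (1 + \<zeta> (of_real w))"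
      have "complex_of_real w \<in> ball 0 2" using elim by simp
      note inv = eq[OF this, unfolded Let_def, folded t_def]
      have s_eq: "t / (inverse_kernel e \<kappa> Q t) =
          complex_of_real (w / (\<beta> * (1 + w\<^sup>2) + \<alpha> * w))"
        unfolding inv using elim(1) by (simp add: t_def add.commute)
      have "complex_of_real (w / (\<beta> * (1 + w\<^sup>2) + \<alpha> * w)) *
          moment_gf \<nu> (complex_of_real (w / (\<beta> * (1 + w\<^sup>2) + \<alpha> * w))) = t"
        using elim(3)[unfolded Let_def, folded t_def] unfolding s_eq .
      then show ?case using psi[OF elim(2)] by (simp add: Let_def flip: t_def)
    qed
    then have law: "\<nu> = law" by (rule law_unique[OF nu_props(1,2)])
    define E where "E = ln \<beta> - suminf energy_term"
    note energy = log_energy_law[folded E_def]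
    have E: "\<bar>E + 1 / 4 + e\<^sup>2 * \<kappa>\<^sup>2 / 6\<bar> \<le> K * e ^ 3"
      using pe(2) nu_props(3,4) unfolding law E_def by blast
    have e2: "e\<^sup>2 = 1 / real n" using n0 by (simp add: e_def power_divide)
    have e3: "e ^ 3 = 1 / real n powr (3 / 2)"
    proof -
      have "sqrt (real n) ^ 3 = real n powr (3 / 2)"
        using n0 by (simp add: powr_half_sqrt [symmetric] powr_power)
      then show ?thesis by (simp add: e_def power_divide)
    qed
    \<comment> \<open>The remainder divided by its bound, which is positive.\<close>
    define \<theta> where "\<theta> = (E + 1 / 4 + e\<^sup>2 * \<kappa>\<^sup>2 / 6) / (K * e ^ 3)"
    have Ke: "K * e ^ 3 > 0" using K e(1) by simp
    have th: "\<bar>\<theta>\<bar> \<le> 1" using E Ke by (simp add: \<theta>_def abs_divide divide_le_eq)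
    have "K * e ^ 3 \<noteq> 0" using Ke by linarith
    then have "\<theta> * (K * e ^ 3) = E + 1 / 4 + e\<^sup>2 * \<kappa>\<^sup>2 / 6"
      using nonzero_eq_divide_eq \<theta>_def by blast
    then have "E = - 1 / 4 - \<kappa>\<^sup>2 / (6 * real n) + \<theta> * K / real n powr (3 / 2)"
      by (simp add: e2 e3)
    then have expansion: "free_entropy \<nu> = free_entropy semicircle - ereal ((moment \<mu> 3)\<^sup>2 / (6 * real n))
        + ereal (\<theta> * K / real n powr (3 / 2))"
      unfolding law energy(1) free_entropy_semicircle \<kappa>_def by simp
    show "\<exists>p \<in> borel_measurable borel.
        (\<forall>x. p x \<ge> 0) \<and> \<nu> = density lborel (\<lambda>x. ennreal (p x)) \<and>
        integrable (lborel \<Otimes>\<^sub>M lborel) (\<lambda>(x, y). ln \<bar>x - y\<bar> * p x * p y) \<and>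
        free_entropy \<nu> =
          ereal ((LINT (x, y)|(lborel \<Otimes>\<^sub>M lborel). ln \<bar>x - y\<bar> * p x * p y)
                 + 3 / 4 + ln (2 * pi) / 2) \<and>
        (\<exists>\<theta>::real. \<bar>\<theta>\<bar> \<le> 1 \<and>
          free_entropy \<nu> =
            free_entropy semicircle - ereal ((moment \<mu> 3)\<^sup>2 / (6 * real n))
              + ereal (\<theta> * K / real n powr (3 / 2)))"
    proof (intro bexI[of _ dens] conjI)
      show "\<forall>x. dens x \<ge> 0" using dens_nonneg by blast
      show "\<nu> = density lborel (\<lambda>x. ennreal (dens x))" unfolding law by (rule law_eq_density)
      show "integrable (lborel \<Otimes>\<^sub>M lborel) (\<lambda>(x, y). ln \<bar>x - y\<bar> * dens x * dens y)" by (rule energy(2))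
      show "free_entropy \<nu> = ereal ((LINT (x, y)|(lborel \<Otimes>\<^sub>M lborel). ln \<bar>x - y\<bar> * dens x * dens y)
          + 3 / 4 + ln (2 * pi) / 2)"
        unfolding energy(3) law by (rule energy(1))
      show "\<exists>\<theta>::real. \<bar>\<theta>\<bar> \<le> 1 \<and> free_entropy \<nu> =
            free_entropy semicircle - ereal ((moment \<mu> 3)\<^sup>2 / (6 * real n))
              + ereal (\<theta> * K / real n powr (3 / 2))"
        using th expansion by blast
      show "dens \<in> borel_measurable borel" by (rule dens_measurable)
    qed
  qed
qed

end
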